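(* For a positive number $0<\alpha<1$, a large dimension $d$, and a large positive integer $\mathsf{f}$, there exists a probabilistic $\alpha$-correct two-server quantum oblivious transfer (TQOT) protocol in the visible setting for $\mathsf{f}$ mixed states on $\mathbb{C}^d$ with the following properties. The upload complexity is $2\mathsf{f}$ (bits) and the download complexity is $O(d^2)$ (qubits). It satisfies the user secrecy and the server secrecy. It needs $O(d^2)$-ebit prior entanglement between the servers.
   Context: TQOT protocol. There are a user and two servers; the servers do not communicate with each other, and may share entangled states before the protocol starts (prior entanglement, measured in ebits). Let $\mathcal{S}$ be the set of possible message states, a subset of the states on $\mathbb{C}^d$ (here: all mixed states on $\mathbb{C}^d$). A protocol has two inputs: $\mathsf{f}$ message states $(\rho_1,\dots,\rho_{\mathsf{f}})\in\mathcal{S}^{\mathsf{f}}$ and the label $K\in[\mathsf{f}]=\{1,\dots,\mathsf{f}\}$ of the message intended by the user. The user and the servers communicate in both directions, and the user finally outputs a state $\rho_{out}$ on $\mathbb{C}^d$. Visible setting: both servers have the classical descriptions of all message states, and may apply operations depending on these descriptions. The upload complexity is the sum of the sizes of all communications from the user to the servers; the download complexity is the sum of the sizes of all communications from the servers to the user. Probabilistic protocols and $\alpha$-correctness. A protocol is deterministic if its upload and download complexities are determined only by the protocol and, when user and servers are honest, the output is determined only by $(\rho_1,\dots,\rho_{\mathsf{f}})$ and $K$; otherwise it is probabilistic. In a probabilistic protocol, even when all parties are honest, the user has a random variable $X$ that determines the complexities and the output state. A probabilistic protocol is $\alpha$-correct if (with honest parties), for every $\ell\in[\mathsf{f}]$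 and every $(\rho_1,\dots,\rho_{\mathsf{f}})\in\mathcal{S}^{\mathsf{f}}$, the output for $K=\ell$ equals $\rho_\ell$ with probability at least $\alpha$. User secrecy: when the servers apply attacks (arbitrary operations) and the user is honest, no server obtains information on the user's request $K$; i.e. for each server $J$, the final state $\rho_{Y_J|\ell}$ on Server $J$ when $K=\ell$ equals the same state $\rho_{Y_J}$ for every $\ell\in[\mathsf{f}]$. Server secrecy: when the servers are honest (and the user makes arbitrary operations) and the output state $\rho_{out}$ equals $\rho_K$, the user obtains no information about the other messages $\rho_\ell$ with $\ell\neq K$. *)

theory Defs
  imports
    "Jordan_Normal_Form.Schur_Decomposition"
    "HOL-Library.Landau_Symbols"
begin

text \<open>Finite-dimensional states and operations are complex matrices with explicit dimensions.
  The basis vector \<open>|k, i\<rangle>\<close> of \<open>\<complex>^a \<otimes> \<complex>^n\<close> has index \<open>k * n + i\<close>.\<close>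

definition mtrace :: "complex mat \<Rightarrow> complex" where
  "mtrace A = (\<Sum>i<dim_row A. A $$ (i, i))"

definition kron :: "complex mat \<Rightarrow> complex mat \<Rightarrow> complex mat" where
  "kron A B = mat (dim_row A * dim_row B) (dim_col A * dim_col B)
     (\<lambda>(i, j). A $$ (i div dim_row B, j div dim_col B) * B $$ (i mod dim_row B, j mod dim_col B))"

text \<open>Reduced state on the middle factor of \<open>\<complex>^a \<otimes> \<complex>^n \<otimes> \<complex>^b\<close>.\<close>

definition ptrace :: "nat \<Rightarrow> nat \<Rightarrow> nat \<Rightarrow> complex mat \<Rightarrow> complex mat" where
  "ptrace a n b M = mat n n
     (\<lambda>(i, j). \<Sum>k<a. \<Sum>l<b. M $$ ((k * n + i) * b + l, (k * n + j) * b + l))"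

text \<open>The order on \<open>complex\<close> makes \<open>0 \<le> z\<close> mean that \<open>z\<close> is real and nonnegative, so
  the positivity condition below includes hermiticity.\<close>

definition density :: "nat \<Rightarrow> complex mat \<Rightarrow> bool" where
  "density n A \<longleftrightarrow> A \<in> carrier_mat n n \<and>
     (\<forall>v \<in> carrier_vec n. 0 \<le> (A *\<^sub>v v) \<bullet>c v) \<and> mtrace A = 1"

text \<open>Completely positive maps into the operators on \<open>\<complex>^m\<close>, given by a list of Kraus operators.\<close>

definition kraus_apply :: "nat \<Rightarrow> complex mat list \<Rightarrow> complex mat \<Rightarrow> complex mat" where
  "kraus_apply m Ks \<rho> = mat m m (\<lambda>(i, j). \<Sum>A\<leftarrow>Ks. (A * \<rho> * mat_adjoint A) $$ (i, j))"

definition trace_preserving :: "nat \<Rightarrow> complex mat list \<Rightarrow> bool" where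
  "trace_preserving n Ks \<longleftrightarrow>
     mat n n (\<lambda>(i, j). \<Sum>A\<leftarrow>Ks. (mat_adjoint A * A) $$ (i, j)) = 1\<^sub>m n"

text \<open>\<open>e\<close> ebits: the \<open>e\<close>-fold tensor power of the Bell state, with the \<open>e\<close> qubits of each
  server grouped together.\<close>

definition ebit_state :: "nat \<Rightarrow> complex mat" where
  "ebit_state e = (let N = 2 ^ e in mat (N * N) (N * N)
     (\<lambda>(i, j). if i div N = i mod N \<and> j div N = j mod N then 1 / of_nat N else 0))"

definition bits :: "nat \<Rightarrow> bool list list" where
  "bits n = List.n_lists n [False, True]"

text \<open>Communication pattern: in round \<open>t < rounds\<close> the user sends \<open>up1 t\<close> and \<open>up2 t\<close>
  classical bits to the two servers, which answer with \<open>down1 t\<close> and \<open>down2 t\<close> qubits.\<close>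

record pattern =
  rounds :: nat
  up1 :: "nat \<Rightarrow> nat"
  up2 :: "nat \<Rightarrow> nat"
  down1 :: "nat \<Rightarrow> nat"
  down2 :: "nat \<Rightarrow> nat"

text \<open>\<open>smem t\<close> is the dimension of the server's register before round \<open>t\<close>; \<open>act t q\<close> is its
  operation in round \<open>t\<close> on receiving the bit string \<open>q\<close>. Ancillas, measurements and records of
  earlier bit strings are part of the operation and of the register. The two servers never
  communicate; only the initial state of their registers may be correlated.\<close>

record server =
  smem :: "nat \<Rightarrow> nat"
  act :: "nat \<Rightarrow> bool list \<Rightarrow> complex mat list"

definition server_strategy :: "nat \<Rightarrow> (nat \<Rightarrow> nat) \<Rightarrow> (nat \<Rightarrow> nat) \<Rightarrow> server \<Rightarrow> bool" where
  "server_strategy r up down s \<longleftrightarrow>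
     (\<forall>t<r. \<forall>q \<in> set (bits (up t)).
        set (act s t q) \<subseteq> carrier_mat (smem s (Suc t) * 2 ^ down t) (smem s t) \<and>
        trace_preserving (smem s t) (act s t q))"

text \<open>\<open>enc t\<close> is an instrument whose classical outcomes are the pairs \<open>(q1, q2)\<close> sent to the
  servers in round \<open>t\<close>, and \<open>umem t\<close> is the dimension of the register kept by the user while
  waiting for the answers. After the last round, the instrument \<open>dec\<close> yields the outcome
  \<open>x < outcomes\<close>, the value of the random variable \<open>X\<close>, together with the output state on \<open>\<complex>^d\<close>
  and everything else the user keeps, on \<open>\<complex>^aux\<close>.\<close>

record user =
  umem :: "nat \<Rightarrow> nat"
  enc :: "nat \<Rightarrow> bool list \<Rightarrow> bool list \<Rightarrow> complex mat list"
  outcomes :: nat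
  aux :: nat
  dec :: "nat \<Rightarrow> complex mat list"

text \<open>Dimension of the user's system before round \<open>t\<close>, with the answers of the previous round.\<close>

fun hold :: "pattern \<Rightarrow> user \<Rightarrow> nat \<Rightarrow> nat" where
  "hold c u 0 = 1"
| "hold c u (Suc t) = 2 ^ down1 c t * umem u t * 2 ^ down2 c t"

definition user_strategy :: "pattern \<Rightarrow> nat \<Rightarrow> user \<Rightarrow> bool" where
  "user_strategy c d u \<longleftrightarrow>
     (\<forall>t<rounds c.
        (\<forall>q1 \<in> set (bits (up1 c t)). \<forall>q2 \<in> set (bits (up2 c t)).
           set (enc u t q1 q2) \<subseteq> carrier_mat (umem u t) (hold c u t)) \<and>
        trace_preserving (hold c u t)
          (concat [enc u t q1 q2. q1 \<leftarrow> bits (up1 c t), q2 \<leftarrow> bits (up2 c t)])) \<and>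
     (\<forall>x<outcomes u. set (dec u x) \<subseteq> carrier_mat (d * aux u) (hold c u (rounds c))) \<and>
     trace_preserving (hold c u (rounds c)) (concat [dec u x. x \<leftarrow> [0..<outcomes u]])"

text \<open>The joint system is ordered as Server 1, user, Server 2. Server 1 puts its answer in the right
  factor and Server 2 in the left factor of its output, so that sending an answer only
  regroups \<open>(S1 \<otimes> D1) \<otimes> U \<otimes> (D2 \<otimes> S2)\<close> as \<open>S1 \<otimes> (D1 \<otimes> U \<otimes> D2) \<otimes> S2\<close>.\<close>

definition round_ops :: "pattern \<Rightarrow> server \<Rightarrow> server \<Rightarrow> user \<Rightarrow> nat \<Rightarrow> complex mat list" where
  "round_ops c s1 s2 u t =
     [kron A (kron V B). q1 \<leftarrow> bits (up1 c t), q2 \<leftarrow> bits (up2 c t),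
        A \<leftarrow> act s1 t q1, V \<leftarrow> enc u t q1 q2, B \<leftarrow> act s2 t q2]"

fun joint_state ::
  "pattern \<Rightarrow> server \<Rightarrow> server \<Rightarrow> user \<Rightarrow> complex mat \<Rightarrow> nat \<Rightarrow> complex mat" where
  "joint_state c s1 s2 u \<sigma> 0 = \<sigma>"
| "joint_state c s1 s2 u \<sigma> (Suc t) =
     kraus_apply (smem s1 (Suc t) * hold c u (Suc t) * smem s2 (Suc t))
       (round_ops c s1 s2 u t) (joint_state c s1 s2 u \<sigma> t)"

text \<open>Final state of the user for the outcome \<open>x\<close>: not normalized, its trace is the probability
  of \<open>x\<close>.\<close>

definition user_state ::
  "pattern \<Rightarrow> nat \<Rightarrow> server \<Rightarrow> server \<Rightarrow> user \<Rightarrow> complex mat \<Rightarrow> nat \<Rightarrow> complex mat" where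
  "user_state c d s1 s2 u \<sigma> x =
     (let r = rounds c; a = smem s1 r; n = d * aux u; b = smem s2 r in
      ptrace a n b (kraus_apply (a * n * b)
        [kron (1\<^sub>m a) (kron D (1\<^sub>m b)). D \<leftarrow> dec u x] (joint_state c s1 s2 u \<sigma> r)))"

definition server1_state ::
  "pattern \<Rightarrow> server \<Rightarrow> server \<Rightarrow> user \<Rightarrow> complex mat \<Rightarrow> complex mat" where
  "server1_state c s1 s2 u \<sigma> = (let r = rounds c in
     ptrace 1 (smem s1 r) (hold c u r * smem s2 r) (joint_state c s1 s2 u \<sigma> r))"

definition server2_state ::
  "pattern \<Rightarrow> server \<Rightarrow> server \<Rightarrow> user \<Rightarrow> complex mat \<Rightarrow> complex mat" where
  "server2_state c s1 s2 u \<sigma> = (let r = rounds c in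
     ptrace (smem s1 r * hold c u r) (smem s2 r) 1 (joint_state c s1 s2 u \<sigma> r))"

text \<open>A protocol in the visible setting: the honest servers \<open>srv1\<close> and \<open>srv2\<close> depend on the
  descriptions of all message states, the honest user \<open>usr\<close> on the label only.\<close>

record protocol =
  pat :: pattern
  ebits :: nat
  srv1 :: "(nat \<Rightarrow> complex mat) \<Rightarrow> server"
  srv2 :: "(nat \<Rightarrow> complex mat) \<Rightarrow> server"
  usr :: "nat \<Rightarrow> user"

definition messages :: "nat \<Rightarrow> nat \<Rightarrow> (nat \<Rightarrow> complex mat) set" where
  "messages d f = {\<rho>. \<forall>l \<in> {1..f}. density d (\<rho> l)}"

definition tqot_protocol :: "nat \<Rightarrow> nat \<Rightarrow> protocol \<Rightarrow> bool" where
  "tqot_protocol d f P \<longleftrightarrow>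
     (\<forall>\<rho> \<in> messages d f.
        server_strategy (rounds (pat P)) (up1 (pat P)) (down1 (pat P)) (srv1 P \<rho>) \<and>
        server_strategy (rounds (pat P)) (up2 (pat P)) (down2 (pat P)) (srv2 P \<rho>) \<and>
        smem (srv1 P \<rho>) 0 = 2 ^ ebits P \<and> smem (srv2 P \<rho>) 0 = 2 ^ ebits P) \<and>
     (\<forall>K \<in> {1..f}. user_strategy (pat P) d (usr P K))"

definition upload_bits :: "protocol \<Rightarrow> nat" where
  "upload_bits P = (\<Sum>t<rounds (pat P). up1 (pat P) t + up2 (pat P) t)"

definition download_qubits :: "protocol \<Rightarrow> nat" where
  "download_qubits P = (\<Sum>t<rounds (pat P). down1 (pat P) t + down2 (pat P) t)"

text \<open>Run with honest servers holding the messages \<open>\<rho>\<close> and an arbitrary user \<open>u\<close>.\<close>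

definition final_state ::
  "nat \<Rightarrow> protocol \<Rightarrow> (nat \<Rightarrow> complex mat) \<Rightarrow> user \<Rightarrow> nat \<Rightarrow> complex mat" where
  "final_state d P \<rho> u x =
     user_state (pat P) d (srv1 P \<rho>) (srv2 P \<rho>) u (ebit_state (ebits P)) x"

definition output_state ::
  "nat \<Rightarrow> protocol \<Rightarrow> (nat \<Rightarrow> complex mat) \<Rightarrow> user \<Rightarrow> nat \<Rightarrow> complex mat" where
  "output_state d P \<rho> u x = ptrace 1 d (aux u) (final_state d P \<rho> u x)"

definition outcome_prob ::
  "nat \<Rightarrow> protocol \<Rightarrow> (nat \<Rightarrow> complex mat) \<Rightarrow> user \<Rightarrow> nat \<Rightarrow> real" where
  "outcome_prob d P \<rho> u x = Re (mtrace (final_state d P \<rho> u x))"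

text \<open>Conditioned on \<open>X = x\<close>, the output is the normalized state \<open>\<omega>\<close> (void when \<open>x\<close> has
  probability zero).\<close>

definition outputs ::
  "nat \<Rightarrow> protocol \<Rightarrow> (nat \<Rightarrow> complex mat) \<Rightarrow> user \<Rightarrow> nat \<Rightarrow> complex mat \<Rightarrow> bool" where
  "outputs d P \<rho> u x \<omega> \<longleftrightarrow>
     output_state d P \<rho> u x = of_real (outcome_prob d P \<rho> u x) \<cdot>\<^sub>m \<omega>"

text \<open>The complexities are fixed by the communication pattern, so being deterministic only
  concerns the output.\<close>

definition deterministic :: "nat \<Rightarrow> nat \<Rightarrow> protocol \<Rightarrow> bool" where
  "deterministic d f P \<longleftrightarrow>
     (\<forall>K \<in> {1..f}. \<forall>\<rho> \<in> messages d f. \<exists>\<omega>. density d \<omega> \<and>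
        (\<forall>x<outcomes (usr P K). outputs d P \<rho> (usr P K) x \<omega>))"

definition alpha_correct :: "real \<Rightarrow> nat \<Rightarrow> nat \<Rightarrow> protocol \<Rightarrow> bool" where
  "alpha_correct \<alpha> d f P \<longleftrightarrow>
     (\<forall>l \<in> {1..f}. \<forall>\<rho> \<in> messages d f.
        \<alpha> \<le> (\<Sum>x | x < outcomes (usr P l) \<and> outputs d P \<rho> (usr P l) x (\<rho> l).
               outcome_prob d P \<rho> (usr P l) x))"

text \<open>Attacking servers may start from any shared state and apply any local operations; they have
  to follow only the sizes of the messages.\<close>

definition user_secret :: "nat \<Rightarrow> protocol \<Rightarrow> bool" where
  "user_secret f P \<longleftrightarrow>
     (\<forall>s1 s2 \<sigma>.
        server_strategy (rounds (pat P)) (up1 (pat P)) (down1 (pat P)) s1 \<longrightarrow>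
        server_strategy (rounds (pat P)) (up2 (pat P)) (down2 (pat P)) s2 \<longrightarrow>
        density (smem s1 0 * smem s2 0) \<sigma> \<longrightarrow>
        (\<exists>\<tau>1 \<tau>2. \<forall>K \<in> {1..f}.
           server1_state (pat P) s1 s2 (usr P K) \<sigma> = \<tau>1 \<and>
           server2_state (pat P) s1 s2 (usr P K) \<sigma> = \<tau>2))"

text \<open>No information about the other messages: the final state of the user, including the
  probability of the outcome, is a function of \<open>\<rho> K\<close>. For the honest user this is required at every
  message tuple for which the output is \<open>\<rho> K\<close>. A malicious user may output a constant state, which
  is right for some tuples by coincidence, so there "the output equals \<open>\<rho> K\<close>" means that the outcome
  \<open>x\<close> yields \<open>\<rho> K\<close> whatever the messages are.\<close>

definition server_secret :: "nat \<Rightarrow> nat \<Rightarrow> protocol \<Rightarrow> bool" where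
  "server_secret d f P \<longleftrightarrow>
     (\<forall>K \<in> {1..f}.
        (\<forall>x<outcomes (usr P K). \<forall>\<rho> \<in> messages d f. \<forall>\<rho>' \<in> messages d f.
           0 < outcome_prob d P \<rho> (usr P K) x \<longrightarrow>
           outputs d P \<rho> (usr P K) x (\<rho> K) \<longrightarrow> \<rho>' K = \<rho> K \<longrightarrow>
           final_state d P \<rho>' (usr P K) x = final_state d P \<rho> (usr P K) x) \<and>
        (\<forall>u. user_strategy (pat P) d u \<longrightarrow>
           (\<forall>x<outcomes u.
              (\<forall>\<rho> \<in> messages d f. outputs d P \<rho> u x (\<rho> K)) \<longrightarrow>
              (\<forall>\<rho> \<in> messages d f. \<forall>\<rho>' \<in> messages d f. \<rho>' K = \<rho> K \<longrightarrow>
                 final_state d P \<rho>' u x = final_state d P \<rho> u x))))"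

end

(* Write each message as a mixture of vectors with entries x + iy, |x|, |y| <= 1, and store it in the
   angles arccos x, arccos y. The servers share a maximally entangled state of e ebits, receive a
   uniformly random query q and its neighbour q xor e_K, apply opposite diagonal phases that are
   linear in the query, and send everything to the user. The phases of all messages but the K-th
   cancel. The index of the shared state consists of n digits; each digit is a trial in which the
   user, since cos x is the mean of cis x and cis (-x), recovers the message with probability of
   order 1/d, so n = O(d) trials of O(log d) qubits suffice. Each query alone is uniform, which gives
   user secrecy.

   For server secrecy, a user whose queries differ in a message other than the K-th must decode
   rho_K correctly for all values of that message. The angles are chosen such that, on an infinite
   family of messages, the phases are cis (tau C_k) with integers C_k that determine the phases of
   all messages. Testing against rho_K = |0><0| and |1><1| then shows that such a user never obtains
   the outcome. *)

theory Submission
  imports Defs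
begin

section \<open>Frequencies of phase vectors\<close>

text \<open>Exact secrecy is demanded against a user with arbitrary queries, while the angles come
  from an uncontrolled choice. For each query pair the user's vector has entries that are sums over
  \<open>k\<close> of \<open>final_coeff u A V i k * cis (phase_diff \<rho> q1 q2 k)\<close>, with
  coefficients free of the messages. Correctness for all messages makes such sums vanish, but a
  conclusion about the coefficients needs linear independence of phase vectors, which an arbitrary
  choice of angles need not provide. It is therefore built into the choice: over \<open>n\<close>
  trials each angle is counted with an integer between \<open>- n\<close> and \<open>n\<close>, and
  geometric angles in base \<open>2 * n + 1\<close> turn different counts into different
  frequencies. The coefficients then sum to zero over each frequency class, where every message
  phase is constant.

  The choice depends on the message matrix alone, so both servers make the same one without
  communicating. It need not return the parameter from which a matrix was built; that infinitely
  many parameters occur is seen from the entry \<open>(0, 0)\<close> of the matrix.\<close>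

lemma signed_digits_zero:
  fixes x :: "nat \<Rightarrow> int" and B :: int
  assumes "(\<Sum>q<m. x q * B ^ q) = 0" and "\<And>q. q < m \<Longrightarrow> \<bar>x q\<bar> < B" and "q < m"
  shows "x q = 0"
  using assms
proof (induction m arbitrary: x q)
  case 0
  then show ?case by simp
next
  case (Suc m)
  have B: "0 < B" using Suc.prems(2)[of 0] by simp
  have split: "x 0 + B * (\<Sum>q<m. x (Suc q) * B ^ q) = 0"
    using Suc.prems(1) unfolding sum.lessThan_Suc_shift
    by (simp add: sum_distrib_left algebra_simps)
  then have "x 0 = B * - (\<Sum>q<m. x (Suc q) * B ^ q)" by simp
  \<comment> \<open>Modulo \<open>B\<close> only the lowest digit survives; being smaller than
    \<open>B\<close> in absolute value it is zero, and dividing by \<open>B\<close> shifts the other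
    digits down.\<close>
  then have "B dvd x 0" by (rule dvdI)
  then have x0: "x 0 = 0"
    using Suc.prems(2)[of 0] dvd_imp_le_int[of "x 0" B] B by (cases "x 0 = 0") auto
  show ?case
  proof (cases q)
    case 0
    then show ?thesis using x0 by simp
  next
    case (Suc q')
    have "(\<Sum>q<m. x (Suc q) * B ^ q) = 0" using split x0 B by simp
    then show ?thesis
      using Suc.IH[of "\<lambda>q. x (Suc q)" q'] Suc.prems Suc by simp
  qed
qed

text \<open>Multiplied by a power of \<open>cis \<tau>\<close> that makes all exponents nonnegative,
  the hypothesis says that a polynomial has infinitely many roots on the unit circle. It is
  therefore zero, and each of its coefficients is the sum of \<open>h\<close> over one frequency
  class.\<close>

lemma cis_frequency_independence:
  fixes h :: "nat \<Rightarrow> complex" and C :: "nat \<Rightarrow> int"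
  assumes T: "infinite T" "T \<subseteq> {0<..<pi}"
    and zero: "\<And>\<tau>. \<tau> \<in> T \<Longrightarrow> (\<Sum>k<M. h k * cis (\<tau> * of_int (C k))) = 0"
  shows "(\<Sum>k | k < M \<and> C k = v. h k) = 0"
proof (cases "\<exists>k<M. C k = v")
  case False
  then have "{k. k < M \<and> C k = v} = {}" by blast
  then show ?thesis by (metis sum.empty)
next
  case True
  then obtain k0 where k0: "k0 < M" "C k0 = v" by blast
  \<comment> \<open>A common shift that turns all frequencies into natural exponents and leaves
    unchanged which of them coincide.\<close>
  define S where "S = (\<Sum>k<M. \<bar>C k\<bar>)"
  have S: "0 \<le> C k + S" if "k < M" for k
  proof -
    have "\<bar>C k\<bar> \<le> S" unfolding S_def by (rule member_le_sum) (use that in auto)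
    then show ?thesis by linarith
  qed
  define E where "E k = nat (C k + S)" for k
  define p where "p = (\<Sum>k<M. monom (h k) (E k))"
  have root: "poly p (cis \<tau>) = 0" if "\<tau> \<in> T" for \<tau>
  proof -
    have "poly p (cis \<tau>) = (\<Sum>k<M. h k * cis \<tau> ^ E k)"
      by (simp add: p_def poly_sum poly_monom)
    also have "\<dots> = (\<Sum>k<M. cis (\<tau> * of_int S) * (h k * cis (\<tau> * of_int (C k))))"
    proof (rule sum.cong[OF refl])
      fix k assume "k \<in> {..<M}"
      then have "real (E k) = of_int (C k + S)" using S[of k] by (simp add: E_def)
      then have "cis \<tau> ^ E k = cis (of_int (C k + S) * \<tau>)"
        by (simp only: Complex.DeMoivre)
      also have "\<dots> = cis (\<tau> * of_int S) * cis (\<tau> * of_int (C k))"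
        by (simp add: cis_mult algebra_simps)
      finally show "h k * cis \<tau> ^ E k = cis (\<tau> * of_int S) * (h k * cis (\<tau> * of_int (C k)))"
        by simp
    qed
    also have "\<dots> = 0" using zero[OF that] by (simp flip: sum_distrib_left)
    finally show ?thesis .
  qed
  have "inj_on cis T"
  proof (rule inj_onI)
    fix x y assume "x \<in> T" "y \<in> T" and eq: "cis x = cis y"
    then have "x \<in> {0<..<pi}" "y \<in> {0<..<pi}" using T(2) by blast+
    moreover have "cos x = cos y" using arg_cong[OF eq, of Re] by simp
    ultimately show "x = y" using cos_inj_pi[of x y] by auto
  qed
  then have "infinite (cis ` T)" using T(1) by (simp add: finite_image_iff)
  moreover have "cis ` T \<subseteq> {z. poly p z = 0}" using root by blast
  ultimately have "infinite {z. poly p z = 0}" by (rule infinite_super[rotated])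
  then have "p = 0" using poly_roots_finite[of p] by blast
  then have "0 = coeff p (E k0)" by simp
  also have "\<dots> = (\<Sum>k<M. if E k = E k0 then h k else 0)"
    by (simp add: p_def coeff_sum)
  also have "\<dots> = (\<Sum>k<M. if C k = v then h k else 0)"
  proof (rule sum.cong[OF refl])
    fix k assume "k \<in> {..<M}"
    then have "E k = E k0 \<longleftrightarrow> C k = v"
      using S[of k] S[of k0] k0 by (simp add: E_def eq_nat_nat_iff)
    then show "(if E k = E k0 then h k else 0) = (if C k = v then h k else 0)" by simp
  qed
  also have "\<dots> = (\<Sum>k | k < M \<and> C k = v. h k)"
    by (auto intro!: sum.mono_neutral_cong_right split: if_splits)
  finally show ?thesis by simp
qed

text \<open>On a frequency class \<open>c\<close> is a nonzero constant, so already the class sum of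
  \<open>g\<close> is zero, and any other class function \<open>c'\<close> may be inserted. This
  carries a vanishing sum from one infinite family of messages to arbitrary messages.\<close>

lemma class_function_sum_zero:
  fixes g c c' :: "nat \<Rightarrow> complex" and C :: "nat \<Rightarrow> int"
  assumes T: "infinite T" "T \<subseteq> {0<..<pi}"
    and zero: "\<And>\<tau>. \<tau> \<in> T \<Longrightarrow> (\<Sum>k<M. g k * c k * cis (\<tau> * of_int (C k))) = 0"
    and c: "\<And>k. c k \<noteq> 0" "\<And>k l. C k = C l \<Longrightarrow> c k = c l"
    and c': "\<And>k l. C k = C l \<Longrightarrow> c' k = c' l"
  shows "(\<Sum>k<M. g k * c' k) = 0"
proof -
  have "(\<Sum>k | k < M \<and> C k = C l. g k * c' k) = 0" for l
  proof -
    have "0 = (\<Sum>k | k < M \<and> C k = C l. g k * c k)"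
      by (rule cis_frequency_independence[OF T zero, symmetric])
    also have "\<dots> = (\<Sum>k | k < M \<and> C k = C l. g k * c l)"
      by (intro sum.cong arg_cong2[where f = times] c(2)) auto
    also have "\<dots> = (\<Sum>k | k < M \<and> C k = C l. g k) * c l"
      by (simp add: sum_distrib_right)
    finally have "(\<Sum>k | k < M \<and> C k = C l. g k) * c' l = 0" using c(1) by simp
    also have "(\<Sum>k | k < M \<and> C k = C l. g k) * c' l = (\<Sum>k | k < M \<and> C k = C l. g k * c' k)"
      unfolding sum_distrib_right by (intro sum.cong arg_cong2[where f = times] c') auto
    finally show ?thesis .
  qed
  then have "(\<Sum>y\<in>C ` {..<M}. \<Sum>k | k \<in> {..<M} \<and> C k = y. g k * c' k) = 0"
    by (intro sum.neutral) auto
  then show ?thesis by (subst (asm) sum.group) auto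
qed

text \<open>A trial index \<open>\<kappa> < m\<close> carries the angle number \<open>\<kappa> div 2\<close> with the sign given by the parity
  of \<open>\<kappa>\<close>; the base-\<open>m\<close> digits of \<open>k < m ^ n\<close> are the indices of \<open>n\<close> independent trials.\<close>

definition bit_sign :: "nat \<Rightarrow> int" where
  "bit_sign \<kappa> = (if even \<kappa> then 1 else - 1)"

text \<open>The signed number of times that angle \<open>q\<close> occurs among the \<open>n\<close>
  digits of \<open>k\<close>; with it the product of the trial phases becomes one linear form in the
  angles.\<close>

fun expo :: "nat \<Rightarrow> nat \<Rightarrow> nat \<Rightarrow> nat \<Rightarrow> int" where
  "expo m 0 k q = 0"
| "expo m (Suc n) k q =
     expo m n (k div m) q + (if k mod m div 2 = q then bit_sign (k mod m) else 0)"

definition angle :: "nat \<Rightarrow> nat \<Rightarrow> (nat \<Rightarrow> real) \<Rightarrow> nat \<Rightarrow> real" where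
  "angle m n \<beta> k = (\<Sum>q<m. of_int (expo m n k q) * \<beta> q)"

text \<open>The counts \<open>expo\<close> read as signed digits. Two counts differ by at most
  \<open>2 * n\<close>, which is why \<open>2 * n + 1\<close> is a base in which they can be
  recovered.\<close>

definition freq :: "nat \<Rightarrow> nat \<Rightarrow> nat \<Rightarrow> int" where
  "freq m n k = (\<Sum>q<m. expo m n k q * (2 * int n + 1) ^ q)"

definition geometric_angles :: "nat \<Rightarrow> real \<Rightarrow> nat \<Rightarrow> real" where
  "geometric_angles n \<tau> q = \<tau> * (2 * real n + 1) ^ q"

lemma abs_expo_le: "\<bar>expo m n k q\<bar> \<le> int n"
proof (induction n arbitrary: k)
  case (Suc n)
  from Suc[of "k div m"] show ?case by (auto simp: bit_sign_def)
qed simp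

lemma angle_0 [simp]: "angle m 0 \<beta> k = 0"
  by (simp add: angle_def)

lemma angle_Suc:
  assumes "0 < m"
  shows "angle m (Suc n) \<beta> k =
    angle m n \<beta> (k div m) + of_int (bit_sign (k mod m)) * \<beta> (k mod m div 2)"
proof -
  have lt: "k mod m div 2 < m"
    using assms by (meson div_le_dividend le_less_trans mod_less_divisor)
  have "(\<Sum>q<m. of_int (if k mod m div 2 = q then bit_sign (k mod m) else 0) * \<beta> q) =
      (\<Sum>q<m. if k mod m div 2 = q then of_int (bit_sign (k mod m)) * \<beta> q else 0)"
    by (rule sum.cong) auto
  then show ?thesis
    using lt by (simp add: angle_def algebra_simps sum.distrib)
qed

lemma angle_geometric: "angle m n (geometric_angles n \<tau>) k = \<tau> * of_int (freq m n k)"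
  by (simp add: angle_def freq_def geometric_angles_def sum_distrib_left algebra_simps)

text \<open>Equal frequencies force equal counts, hence equal phases for every
  \<open>\<beta>\<close> and not only for geometric angles. So the phases of all messages are
  functions of the frequency class.\<close>

lemma freq_determines_angle:
  assumes "freq m n k = freq m n l"
  shows "angle m n \<beta> k = angle m n \<beta> l"
proof -
  have "expo m n k q = expo m n l q" if "q < m" for q
  proof -
    have "(\<Sum>q<m. (expo m n k q - expo m n l q) * (2 * int n + 1) ^ q) = 0"
      using assms by (simp add: freq_def left_diff_distrib sum_subtractf)
    moreover have "\<bar>expo m n k q - expo m n l q\<bar> < 2 * int n + 1" for q
      using abs_expo_le[of m n k q] abs_expo_le[of m n l q] by linarith
    ultimately show ?thesis
      using signed_digits_zero[of "\<lambda>q. expo m n k q - expo m n l q" "2 * int n + 1" m q] that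
      by simp
  qed
  then show ?thesis by (simp add: angle_def)
qed

section \<open>Gram representation of density matrices\<close>

lemma complex_le_real: "0 \<le> (z::complex) \<longleftrightarrow> Im z = 0 \<and> 0 \<le> Re z"
  by (auto simp: less_eq_complex_def)

definition pos_semidef :: "nat \<Rightarrow> (nat \<Rightarrow> nat \<Rightarrow> complex) \<Rightarrow> bool" where
  "pos_semidef n a \<longleftrightarrow> (\<forall>v. 0 \<le> (\<Sum>i<n. \<Sum>j<n. cnj (v i) * a i j * v j))"

lemma pos_semidefD: "pos_semidef n a \<Longrightarrow> 0 \<le> (\<Sum>i<n. \<Sum>j<n. cnj (v i) * a i j * v j)"
  by (simp add: pos_semidef_def)

lemma pos_semidef_diag:
  assumes "pos_semidef n a" "i < n"
  shows "0 \<le> a i i"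
proof -
  have "0 \<le> (\<Sum>k<n. \<Sum>j<n. cnj (of_bool (k = i)) * a k j * of_bool (j = i))"
    by (rule pos_semidefD[OF assms(1)])
  also have "\<dots> = (\<Sum>k<n. \<Sum>j<n. if k = i then if j = i then a k j else 0 else 0)"
    by (intro sum.cong) auto
  also have "\<dots> = (\<Sum>k<n. if k = i then \<Sum>j<n. if j = i then a k j else 0 else 0)"
    by (intro sum.cong) auto
  finally show ?thesis using assms(2) by simp
qed

lemma pos_semidef_pair:
  assumes psd: "pos_semidef n a" and ij: "i < n" "j < n" "i \<noteq> j"
  shows "0 \<le> cnj x * a i i * x + cnj x * a i j * y + cnj y * a j i * x + cnj y * a j j * y"
proof -
  define v where "v k = (if k = i then x else if k = j then y else 0)" for k
  have inner: "(\<Sum>l<n. cnj (v k) * a k l * v l) =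
      cnj (v k) * a k i * x + cnj (v k) * a k j * y" for k
  proof -
    have "(\<Sum>l<n. cnj (v k) * a k l * v l) = (\<Sum>l\<in>{i, j}. cnj (v k) * a k l * v l)"
      by (rule sum.mono_neutral_right) (use ij in \<open>auto simp: v_def\<close>)
    then show ?thesis using ij by (simp add: v_def)
  qed
  have "(\<Sum>k<n. \<Sum>l<n. cnj (v k) * a k l * v l) =
      (\<Sum>k\<in>{i, j}. cnj (v k) * a k i * x + cnj (v k) * a k j * y)"
    unfolding inner by (rule sum.mono_neutral_right) (use ij in \<open>auto simp: v_def\<close>)
  also have "\<dots> = cnj x * a i i * x + cnj x * a i j * y + cnj y * a j i * x + cnj y * a j j * y"
    using ij by (simp add: v_def)
  finally show ?thesis using pos_semidefD[OF psd, of v] by simp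
qed

lemma pos_semidef_hermitian:
  assumes psd: "pos_semidef n a" and ij: "i < n" "j < n"
  shows "a j i = cnj (a i j)"
proof (cases "i = j")
  case True
  then show ?thesis
    using pos_semidef_diag[OF psd ij(1)] by (simp add: complex_le_real complex_eq_iff)
next
  case False
  have d: "Im (a i i) = 0" "Im (a j j) = 0"
    using pos_semidef_diag[OF psd] ij by (auto simp: complex_le_real)
  \<comment> \<open>The test vectors \<open>(1, 1)\<close> and \<open>(\<i>, 1)\<close> compare
    imaginary and real parts of the two entries.\<close>
  have "Im (a i j + a j i) = 0"
    using pos_semidef_pair[OF psd ij False, of 1 1] d by (simp add: complex_le_real)
  moreover have "Im (- \<i> * a i j + \<i> * a j i) = 0"
    using pos_semidef_pair[OF psd ij False, of "\<i>" 1] d by (simp add: complex_le_real)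
  ultimately show ?thesis by (simp add: complex_eq_iff)
qed

text \<open>On the vector with entries \<open>1\<close> at \<open>i\<close> and
  \<open>- t * cnj (a i j)\<close> at \<open>j\<close> the form is affine in \<open>t\<close> with
  slope \<open>- 2 * (cmod (a i j))^2\<close>, so it stays nonnegative only if the slope is
  zero.\<close>

lemma pos_semidef_zero_row:
  assumes psd: "pos_semidef n a" and ij: "i < n" "j < n" and zero: "a j j = 0"
  shows "a i j = 0"
proof (cases "i = j")
  case False
  define s where "s = Re (a i i)"
  have aii: "a i i = of_real s" "0 \<le> s"
    using pos_semidef_diag[OF psd ij(1)] by (auto simp: complex_le_real complex_eq_iff s_def)
  have aji: "a j i = cnj (a i j)" by (rule pos_semidef_hermitian[OF psd ij])
  define N where "N = (cmod (a i j))\<^sup>2"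
  have N: "a i j * cnj (a i j) = of_real N"
    unfolding N_def by (rule complex_norm_square[symmetric])
  have "0 \<le> (of_real s - 2 * of_real t * of_real N :: complex)" for t :: real
  proof -
    have "cnj 1 * a i i * 1 + cnj 1 * a i j * (- of_real t * cnj (a i j)) +
        cnj (- of_real t * cnj (a i j)) * a j i * 1 +
        cnj (- of_real t * cnj (a i j)) * a j j * (- of_real t * cnj (a i j)) =
        of_real s - of_real t * (a i j * cnj (a i j)) - of_real t * (a i j * cnj (a i j))"
      by (simp add: zero aii aji algebra_simps)
    also have "\<dots> = of_real s - 2 * of_real t * of_real N"
      by (simp add: N)
    finally show ?thesis
      using pos_semidef_pair[OF psd ij False, of 1 "- of_real t * cnj (a i j)"] by metis
  qed
  then have "2 * t * N \<le> s" for t by (simp add: complex_le_real)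
  \<comment> \<open>For nonzero \<open>N\<close> this value of \<open>t\<close> turns the bound into
    \<open>s + 1 \<le> s\<close>.\<close>
  from this[of "(s + 1) / (2 * N)"] have "N = 0" by (cases "N = 0") auto
  then show ?thesis by (simp add: N_def)
qed (use zero in simp)

text \<open>Completing the square: the complement at \<open>v\<close> is the form of
  \<open>a\<close> at \<open>v\<close> extended by the minimizing last coordinate
  \<open>- S / a n n\<close>.\<close>

lemma pos_semidef_Schur_complement:
  assumes psd: "pos_semidef (Suc n) a" and nz: "a n n \<noteq> 0"
  shows "pos_semidef n (\<lambda>i j. a i j - a i n * a n j / a n n)"
  unfolding pos_semidef_def
proof
  fix v :: "nat \<Rightarrow> complex"
  define S where "S = (\<Sum>j<n. a n j * v j)"
  define w where "w = v(n := - S / a n n)"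
  have herm: "a i n = cnj (a n i)" if "i < n" for i
    using pos_semidef_hermitian[OF psd, of n i] that by simp
  have ann: "cnj (a n n) = a n n"
    using pos_semidef_hermitian[OF psd, of n n] by simp
  have cS: "(\<Sum>i<n. cnj (v i) * a i n) = cnj S"
    unfolding S_def cnj_sum by (rule sum.cong) (simp_all add: herm)
  define x where "x = - S / a n n"
  have w: "w i = v i" if "i < n" for i using that by (simp add: w_def)
  have wn: "w n = x" by (simp add: w_def x_def)
  have "(\<Sum>i<Suc n. \<Sum>j<Suc n. cnj (w i) * a i j * w j) =
      (\<Sum>i<n. (\<Sum>j<n. cnj (v i) * a i j * v j) + cnj (v i) * a i n * x) +
      ((\<Sum>j<n. cnj x * a n j * v j) + cnj x * a n n * x)"
    unfolding sum.lessThan_Suc wn by (intro arg_cong2[where f = plus] sum.cong) (simp_all add: w)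
  also have "(\<Sum>j<n. cnj x * a n j * v j) = cnj x * S"
    unfolding S_def sum_distrib_left by (simp add: mult.assoc)
  also have "(\<Sum>i<n. (\<Sum>j<n. cnj (v i) * a i j * v j) + cnj (v i) * a i n * x) =
      (\<Sum>i<n. \<Sum>j<n. cnj (v i) * a i j * v j) + cnj S * x"
    unfolding cS[symmetric] by (simp add: sum.distrib sum_distrib_right)
  finally have "(\<Sum>i<Suc n. \<Sum>j<Suc n. cnj (w i) * a i j * w j) =
      (\<Sum>i<n. \<Sum>j<n. cnj (v i) * a i j * v j) - cnj S * S / a n n"
    using nz by (simp add: x_def ann del: sum.lessThan_Suc)
  also have "cnj S * S / a n n = (\<Sum>i<n. \<Sum>j<n. cnj (v i) * (a i n * a n j / a n n) * v j)"
    unfolding cS[symmetric] unfolding S_def sum_product sum_divide_distrib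
    by (intro sum.cong) simp_all
  finally have "(\<Sum>i<Suc n. \<Sum>j<Suc n. cnj (w i) * a i j * w j) =
      (\<Sum>i<n. \<Sum>j<n. cnj (v i) * (a i j - a i n * a n j / a n n) * v j)"
    by (simp only: right_diff_distrib left_diff_distrib sum_subtractf)
  then show "0 \<le> (\<Sum>i<n. \<Sum>j<n. cnj (v i) * (a i j - a i n * a n j / a n n) * v j)"
    using pos_semidefD[OF psd, of w] by simp
qed

lemma pos_semidef_restrict:
  assumes "pos_semidef (Suc n) a"
  shows "pos_semidef n a"
  unfolding pos_semidef_def
proof
  fix v :: "nat \<Rightarrow> complex"
  have "0 \<le> (\<Sum>i<Suc n. \<Sum>j<Suc n. cnj ((v(n := 0)) i) * a i j * (v(n := 0)) j)"
    by (rule pos_semidefD[OF assms])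
  then show "0 \<le> (\<Sum>i<n. \<Sum>j<n. cnj (v i) * a i j * v j)" by simp
qed

text \<open>A Cholesky-type induction that splits off the last row and column: a zero diagonal entry
  kills them, and otherwise they form a rank-one term on top of the Schur complement. It supplies
  the ensemble of a mixed state without the spectral theorem.\<close>

lemma pos_semidef_gram:
  assumes "pos_semidef n a"
  shows "\<exists>\<phi>. \<forall>i<n. \<forall>j<n. a i j = (\<Sum>l<n. \<phi> l i * cnj (\<phi> l j))"
  using assms
proof (induction n arbitrary: a)
  case (Suc n)
  show ?case
  proof (cases "a n n = 0")
    case True
    obtain \<phi> where \<phi>: "\<forall>i<n. \<forall>j<n. a i j = (\<Sum>l<n. \<phi> l i * cnj (\<phi> l j))"
      using Suc.IH[OF pos_semidef_restrict[OF Suc.prems]] by blast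
    have z: "a i n = 0" "a n i = 0" if "i < Suc n" for i
      using pos_semidef_zero_row[OF Suc.prems that _ True]
        pos_semidef_hermitian[OF Suc.prems that, of n] by auto
    define \<psi> where "\<psi> l i = (if l < n \<and> i < n then \<phi> l i else 0)" for l i
    have "a i j = (\<Sum>l<Suc n. \<psi> l i * cnj (\<psi> l j))" if "i < Suc n" "j < Suc n" for i j
    proof (cases "i < n \<and> j < n")
      case True
      then show ?thesis using \<phi> by (simp add: \<psi>_def)
    next
      case False
      then have "i = n \<or> j = n" using that by linarith
      then have "a i j = 0" using z that by blast
      then show ?thesis using False by (auto simp: \<psi>_def)
    qed
    then show ?thesis by blast
  next
    case False
    obtain \<phi> where \<phi>: "\<forall>i<n. \<forall>j<n. a i j - a i n * a n j / a n n = (\<Sum>l<n. \<phi> l i * cnj (\<phi> l j))"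
      using Suc.IH[OF pos_semidef_Schur_complement[OF Suc.prems False]] by blast
    define s where "s = Re (a n n)"
    have s: "a n n = of_real s" "0 \<le> s"
      using pos_semidef_diag[OF Suc.prems, of n] by (auto simp: complex_le_real complex_eq_iff s_def)
    define \<psi> where
      "\<psi> l i = (if l < n then if i < n then \<phi> l i else 0 else a i n / of_real (sqrt s))" for l i
    have sq: "of_real (sqrt s) * of_real (sqrt s) = a n n"
      using s by (simp flip: of_real_mult)
    have herm: "cnj (a j n) = a n j" if "j < Suc n" for j
      using pos_semidef_hermitian[OF Suc.prems that, of n] by simp
    have "a i j = (\<Sum>l<Suc n. \<psi> l i * cnj (\<psi> l j))" if ij: "i < Suc n" "j < Suc n" for i j
    proof -
      have "(\<Sum>l<Suc n. \<psi> l i * cnj (\<psi> l j)) =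
          (\<Sum>l<n. \<psi> l i * cnj (\<psi> l j)) + a i n * a n j / a n n"
        using herm[OF ij(2)] by (simp add: \<psi>_def flip: sq)
      also have "\<dots> = a i j"
      proof (cases "i < n \<and> j < n")
        case True
        then have "(\<Sum>l<n. \<psi> l i * cnj (\<psi> l j)) = a i j - a i n * a n j / a n n"
          using \<phi> by (simp add: \<psi>_def)
        then show ?thesis by simp
      next
        case F: False
        then have "(\<Sum>l<n. \<psi> l i * cnj (\<psi> l j)) = 0" by (auto simp: \<psi>_def)
        then show ?thesis using F ij False by (auto simp: less_Suc_eq)
      qed
      finally show ?thesis by simp
    qed
    then show ?thesis by blast
  qed
qed simp

lemma density_pos_semidef:
  assumes "density d \<rho>"
  shows "pos_semidef d (\<lambda>i j. \<rho> $$ (i, j))"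
  unfolding pos_semidef_def
proof
  fix v :: "nat \<Rightarrow> complex"
  have \<rho>: "\<rho> \<in> carrier_mat d d" and pos: "0 \<le> (\<rho> *\<^sub>v vec d v) \<bullet>c vec d v"
    using assms unfolding density_def by auto
  have "(\<rho> *\<^sub>v vec d v) \<bullet>c vec d v = (\<Sum>i<d. (\<Sum>j<d. \<rho> $$ (i, j) * v j) * cnj (v i))"
    using \<rho> by (simp add: scalar_prod_def atLeast0LessThan)
  also have "\<dots> = (\<Sum>i<d. \<Sum>j<d. cnj (v i) * \<rho> $$ (i, j) * v j)"
    by (simp add: sum_distrib_left sum_distrib_right mult_ac)
  finally show "0 \<le> (\<Sum>i<d. \<Sum>j<d. cnj (v i) * \<rho> $$ (i, j) * v j)" using pos by simp
qed

lemma density_trace: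
  assumes "density d \<rho>"
  shows "(\<Sum>i<d. \<rho> $$ (i, i)) = 1"
  using assms by (auto simp: density_def mtrace_def)

section \<open>Messages as angles\<close>

lemma sum_list_concat:
  "sum_list (concat xss) = (\<Sum>xs\<leftarrow>xss. sum_list (xs :: 'a::monoid_add list))"
  by (induction xss) simp_all

text \<open>The angles \<open>\<beta>\<close> represent the amplitudes of \<open>N\<close> unnormalized vectors on \<open>\<complex>^d\<close>, whose mixture is
  proportional to the message. The lower bound on the weight makes a trial succeed with
  probability at least \<open>1 / (8 * N)\<close>.\<close>

definition amp :: "nat \<Rightarrow> (nat \<Rightarrow> real) \<Rightarrow> nat \<Rightarrow> nat \<Rightarrow> complex" where
  "amp N \<beta> r i = Complex (cos (\<beta> (2 * (i * N + r)))) (cos (\<beta> (2 * (i * N + r) + 1)))"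

definition weight :: "nat \<Rightarrow> nat \<Rightarrow> (nat \<Rightarrow> real) \<Rightarrow> real" where
  "weight d N \<beta> = (\<Sum>i<d. \<Sum>r<N. (cmod (amp N \<beta> r i))\<^sup>2)"

definition encodes :: "nat \<Rightarrow> nat \<Rightarrow> complex mat \<Rightarrow> (nat \<Rightarrow> real) \<Rightarrow> bool" where
  "encodes d N \<rho> \<beta> \<longleftrightarrow> real N / 2 \<le> weight d N \<beta> \<and>
     (\<forall>i<d. \<forall>j<d. (\<Sum>r<N. amp N \<beta> r i * cnj (amp N \<beta> r j)) = of_real (weight d N \<beta>) * \<rho> $$ (i, j))"

lemma cmod_amp: "(cmod (amp N \<beta> r i))\<^sup>2 =
    (cos (\<beta> (2 * (i * N + r))))\<^sup>2 + (cos (\<beta> (2 * (i * N + r) + 1)))\<^sup>2"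
  by (simp add: amp_def cmod_def)

lemma weight_le: "weight d N \<beta> \<le> 2 * real d * real N"
proof -
  have "(cmod (amp N \<beta> r i))\<^sup>2 \<le> 2" for r i
    unfolding cmod_amp using abs_cos_le_one[of "\<beta> (2 * (i * N + r))"]
      abs_cos_le_one[of "\<beta> (2 * (i * N + r) + 1)"]
    by (simp flip: abs_square_le_1)
  then have "weight d N \<beta> \<le> (\<Sum>i<d. \<Sum>r<N. 2)" unfolding weight_def by (intro sum_mono) auto
  then show ?thesis by simp
qed

lemma amp_surj:
  assumes "\<And>r i. r < N \<Longrightarrow> i < d \<Longrightarrow> cmod (\<psi> r i) \<le> 1"
  shows "\<exists>\<beta>. \<forall>r<N. \<forall>i<d. amp N \<beta> r i = \<psi> r i"
proof -
  \<comment> \<open>The inverse of the numbering in \<open>amp\<close>: \<open>q div 2\<close> is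
    \<open>i * N + r\<close>, and the parity of \<open>q\<close> selects real or imaginary
    part.\<close>
  define \<beta> where "\<beta> q = arccos ((if even q then Re else Im) (\<psi> (q div 2 mod N) (q div 2 div N)))"
    for q
  have "amp N \<beta> r i = \<psi> r i" if "r < N" "i < d" for r i
  proof -
    have "\<bar>Re (\<psi> r i)\<bar> \<le> 1" "\<bar>Im (\<psi> r i)\<bar> \<le> 1"
      using assms[OF that] abs_Re_le_cmod abs_Im_le_cmod order_trans by blast+
    moreover have "\<beta> (2 * (i * N + r)) = arccos (Re (\<psi> r i))"
      "\<beta> (2 * (i * N + r) + 1) = arccos (Im (\<psi> r i))"
      using that by (simp_all add: \<beta>_def)
    ultimately show ?thesis by (simp add: amp_def cos_arccos_abs complex_eq_iff)
  qed
  then show ?thesis by blast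
qed

text \<open>Rounding the number of copies of each \<open>\<phi> l\<close> up and rescaling keeps all entries below 1.\<close>

lemma bounded_ensemble:
  fixes \<phi> :: "nat \<Rightarrow> nat \<Rightarrow> complex"
  assumes N: "2 * d \<le> N" "0 < N" and tr: "(\<Sum>l<d. \<Sum>i<d. (cmod (\<phi> l i))\<^sup>2) = 1"
  shows "\<exists>\<psi>. (\<forall>r<N. \<forall>i<d. cmod (\<psi> r i) \<le> 1) \<and>
    (\<forall>i<d. \<forall>j<d. (\<Sum>r<N. \<psi> r i * cnj (\<psi> r j)) =
       of_real (real N / 2) * (\<Sum>l<d. \<phi> l i * cnj (\<phi> l j)))"
proof -
  define p where "p l = (\<Sum>i<d. (cmod (\<phi> l i))\<^sup>2)" for l
  have p0: "0 \<le> p l" for l unfolding p_def by (intro sum_nonneg) simp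
  define n where "n l = nat \<lceil>p l * real N / 2\<rceil>" for l
  have n: "p l * real N / 2 \<le> n l" "n l \<le> p l * real N / 2 + 1" for l
  proof -
    have "0 \<le> p l * real N / 2" using p0 by simp
    then show "p l * real N / 2 \<le> n l" "n l \<le> p l * real N / 2 + 1"
      unfolding n_def by linarith+
  qed
  have "real (\<Sum>l<d. n l) \<le> (\<Sum>l<d. p l * real N / 2 + 1)"
    unfolding of_nat_sum by (intro sum_mono n)
  also have "\<dots> = real N / 2 + d"
    using tr by (simp add: sum.distrib p_def flip: sum_distrib_right sum_divide_distrib)
  \<comment> \<open>Rounding up costs at most one copy per vector, thus \<open>d \<le> N / 2\<close>
    in total; aiming at weight \<open>N / 2\<close> instead of \<open>N\<close> leaves room for
    it.\<close>
  finally have nN: "(\<Sum>l<d. n l) \<le> N" using N(1) by linarith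
  define ls where "ls = concat (map (\<lambda>l. replicate (n l) l) [0..<d])"
  have len: "length ls \<le> N"
    using nN by (simp add: ls_def length_concat comp_def interv_sum_list_conv_sum_set_nat
        atLeast0LessThan)
  \<comment> \<open>With this scaling the \<open>n l\<close> copies of a vector together carry the
    factor \<open>N / 2\<close>, and \<open>p l * N / 2 \<le> n l\<close> bounds the norm of a
    single copy by 1.\<close>
  define s where "s l = sqrt (real N / (2 * n l))" for l
  define \<psi> where "\<psi> r i = (if r < length ls then of_real (s (ls ! r)) * \<phi> (ls ! r) i else 0)" for r i
  have bound: "cmod (\<psi> r i) \<le> 1" if "i < d" for r i
  proof (cases "r < length ls")
    case True
    define l where "l = ls ! r"
    have "l \<in> set ls" using True by (simp add: l_def)
    then have pos: "0 < n l" by (auto simp: ls_def)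
    have "(cmod (\<phi> l i))\<^sup>2 \<le> p l"
      unfolding p_def by (rule member_le_sum) (use that in auto)
    then have "(s l)\<^sup>2 * (cmod (\<phi> l i))\<^sup>2 \<le> (s l)\<^sup>2 * p l"
      by (intro mult_left_mono) auto
    also have "(s l)\<^sup>2 * p l \<le> 1"
      using n(1)[of l] pos by (simp add: s_def field_simps)
    finally have "(s l * cmod (\<phi> l i))\<^sup>2 \<le> 1" by (simp add: power_mult_distrib)
    then have "\<bar>s l * cmod (\<phi> l i)\<bar> \<le> 1" by (simp add: abs_square_le_1)
    then show ?thesis using True by (simp add: \<psi>_def l_def norm_mult abs_mult)
  qed (simp add: \<psi>_def)
  have "(\<Sum>r<N. \<psi> r i * cnj (\<psi> r j)) = of_real (real N / 2) * (\<Sum>l<d. \<phi> l i * cnj (\<phi> l j))"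
    if ij: "i < d" "j < d" for i j
  proof -
    define g where "g l = of_real ((s l)\<^sup>2) * (\<phi> l i * cnj (\<phi> l j))" for l
    have "(\<Sum>r<N. \<psi> r i * cnj (\<psi> r j)) = (\<Sum>r<length ls. \<psi> r i * cnj (\<psi> r j))"
      by (rule sum.mono_neutral_right) (use len in \<open>auto simp: \<psi>_def\<close>)
    also have "\<dots> = (\<Sum>r<length ls. g (ls ! r))"
      by (rule sum.cong) (simp_all add: \<psi>_def g_def power2_eq_square)
    also have "\<dots> = sum_list (map g ls)"
      by (simp add: sum_list_sum_nth atLeast0LessThan)
    also have "\<dots> = (\<Sum>l<d. of_nat (n l) * g l)"
      by (simp add: ls_def map_concat sum_list_concat comp_def sum_list_replicate
          interv_sum_list_conv_sum_set_nat atLeast0LessThan)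
    also have "\<dots> = (\<Sum>l<d. of_real (real N / 2) * (\<phi> l i * cnj (\<phi> l j)))"
    proof (rule sum.cong[OF refl])
      fix l assume "l \<in> {..<d}"
      show "of_nat (n l) * g l = of_real (real N / 2) * (\<phi> l i * cnj (\<phi> l j))"
      proof (cases "n l = 0")
        case True
        then have "p l = 0" using n(1)[of l] p0[of l] N(2) by (simp add: mult_le_0_iff)
        then have "\<phi> l i = 0"
          using ij by (simp add: p_def sum_nonneg_eq_0_iff)
        then show ?thesis using True by simp
      next
        case False
        then have "real (n l) * (s l)\<^sup>2 = real N / 2" by (simp add: s_def)
        then have "of_nat (n l) * of_real ((s l)\<^sup>2) = (of_real (real N / 2) :: complex)"
          by (metis of_real_mult of_real_of_nat_eq)
        then show ?thesis by (simp only: g_def mult.assoc[symmetric])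
      qed
    qed
    finally show ?thesis by (simp only: sum_distrib_left)
  qed
  then show ?thesis using bound by blast
qed

lemma encodes_exists:
  assumes \<rho>: "density d \<rho>" and N: "2 * d \<le> N" "0 < N"
  shows "\<exists>\<beta>. encodes d N \<rho> \<beta>"
proof -
  obtain \<phi> where \<phi>: "\<forall>i<d. \<forall>j<d. \<rho> $$ (i, j) = (\<Sum>l<d. \<phi> l i * cnj (\<phi> l j))"
    using pos_semidef_gram[OF density_pos_semidef[OF \<rho>]] by blast
  have "complex_of_real (\<Sum>l<d. \<Sum>i<d. (cmod (\<phi> l i))\<^sup>2) = (\<Sum>l<d. \<Sum>i<d. \<phi> l i * cnj (\<phi> l i))"
    by (simp add: complex_norm_square[symmetric])
  also have "\<dots> = (\<Sum>i<d. \<rho> $$ (i, i))" using \<phi> by (subst sum.swap) simp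
  also have "\<dots> = 1" by (rule density_trace[OF \<rho>])
  finally have "(\<Sum>l<d. \<Sum>i<d. (cmod (\<phi> l i))\<^sup>2) = 1" by (simp only: of_real_eq_1_iff)
  from bounded_ensemble[OF N this] obtain \<psi> where
    \<psi>: "\<forall>r<N. \<forall>i<d. cmod (\<psi> r i) \<le> 1" "\<forall>i<d. \<forall>j<d. (\<Sum>r<N. \<psi> r i * cnj (\<psi> r j)) =
       of_real (real N / 2) * (\<Sum>l<d. \<phi> l i * cnj (\<phi> l j))"
    by blast
  obtain \<beta> where \<beta>: "\<forall>r<N. \<forall>i<d. amp N \<beta> r i = \<psi> r i"
    using amp_surj[of N d \<psi>] \<psi>(1) by blast
  have gram: "(\<Sum>r<N. amp N \<beta> r i * cnj (amp N \<beta> r j)) = of_real (real N / 2) * \<rho> $$ (i, j)"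
    if "i < d" "j < d" for i j
    using \<psi>(2) \<phi> \<beta> that by simp
  have "complex_of_real (weight d N \<beta>) = (\<Sum>i<d. \<Sum>r<N. amp N \<beta> r i * cnj (amp N \<beta> r i))"
    by (simp add: weight_def complex_norm_square[symmetric])
  also have "\<dots> = of_real (real N / 2) * (\<Sum>i<d. \<rho> $$ (i, i))"
    unfolding sum_distrib_left by (intro sum.cong refl gram) auto
  also have "\<dots> = complex_of_real (real N / 2)" by (simp add: density_trace[OF \<rho>])
  finally have w: "weight d N \<beta> = real N / 2" by (simp only: of_real_eq_iff)
  have "encodes d N \<rho> \<beta>"
    unfolding encodes_def w by (intro conjI order_refl allI impI gram)
  then show ?thesis by blast
qed

text \<open>Whenever a message admits geometric angles, they are chosen: this makes distinct monomials in
  the phases linearly independent as functions of the message.\<close>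

definition family_range :: "nat \<Rightarrow> nat \<Rightarrow> real set" where
  "family_range N n = {0<..(pi / 3) / (2 * real n + 1) ^ (2 * N * N)}"

definition message_angles :: "nat \<Rightarrow> nat \<Rightarrow> nat \<Rightarrow> complex mat \<Rightarrow> nat \<Rightarrow> real" where
  "message_angles d N n \<rho> =
     (if \<exists>\<tau>\<in>family_range N n. encodes d N \<rho> (geometric_angles n \<tau>)
      then geometric_angles n (SOME \<tau>. \<tau> \<in> family_range N n \<and> encodes d N \<rho> (geometric_angles n \<tau>))
      else SOME \<beta>. encodes d N \<rho> \<beta>)"

lemma message_angles_encodes:
  assumes "density d \<rho>" "2 * d \<le> N" "0 < N"
  shows "encodes d N \<rho> (message_angles d N n \<rho>)"
proof (cases "\<exists>\<tau>\<in>family_range N n. encodes d N \<rho> (geometric_angles n \<tau>)")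
  case True
  then have "\<exists>\<tau>. \<tau> \<in> family_range N n \<and> encodes d N \<rho> (geometric_angles n \<tau>)" by blast
  from someI_ex[OF this] show ?thesis using True by (simp add: message_angles_def)
next
  case False
  then show ?thesis
    using someI_ex[OF encodes_exists[OF assms]] by (simp only: message_angles_def if_False)
qed

definition head_weight :: "nat \<Rightarrow> (nat \<Rightarrow> real) \<Rightarrow> real" where
  "head_weight N \<beta> = (\<Sum>r<N. (cmod (amp N \<beta> r 0))\<^sup>2)"

text \<open>The ratio is read off the matrix, so all angles that encode the same matrix share
  it.\<close>

lemma encodes_head:
  assumes "encodes d N \<rho> \<beta>" "0 < d" "0 < N"
  shows "\<rho> $$ (0, 0) = of_real (head_weight N \<beta> / weight d N \<beta>)"
proof -
  have w: "weight d N \<beta> \<noteq> 0" using assms by (auto simp: encodes_def)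
  have "of_real (head_weight N \<beta>) = (\<Sum>r<N. amp N \<beta> r 0 * cnj (amp N \<beta> r 0))"
    by (simp add: head_weight_def complex_norm_square[symmetric])
  also have "\<dots> = of_real (weight d N \<beta>) * \<rho> $$ (0, 0)"
    using assms by (simp add: encodes_def)
  finally show ?thesis using w by simp
qed

lemma gram_density:
  assumes w: "0 < weight d N \<beta>"
  shows "density d (mat d d (\<lambda>(i, j). (\<Sum>r<N. amp N \<beta> r i * cnj (amp N \<beta> r j)) / of_real (weight d N \<beta>)))"
    (is "density d ?R")
  unfolding density_def
proof (intro conjI ballI)
  show "?R \<in> carrier_mat d d" by simp
  have "mtrace ?R = (\<Sum>i<d. \<Sum>r<N. of_real ((cmod (amp N \<beta> r i))\<^sup>2)) / of_real (weight d N \<beta>)"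
    by (simp add: mtrace_def complex_norm_square[symmetric] flip: sum_divide_distrib)
  also have "\<dots> = of_real (weight d N \<beta>) / of_real (weight d N \<beta>)"
    by (simp add: weight_def)
  finally show "mtrace ?R = 1" using w by simp
  fix v :: "complex vec" assume v: "v \<in> carrier_vec d"
  define S where "S r = (\<Sum>i<d. amp N \<beta> r i * cnj (v $ i))" for r
  have "(?R *\<^sub>v v) \<bullet>c v = (\<Sum>i<d. (\<Sum>j<d. (\<Sum>r<N. amp N \<beta> r i * cnj (amp N \<beta> r j)) /
      of_real (weight d N \<beta>) * v $ j) * cnj (v $ i))"
    using v by (simp add: scalar_prod_def atLeast0LessThan)
  also have "\<dots> = (\<Sum>i<d. \<Sum>j<d. \<Sum>r<N. (amp N \<beta> r i * cnj (v $ i)) * cnj (amp N \<beta> r j * cnj (v $ j)) /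
      of_real (weight d N \<beta>))"
    by (simp add: sum_distrib_left sum_distrib_right sum_divide_distrib mult_ac)
  also have "\<dots> = (\<Sum>i<d. \<Sum>r<N. \<Sum>j<d. (amp N \<beta> r i * cnj (v $ i)) * cnj (amp N \<beta> r j * cnj (v $ j)) /
      of_real (weight d N \<beta>))"
    by (intro sum.cong refl sum.swap)
  also have "\<dots> = (\<Sum>r<N. \<Sum>i<d. \<Sum>j<d. (amp N \<beta> r i * cnj (v $ i)) * cnj (amp N \<beta> r j * cnj (v $ j)) /
      of_real (weight d N \<beta>))"
    by (rule sum.swap)
  also have "\<dots> = (\<Sum>r<N. S r * cnj (S r) / of_real (weight d N \<beta>))"
    unfolding S_def cnj_sum sum_product by (simp add: sum_divide_distrib)
  also have "\<dots> = of_real (\<Sum>r<N. (cmod (S r))\<^sup>2 / weight d N \<beta>)"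
    by (simp add: complex_norm_square[symmetric])
  finally have eq: "(?R *\<^sub>v v) \<bullet>c v = of_real (\<Sum>r<N. (cmod (S r))\<^sup>2 / weight d N \<beta>)" .
  have "0 \<le> (\<Sum>r<N. (cmod (S r))\<^sup>2 / weight d N \<beta>)" using w by (intro sum_nonneg) simp
  then show "0 \<le> (?R *\<^sub>v v) \<bullet>c v" unfolding eq by (simp add: complex_le_real)
qed

text \<open>The choice in \<open>message_angles\<close> may replace \<open>\<tau>\<close> by another
  parameter of the same matrix. The relative head weight \<open>f\<close> is an invariant of the
  matrix and takes infinitely many values by continuity, so the parameters that are really chosen
  form an infinite set.\<close>

lemma infinitely_many_geometric_messages:
  assumes d: "2 \<le> d" and N: "2 * d \<le> N" and n: "1 \<le> n"
  shows "\<exists>T. infinite T \<and> T \<subseteq> {0<..<pi} \<and>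
    (\<forall>\<tau>\<in>T. \<exists>\<rho>. density d \<rho> \<and> message_angles d N n \<rho> = geometric_angles n \<tau>)"
proof -
  define B where "B = 2 * real n + 1"
  \<comment> \<open>The end of \<open>family_range\<close>: all exponents in use are at most
    \<open>2 * N * N\<close>, so every angle lies between 0 and \<open>pi / 3\<close>, every cosine
    is at least 1/2, and the weight bound in \<open>encodes\<close> follows.\<close>
  define \<epsilon> where "\<epsilon> = (pi / 3) / B ^ (2 * N * N)"
  have B: "1 < B" using n by (simp add: B_def)
  have \<epsilon>: "0 < \<epsilon>" using B by (simp add: \<epsilon>_def)
  have range: "family_range N n = {0<..\<epsilon>}" by (simp add: family_range_def \<epsilon>_def B_def)
  have geo: "geometric_angles n \<tau> q = \<tau> * B ^ q" for \<tau> q by (simp add: geometric_angles_def B_def)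
  have N0: "0 < N" using d N by simp
  have small: "0 \<le> \<tau> * B ^ q \<and> \<tau> * B ^ q \<le> pi / 3" if "0 \<le> \<tau>" "\<tau> \<le> \<epsilon>" "q \<le> 2 * N * N" for \<tau> q
  proof -
    have "\<tau> * B ^ q \<le> \<epsilon> * B ^ (2 * N * N)"
      using that B \<epsilon> by (intro mult_mono power_increasing) auto
    also have "\<dots> = pi / 3" using B by (simp add: \<epsilon>_def)
    finally show ?thesis using that B by simp
  qed
  have idx: "2 * (i * N + r) + 1 \<le> 2 * N * N" if "i < d" "r < N" for i r
  proof -
    have "i * N + r < (i + 1) * N" using that by simp
    also have "\<dots> \<le> N * N" using that N by (intro mult_right_mono) auto
    finally show ?thesis by simp
  qed
  have half: "1 / 2 \<le> cos (\<tau> * B ^ q)" if "0 \<le> \<tau>" "\<tau> \<le> \<epsilon>" "q \<le> 2 * N * N" for \<tau> q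
    using cos_monotone_0_pi_le[of "\<tau> * B ^ q" "pi / 3"] small[OF that] by (simp add: cos_60)
  have w: "real N / 2 \<le> weight d N (geometric_angles n \<tau>)" if "0 \<le> \<tau>" "\<tau> \<le> \<epsilon>" for \<tau>
  proof -
    have "1 / 2 \<le> (cmod (amp N (geometric_angles n \<tau>) r i))\<^sup>2" if "i < d" "r < N" for i r
    proof -
      have "1 / 2 \<le> cos (\<tau> * B ^ (2 * (i * N + r)))" "1 / 2 \<le> cos (\<tau> * B ^ (2 * (i * N + r) + 1))"
        using idx[OF that] by (intro half \<open>0 \<le> \<tau>\<close> \<open>\<tau> \<le> \<epsilon>\<close>; linarith)+
      then have "(1 / 2)\<^sup>2 \<le> (cos (\<tau> * B ^ (2 * (i * N + r))))\<^sup>2"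
        "(1 / 2)\<^sup>2 \<le> (cos (\<tau> * B ^ (2 * (i * N + r) + 1)))\<^sup>2"
        by (intro power_mono; simp)+
      then show ?thesis unfolding cmod_amp geo by (simp add: power2_eq_square)
    qed
    then have "(\<Sum>i<d. \<Sum>r<N. 1 / 2) \<le> weight d N (geometric_angles n \<tau>)"
      unfolding weight_def by (intro sum_mono) auto
    moreover have "real N / 2 \<le> (\<Sum>i<d. \<Sum>r<N. 1 / 2)"
      using d mult_right_mono[of 1 "real d" "real N"] by simp
    ultimately show ?thesis by linarith
  qed
  define f where "f \<tau> = head_weight N (geometric_angles n \<tau>) / weight d N (geometric_angles n \<tau>)" for \<tau>
  have "continuous_on {0..\<epsilon>} f"
    unfolding f_def head_weight_def weight_def cmod_amp geo
    by (intro continuous_intros)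
      (use w N0 in \<open>fastforce simp: weight_def cmod_amp geo\<close>)
  \<comment> \<open>At parameter 0 all cosines are 1 and the \<open>d\<close> rows have equal
    weight.\<close>
  have f0: "f 0 = 1 / d"
    using d N0 by (simp add: f_def head_weight_def weight_def cmod_amp geo)
  \<comment> \<open>The squared cosines decrease with the exponent and row 0 has the smallest
    exponents, so it weighs more than the average row.\<close>
  have f\<epsilon>: "1 / d < f \<epsilon>"
  proof -
    let ?\<beta> = "geometric_angles n \<epsilon>"
    have mono: "(cos (\<epsilon> * B ^ q'))\<^sup>2 < (cos (\<epsilon> * B ^ q))\<^sup>2" if "q < q'" "q' \<le> 2 * N * N" for q q'
    proof -
      have "\<epsilon> * B ^ q < \<epsilon> * B ^ q'" using B \<epsilon> that by simp
      then have "cos (\<epsilon> * B ^ q') < cos (\<epsilon> * B ^ q)"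
        using small[of \<epsilon> q'] small[of \<epsilon> q] \<epsilon> that pi_gt_zero by (intro cos_monotone_0_pi) auto
      moreover have "0 \<le> cos (\<epsilon> * B ^ q')" using half[of \<epsilon> q'] \<epsilon> that by simp
      ultimately show ?thesis by (intro power_strict_mono) auto
    qed
    have less: "(cmod (amp N ?\<beta> r i))\<^sup>2 < (cmod (amp N ?\<beta> r 0))\<^sup>2" if "0 < i" "i < d" "r < N" for i r
    proof -
      have pos: "0 < i * N" using that N0 by simp
      show ?thesis
        unfolding cmod_amp geo
        by (rule add_strict_mono; rule mono)
          (use pos idx[OF that(2,3)] in \<open>simp_all add: algebra_simps\<close>)
    qed
    have "weight d N ?\<beta> < (\<Sum>i<d. head_weight N ?\<beta>)"
      unfolding weight_def
    proof (rule sum_strict_mono_ex1)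
      have "(\<Sum>r<N. (cmod (amp N ?\<beta> r i))\<^sup>2) \<le> head_weight N ?\<beta>" if "i < d" for i
        unfolding head_weight_def
      proof (rule sum_mono)
        fix r assume "r \<in> {..<N}"
        then show "(cmod (amp N ?\<beta> r i))\<^sup>2 \<le> (cmod (amp N ?\<beta> r 0))\<^sup>2"
          using less[THEN less_imp_le, of i r] that by (cases "i = 0") auto
      qed
      then show "\<forall>i\<in>{..<d}. (\<Sum>r<N. (cmod (amp N ?\<beta> r i))\<^sup>2) \<le> head_weight N ?\<beta>" by simp
      have "(\<Sum>r<N. (cmod (amp N ?\<beta> r 1))\<^sup>2) < head_weight N ?\<beta>"
        unfolding head_weight_def using less[of 1] d N0 by (intro sum_strict_mono) auto
      then show "\<exists>i\<in>{..<d}. (\<Sum>r<N. (cmod (amp N ?\<beta> r i))\<^sup>2) < head_weight N ?\<beta>"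
        using d by (intro bexI[of _ 1]) auto
    qed simp
    moreover have "0 < weight d N ?\<beta>" using w[of \<epsilon>] \<epsilon> N0 by simp
    ultimately show ?thesis using d by (simp add: f_def field_simps)
  qed
  have sub: "{1 / d<..f \<epsilon>} \<subseteq> f ` {0<..\<epsilon>}"
  proof
    fix y assume y: "y \<in> {1 / d<..f \<epsilon>}"
    then obtain x where "0 \<le> x" "x \<le> \<epsilon>" "f x = y"
      using IVT'[of f 0 y \<epsilon>] f0 \<epsilon> \<open>continuous_on {0..\<epsilon>} f\<close> by auto
    then show "y \<in> f ` {0<..\<epsilon>}" using y f0 by (cases "x = 0") auto
  qed
  then have inf: "infinite (f ` {0<..\<epsilon>})"
    using f\<epsilon> infinite_Ioc finite_subset by blast
  define R where "R \<tau> = mat d d (\<lambda>(i, j). (\<Sum>r<N. amp N (geometric_angles n \<tau>) r i *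
    cnj (amp N (geometric_angles n \<tau>) r j)) / of_real (weight d N (geometric_angles n \<tau>)))" for \<tau>
  \<comment> \<open>The parameter picked for the matrix built from \<open>\<tau>\<close>; the image
    of \<open>sel\<close>, not the whole interval, is the family \<open>T\<close>.\<close>
  define sel where
    "sel \<tau> = (SOME \<tau>'. \<tau>' \<in> family_range N n \<and> encodes d N (R \<tau>) (geometric_angles n \<tau>'))" for \<tau>
  have sel: "sel \<tau> \<in> {0<..\<epsilon>} \<and> f (sel \<tau>) = f \<tau> \<and> density d (R \<tau>) \<and>
      message_angles d N n (R \<tau>) = geometric_angles n (sel \<tau>)" if \<tau>: "\<tau> \<in> {0<..\<epsilon>}" for \<tau>
  proof -
    have pos: "0 < weight d N (geometric_angles n \<tau>)" using w[of \<tau>] \<tau> N0 by simp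
    have enc: "encodes d N (R \<tau>) (geometric_angles n \<tau>)"
      using w[of \<tau>] \<tau> pos by (simp add: encodes_def R_def)
    then have ex: "\<exists>\<tau>'. \<tau>' \<in> family_range N n \<and> encodes d N (R \<tau>) (geometric_angles n \<tau>')"
      using \<tau> range by blast
    have s: "sel \<tau> \<in> family_range N n \<and> encodes d N (R \<tau>) (geometric_angles n (sel \<tau>))"
      unfolding sel_def by (rule someI_ex[OF ex])
    have "complex_of_real (f (sel \<tau>)) = of_real (f \<tau>)"
      unfolding f_def using encodes_head[of d N "R \<tau>"] s enc d N0 by (metis gr0I not_numeral_le_zero)
    then have "f (sel \<tau>) = f \<tau>" by (simp only: of_real_eq_iff)
    moreover have "message_angles d N n (R \<tau>) = geometric_angles n (sel \<tau>)"
      using ex by (simp add: message_angles_def sel_def Bex_def)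
    ultimately show ?thesis using s range gram_density[OF pos] by (simp add: R_def)
  qed
  have "f ` {0<..\<epsilon>} \<subseteq> f ` sel ` {0<..\<epsilon>}" using sel by (force simp: image_iff)
  then have "infinite (sel ` {0<..\<epsilon>})" using inf finite_subset finite_imageI by blast
  moreover have "\<epsilon> < pi" using small[of \<epsilon> 0] \<epsilon> pi_gt_zero by simp
  then have "sel ` {0<..\<epsilon>} \<subseteq> {0<..<pi}" using sel by fastforce
  moreover have "\<forall>\<tau>\<in>sel ` {0<..\<epsilon>}. \<exists>\<rho>. density d \<rho> \<and> message_angles d N n \<rho> = geometric_angles n \<tau>"
    using sel by blast
  ultimately show ?thesis by blast
qed

section \<open>Decoding by repeated trials\<close>

lemma mult_add_less:
  fixes i j a m :: nat
  assumes "i < a" "j < m"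
  shows "i * m + j < a * m"
proof -
  have "Suc i * m \<le> a * m" using assms(1) by (intro mult_le_mono1 Suc_leI)
  then show ?thesis using assms(2) by simp
qed

lemma of_bool_div_mod:
  fixes k l m :: nat
  shows "of_bool (k div m = l div m) * of_bool (k mod m = l mod m) = (of_bool (k = l) :: complex)"
proof -
  have "k div m = l div m \<Longrightarrow> k mod m = l mod m \<Longrightarrow> k = l"
    by (metis div_mult_mod_eq)
  then show ?thesis by auto
qed

lemma sum_div_mod:
  fixes f :: "nat \<Rightarrow> nat \<Rightarrow> 'a::comm_monoid_add"
  shows "(\<Sum>k<a * m. f (k div m) (k mod m)) = (\<Sum>i<a. \<Sum>j<m. f i j)"
proof (cases "m = 0")
  case False
  show ?thesis
    unfolding sum.cartesian_product
    by (rule sum.reindex_bij_witness[where i = "\<lambda>(i, j). i * m + j" and j = "\<lambda>k. (k div m, k mod m)"])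
      (use False in \<open>auto simp: less_mult_imp_div_less mult_add_less\<close>)
qed simp

lemma sum_mult_add:
  fixes f :: "nat \<Rightarrow> 'a::comm_monoid_add"
  shows "(\<Sum>i<a. \<Sum>j<m. f (i * m + j)) = (\<Sum>k<a * m. f k)"
  using sum_div_mod[of "\<lambda>i j. f (i * m + j)" m a] by simp

lemma sum_list_product:
  fixes f :: "'a \<Rightarrow> 'b::monoid_add"
  shows "(\<Sum>z\<leftarrow>[h x y. x \<leftarrow> xs, y \<leftarrow> ys]. f z) = (\<Sum>x\<leftarrow>xs. \<Sum>y\<leftarrow>ys. f (h x y))"
  by (simp add: map_concat sum_list_concat comp_def)

lemma sum_list_upt: "(\<Sum>x\<leftarrow>[0..<n]. f x) = (\<Sum>x<n. f x)"
  by (simp add: interv_sum_list_conv_sum_set_nat atLeast0LessThan)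

text \<open>Kraus operators on the common index of both registers are written as functions
  \<open>L i k\<close>, so that trials can be tensored through \<open>div\<close> and
  \<open>mod\<close>. Trace preservation says that this Gram matrix is the identity.\<close>

definition kernel_gram :: "nat \<Rightarrow> (nat \<Rightarrow> nat \<Rightarrow> complex) list \<Rightarrow> nat \<Rightarrow> nat \<Rightarrow> complex" where
  "kernel_gram d Ls k l = (\<Sum>L\<leftarrow>Ls. \<Sum>i<d. cnj (L i k) * L i l)"

definition kernel_app :: "nat \<Rightarrow> (nat \<Rightarrow> nat \<Rightarrow> complex) \<Rightarrow> (nat \<Rightarrow> complex) \<Rightarrow> nat \<Rightarrow> complex" where
  "kernel_app M L z i = (\<Sum>k<M. L i k * z k)"

definition kernel_out ::
  "nat \<Rightarrow> (nat \<Rightarrow> nat \<Rightarrow> complex) list \<Rightarrow> (nat \<Rightarrow> complex) \<Rightarrow> nat \<Rightarrow> nat \<Rightarrow> complex" where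
  "kernel_out M Ls z i j = (\<Sum>L\<leftarrow>Ls. kernel_app M L z i * cnj (kernel_app M L z j))"

text \<open>A trial index is \<open>4 * p + g\<close>: \<open>p = i * N + r\<close> numbers an
  amplitude, \<open>g div 2\<close> its real or imaginary part, the parity of \<open>g\<close> the
  sign. Taking \<open>N * N\<close> values of \<open>p\<close> instead of \<open>d * N\<close> makes
  this a power of two whenever \<open>N\<close> is one; the extra values count as failures.\<close>

definition trial_dim :: "nat \<Rightarrow> nat" where
  "trial_dim N = 4 * N * N"

text \<open>A Hadamard basis up to phases. Its first row is proportional to \<open>(1, 1, \<i>, \<i>)\<close> and turns
  the phases \<open>cis x, cis (-x), cis y, cis (-y)\<close> into \<open>Complex (cos x) (cos y)\<close>, irrespective of a
  common sign of \<open>x\<close> and \<open>y\<close>: the user need not know which server received the extra bit.\<close>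

definition basis4 :: "nat \<Rightarrow> nat \<Rightarrow> complex" where
  "basis4 h g = (if odd (h * g + h div 2 * (g div 2)) then - 1 else 1) *
     (if g < 2 then 1 / 2 else \<i> / 2)"

lemma lessThan_4: "{..<4::nat} = {0, 1, 2, 3}"
  by auto

lemma basis4_unitary:
  assumes "g < 4" "g' < 4"
  shows "(\<Sum>h<4. cnj (basis4 h g) * basis4 h g') = of_bool (g = g')"
proof -
  have "g \<in> {0, 1, 2, 3}" "g' \<in> {0, 1, 2, 3}" using assms by auto
  then show ?thesis by (auto simp: lessThan_4 basis4_def)
qed

definition trial_row :: "nat \<Rightarrow> nat \<Rightarrow> complex" where
  "trial_row \<eta> \<kappa> = of_bool (\<eta> div 4 = \<kappa> div 4) * basis4 (\<eta> mod 4) (\<kappa> mod 4)"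

definition trial_fail :: "nat \<Rightarrow> nat \<Rightarrow> nat list" where
  "trial_fail d N = filter (\<lambda>\<eta>. \<not> (\<eta> mod 4 = 0 \<and> \<eta> div 4 < d * N)) [0..<trial_dim N]"

lemma trial_row_complete:
  assumes "\<kappa> < trial_dim N" "\<kappa>' < trial_dim N"
  shows "(\<Sum>\<eta><trial_dim N. cnj (trial_row \<eta> \<kappa>) * trial_row \<eta> \<kappa>') = of_bool (\<kappa> = \<kappa>')"
proof -
  have lt: "\<kappa> div 4 < N * N" using assms(1) by (simp add: trial_dim_def less_mult_imp_div_less)
  have "(\<Sum>\<eta><trial_dim N. cnj (trial_row \<eta> \<kappa>) * trial_row \<eta> \<kappa>') =
      (\<Sum>\<eta><N * N * 4. cnj (trial_row \<eta> \<kappa>) * trial_row \<eta> \<kappa>')"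
    by (simp add: trial_dim_def mult_ac)
  also have "\<dots> = (\<Sum>p<N * N. \<Sum>h<4. of_bool (p = \<kappa> div 4) * of_bool (p = \<kappa>' div 4) *
      (cnj (basis4 h (\<kappa> mod 4)) * basis4 h (\<kappa>' mod 4)))"
    unfolding sum_div_mod[symmetric] by (rule sum.cong) (simp_all add: trial_row_def)
  also have "\<dots> = (\<Sum>p<N * N. of_bool (p = \<kappa> div 4) * of_bool (p = \<kappa>' div 4) *
      of_bool (\<kappa> mod 4 = \<kappa>' mod 4))"
    unfolding sum_distrib_left[symmetric] by (simp add: basis4_unitary)
  also have "\<dots> = (\<Sum>p<N * N. if p = \<kappa> div 4 then
      of_bool (\<kappa> div 4 = \<kappa>' div 4) * of_bool (\<kappa> mod 4 = \<kappa>' mod 4) else 0)"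
    by (rule sum.cong) auto
  also have "\<dots> = of_bool (\<kappa> div 4 = \<kappa>' div 4) * of_bool (\<kappa> mod 4 = \<kappa>' mod 4)"
    using lt by simp
  also have "\<dots> = of_bool (\<kappa> = \<kappa>')"
    by (rule of_bool_div_mod)
  finally show ?thesis .
qed

text \<open>The rows \<open>4 * (i * N + r)\<close> are the first basis vectors of the blocks below
  \<open>d * N\<close>, exactly those that \<open>trial_fail\<close> leaves out.\<close>

lemma sum_trial_split:
  fixes f :: "nat \<Rightarrow> complex"
  assumes "d \<le> N"
  shows "(\<Sum>r<N. \<Sum>i<d. f (4 * (i * N + r))) + (\<Sum>\<eta>\<leftarrow>trial_fail d N. f \<eta>) =
    (\<Sum>\<eta><trial_dim N. f \<eta>)"
proof -
  have le: "d * N \<le> N * N" using assms by simp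
  have set: "set (trial_fail d N) = {..<trial_dim N} - (\<lambda>p. 4 * p) ` {..<d * N}"
  proof -
    have "\<eta> \<in> (\<lambda>p. 4 * p) ` {..<d * N} \<longleftrightarrow> \<eta> mod 4 = 0 \<and> \<eta> div 4 < d * N" for \<eta>
      by (auto simp: image_iff intro!: bexI[of _ "\<eta> div 4"])
    then show ?thesis by (auto simp: trial_fail_def)
  qed
  have sub: "(\<lambda>p. 4 * p) ` {..<d * N} \<subseteq> {..<trial_dim N}"
    by (auto simp: trial_dim_def mult.assoc intro: less_le_trans[OF _ le])
  have "(\<Sum>r<N. \<Sum>i<d. f (4 * (i * N + r))) = (\<Sum>p<d * N. f (4 * p))"
    by (subst sum.swap) (rule sum_mult_add)
  also have "\<dots> = sum f ((\<lambda>p. 4 * p) ` {..<d * N})"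
    by (simp add: sum.reindex inj_on_def)
  finally have "(\<Sum>r<N. \<Sum>i<d. f (4 * (i * N + r))) = sum f ((\<lambda>p. 4 * p) ` {..<d * N})" .
  moreover have "(\<Sum>\<eta>\<leftarrow>trial_fail d N. f \<eta>) = sum f ({..<trial_dim N} - (\<lambda>p. 4 * p) ` {..<d * N})"
    unfolding set[symmetric] by (rule sum_list_distinct_conv_sum_set) (simp add: trial_fail_def)
  ultimately show ?thesis
    using sum.subset_diff[OF sub, of f] by (simp add: add.commute)
qed

definition trial_phase :: "real \<Rightarrow> (nat \<Rightarrow> real) \<Rightarrow> nat \<Rightarrow> complex" where
  "trial_phase s \<beta> \<kappa> = cis (s * (of_int (bit_sign \<kappa>) * \<beta> (\<kappa> div 2)))"

lemma trial_row_amp: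
  assumes s: "s = 1 \<or> s = - 1" and "i < d" "r < N" "d \<le> N"
  shows "(\<Sum>\<kappa><trial_dim N. trial_row (4 * (i * N + r)) \<kappa> * trial_phase s \<beta> \<kappa>) = amp N \<beta> r i"
proof -
  define p where "p = i * N + r"
  have p: "p < N * N" using assms by (simp add: p_def mult_add_less)
  have "(\<Sum>\<kappa><trial_dim N. trial_row (4 * p) \<kappa> * trial_phase s \<beta> \<kappa>) =
      (\<Sum>\<kappa><N * N * 4. trial_row (4 * p) \<kappa> * trial_phase s \<beta> \<kappa>)"
    by (simp add: trial_dim_def mult_ac)
  also have "\<dots> = (\<Sum>q<N * N. \<Sum>g<4. trial_row (4 * p) (q * 4 + g) * trial_phase s \<beta> (q * 4 + g))"
    by (rule sum_mult_add[symmetric])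
  also have "\<dots> = (\<Sum>q<N * N. if q = p then (\<Sum>g<4. basis4 0 g * trial_phase s \<beta> (q * 4 + g)) else 0)"
    by (rule sum.cong) (auto simp: trial_row_def intro!: sum.cong)
  also have "\<dots> = (\<Sum>g<4. basis4 0 g * trial_phase s \<beta> (p * 4 + g))"
    using p by simp
  also have "\<dots> = amp N \<beta> r i"
  proof -
    have "(p * 4 + 0) div 2 = 2 * p" "(p * 4 + 1) div 2 = 2 * p" "(p * 4 + 2) div 2 = 2 * p + 1"
      "(p * 4 + 3) div 2 = 2 * p + 1"
      by linarith+
    then show ?thesis
      using s by (auto simp: lessThan_4 basis4_def trial_phase_def bit_sign_def amp_def p_def[symmetric]
          complex_eq_iff)
  qed
  finally show ?thesis by (simp add: p_def)
qed

text \<open>The trial rows are unitary and the phases have modulus one, so the outcomes share the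
  squared norm \<open>trial_dim N\<close>, of which the successful rows take
  \<open>weight d N \<beta>\<close>.\<close>

lemma trial_fail_weight:
  assumes s: "s = 1 \<or> s = - 1" and dN: "d \<le> N"
  shows "(\<Sum>\<eta>\<leftarrow>trial_fail d N. (\<Sum>\<kappa><trial_dim N. trial_row \<eta> \<kappa> * trial_phase s \<beta> \<kappa>) *
      cnj (\<Sum>\<kappa><trial_dim N. trial_row \<eta> \<kappa> * trial_phase s \<beta> \<kappa>)) =
    of_real (real (trial_dim N) - weight d N \<beta>)"
proof -
  define m where "m = trial_dim N"
  define w where "w = trial_phase s \<beta>"
  define F where "F \<eta> = (\<Sum>\<kappa><m. trial_row \<eta> \<kappa> * w \<kappa>)" for \<eta>
  have w: "w \<kappa> * cnj (w \<kappa>) = 1" for \<kappa> by (simp add: w_def trial_phase_def cis_cnj cis_mult)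
  have "(\<Sum>\<eta><m. F \<eta> * cnj (F \<eta>)) =
      (\<Sum>\<eta><m. \<Sum>\<kappa><m. \<Sum>\<kappa>'<m. cnj (trial_row \<eta> \<kappa>') * trial_row \<eta> \<kappa> * (w \<kappa> * cnj (w \<kappa>')))"
    unfolding F_def cnj_sum sum_product by (intro sum.cong) simp_all
  also have "\<dots> = (\<Sum>\<kappa><m. \<Sum>\<eta><m. \<Sum>\<kappa>'<m. cnj (trial_row \<eta> \<kappa>') * trial_row \<eta> \<kappa> * (w \<kappa> * cnj (w \<kappa>')))"
    by (rule sum.swap)
  also have "\<dots> = (\<Sum>\<kappa><m. \<Sum>\<kappa>'<m. \<Sum>\<eta><m. cnj (trial_row \<eta> \<kappa>') * trial_row \<eta> \<kappa> * (w \<kappa> * cnj (w \<kappa>')))"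
    by (intro sum.cong refl sum.swap)
  also have "\<dots> = (\<Sum>\<kappa><m. \<Sum>\<kappa>'<m. if \<kappa>' = \<kappa> then w \<kappa> * cnj (w \<kappa>') else 0)"
    unfolding sum_distrib_right[symmetric] m_def
    by (intro sum.cong refl) (simp add: trial_row_complete)
  also have "\<dots> = of_nat m" by (simp add: w)
  finally have all: "(\<Sum>\<eta><m. F \<eta> * cnj (F \<eta>)) = of_nat m" .
  have "(\<Sum>r<N. \<Sum>i<d. F (4 * (i * N + r)) * cnj (F (4 * (i * N + r)))) =
      (\<Sum>r<N. \<Sum>i<d. of_real ((cmod (amp N \<beta> r i))\<^sup>2))"
    using trial_row_amp[OF s _ _ dN]
    by (intro sum.cong refl) (simp add: F_def m_def w_def complex_norm_square[symmetric])
  also have "\<dots> = of_real (weight d N \<beta>)"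
    by (subst sum.swap) (simp add: weight_def)
  finally show ?thesis
    using sum_trial_split[OF dN, of "\<lambda>\<eta>. F \<eta> * cnj (F \<eta>)"] all
    by (simp add: F_def m_def w_def algebra_simps)
qed

text \<open>The last digit is tried first. A success measures \<open>r\<close> but keeps
  \<open>i\<close> as the output register, so the amplitudes over \<open>i\<close> stay coherent,
  and it discards the remaining digits by measuring their value \<open>c\<close>. After a failure
  \<open>\<eta>\<close> the remaining digits are decoded.\<close>

fun decode_success :: "nat \<Rightarrow> nat \<Rightarrow> nat \<Rightarrow> (nat \<Rightarrow> nat \<Rightarrow> complex) list" where
  "decode_success d N 0 = []"
| "decode_success d N (Suc n) =
     [\<lambda>i k. of_bool (k div trial_dim N = c) * trial_row (4 * (i * N + r)) (k mod trial_dim N).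
        c \<leftarrow> [0..<trial_dim N ^ n], r \<leftarrow> [0..<N]] @
     [\<lambda>i k. L i (k div trial_dim N) * trial_row \<eta> (k mod trial_dim N).
        L \<leftarrow> decode_success d N n, \<eta> \<leftarrow> trial_fail d N]"

text \<open>Once every trial has failed, the factor \<open>of_bool (i = 0)\<close> prepares the
  default output |0>.\<close>

fun decode_failure :: "nat \<Rightarrow> nat \<Rightarrow> nat \<Rightarrow> (nat \<Rightarrow> nat \<Rightarrow> complex) list" where
  "decode_failure d N 0 = [\<lambda>i k. of_bool (i = 0)]"
| "decode_failure d N (Suc n) =
     [\<lambda>i k. L i (k div trial_dim N) * trial_row \<eta> (k mod trial_dim N).
        L \<leftarrow> decode_failure d N n, \<eta> \<leftarrow> trial_fail d N]"

lemma kernel_gram_tensor: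
  "kernel_gram d [\<lambda>i k. L i (k div m) * R \<eta> (k mod m). L \<leftarrow> Ls, \<eta> \<leftarrow> hs] k l =
     kernel_gram d Ls (k div m) (l div m) * (\<Sum>\<eta>\<leftarrow>hs. cnj (R \<eta> (k mod m)) * R \<eta> (l mod m))"
proof -
  have "(\<Sum>i<d. cnj (L i (k div m) * R \<eta> (k mod m)) * (L i (l div m) * R \<eta> (l mod m))) =
      (\<Sum>i<d. cnj (L i (k div m)) * L i (l div m)) * (cnj (R \<eta> (k mod m)) * R \<eta> (l mod m))" for L \<eta>
    unfolding sum_distrib_right by (rule sum.cong) simp_all
  then show ?thesis
    unfolding kernel_gram_def sum_list_product
    by (simp add: sum_list_const_mult sum_list_mult_const)
qed

lemma kernel_out_tensor:
  assumes z: "\<And>k. z k = y (k div m) * w (k mod m)"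
  shows "kernel_out (M * m) [\<lambda>i k. L i (k div m) * R \<eta> (k mod m). L \<leftarrow> Ls, \<eta> \<leftarrow> hs] z i j =
     kernel_out M Ls y i j *
     (\<Sum>\<eta>\<leftarrow>hs. (\<Sum>\<kappa><m. R \<eta> \<kappa> * w \<kappa>) * cnj (\<Sum>\<kappa><m. R \<eta> \<kappa> * w \<kappa>))"
proof -
  have "kernel_app (M * m) (\<lambda>i k. L i (k div m) * R \<eta> (k mod m)) z i =
      kernel_app M L y i * (\<Sum>\<kappa><m. R \<eta> \<kappa> * w \<kappa>)" for L \<eta> i
  proof -
    have "kernel_app (M * m) (\<lambda>i k. L i (k div m) * R \<eta> (k mod m)) z i =
        (\<Sum>k<M * m. (L i (k div m) * y (k div m)) * (R \<eta> (k mod m) * w (k mod m)))"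
      unfolding kernel_app_def z by (rule sum.cong) simp_all
    also have "\<dots> = (\<Sum>a<M. \<Sum>\<kappa><m. (L i a * y a) * (R \<eta> \<kappa> * w \<kappa>))"
      by (rule sum_div_mod)
    finally show ?thesis by (simp add: kernel_app_def sum_product)
  qed
  then have "kernel_app (M * m) (\<lambda>i k. L i (k div m) * R \<eta> (k mod m)) z i *
      cnj (kernel_app (M * m) (\<lambda>i k. L i (k div m) * R \<eta> (k mod m)) z j) =
      (kernel_app M L y i * cnj (kernel_app M L y j)) *
      ((\<Sum>\<kappa><m. R \<eta> \<kappa> * w \<kappa>) * cnj (\<Sum>\<kappa><m. R \<eta> \<kappa> * w \<kappa>))" for L \<eta>
    by (simp only: complex_cnj_mult mult_ac)
  then show ?thesis
    unfolding kernel_out_def sum_list_product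
    by (simp only: sum_list_const_mult sum_list_mult_const)
qed

text \<open>Success and failure rows of the last digit together form the trial unitary, and each
  failure is followed by a family that is complete by induction.\<close>

lemma decode_complete:
  assumes dN: "d \<le> N" "0 < d" and "k < trial_dim N ^ n" "l < trial_dim N ^ n"
  shows "kernel_gram d (decode_success d N n @ decode_failure d N n) k l = of_bool (k = l)"
  using assms(3,4)
proof (induction n arbitrary: k l)
  case 0
  have "(\<Sum>i<d. cnj (of_bool (i = 0)) * of_bool (i = 0)) = (\<Sum>i<d. if i = 0 then 1 else (0::complex))"
    by (rule sum.cong) auto
  then show ?case using 0 dN by (simp add: kernel_gram_def)
next
  case (Suc n)
  define m where "m = trial_dim N"
  have m: "0 < m" using dN by (simp add: m_def trial_dim_def)
  have kl: "k div m < m ^ n" "l div m < m ^ n" "k mod m < m" "l mod m < m"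
    using Suc.prems m by (simp_all add: m_def less_mult_imp_div_less mult.commute)
  define e where "e \<eta> = cnj (trial_row \<eta> (k mod m)) * trial_row \<eta> (l mod m)" for \<eta>
  have "kernel_gram d [\<lambda>i k. of_bool (k div m = c) * trial_row (4 * (i * N + r)) (k mod m).
        c \<leftarrow> [0..<m ^ n], r \<leftarrow> [0..<N]] k l =
      (\<Sum>c<m ^ n. \<Sum>r<N. \<Sum>i<d. of_bool (k div m = c) * of_bool (l div m = c) * e (4 * (i * N + r)))"
    unfolding kernel_gram_def sum_list_product sum_list_upt e_def
    by (intro sum.cong refl) simp
  also have "\<dots> = (\<Sum>c<m ^ n. if c = k div m then of_bool (k div m = l div m) *
      (\<Sum>r<N. \<Sum>i<d. e (4 * (i * N + r))) else 0)"
    unfolding sum_distrib_left[symmetric] by (rule sum.cong) auto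
  also have "\<dots> = of_bool (k div m = l div m) * (\<Sum>r<N. \<Sum>i<d. e (4 * (i * N + r)))"
    using kl by simp
  finally have first: "kernel_gram d [\<lambda>i k. of_bool (k div m = c) * trial_row (4 * (i * N + r)) (k mod m).
        c \<leftarrow> [0..<m ^ n], r \<leftarrow> [0..<N]] k l =
      of_bool (k div m = l div m) * (\<Sum>r<N. \<Sum>i<d. e (4 * (i * N + r)))" .
  have app: "kernel_gram d (Xs @ Ys) k l = kernel_gram d Xs k l + kernel_gram d Ys k l" for Xs Ys k l
    by (simp add: kernel_gram_def)
  have "kernel_gram d (decode_success d N (Suc n) @ decode_failure d N (Suc n)) k l =
      of_bool (k div m = l div m) * (\<Sum>r<N. \<Sum>i<d. e (4 * (i * N + r))) +
      kernel_gram d (decode_success d N n @ decode_failure d N n) (k div m) (l div m) *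
        (\<Sum>\<eta>\<leftarrow>trial_fail d N. e \<eta>)"
    unfolding decode_success.simps decode_failure.simps app kernel_gram_tensor m_def[symmetric]
      first e_def[symmetric]
    by (simp add: algebra_simps)
  also have "\<dots> = of_bool (k div m = l div m) *
      ((\<Sum>r<N. \<Sum>i<d. e (4 * (i * N + r))) + (\<Sum>\<eta>\<leftarrow>trial_fail d N. e \<eta>))"
    using Suc.IH[of "k div m" "l div m"] kl by (simp add: m_def algebra_simps)
  also have "\<dots> = of_bool (k div m = l div m) * of_bool (k mod m = l mod m)"
    unfolding sum_trial_split[OF dN(1), of e] unfolding e_def
    using trial_row_complete[of "k mod m" N "l mod m"] kl by (simp add: m_def)
  also have "\<dots> = of_bool (k = l)"
    by (rule of_bool_div_mod)
  finally show ?case .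
qed

text \<open>In unnormalized form each trial has total weight \<open>m\<close>, of which
  \<open>m - weight d N \<beta>\<close> fails, independently of the other trials; every success
  leaves the same mixture. Both signs \<open>s\<close> give the same result since the amplitudes are
  cosines.\<close>

lemma decode_out:
  assumes s: "s = 1 \<or> s = - 1" and dN: "d \<le> N" "0 < d" and enc: "encodes d N \<rho> \<beta>"
    and ij: "i < d" "j < d"
  defines "m \<equiv> real (trial_dim N)"
  defines "z \<equiv> \<lambda>n k. cis (s * angle (trial_dim N) n \<beta> k)"
  shows "kernel_out (trial_dim N ^ n) (decode_success d N n) (z n) i j =
      of_real (m ^ n - (m - weight d N \<beta>) ^ n) * \<rho> $$ (i, j)" (is ?success)
    and "kernel_out (trial_dim N ^ n) (decode_failure d N n) (z n) i j =
      of_real ((m - weight d N \<beta>) ^ n) * of_bool (i = 0 \<and> j = 0)" (is ?failure)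
proof -
  define D where "D = trial_dim N"
  have D: "0 < D" using dN by (simp add: D_def trial_dim_def)
  have z_Suc: "z (Suc n) k = z n (k div D) * trial_phase s \<beta> (k mod D)" for n k
    using D by (simp add: z_def D_def angle_Suc trial_phase_def cis_mult distrib_left)
  have fail: "(\<Sum>\<eta>\<leftarrow>trial_fail d N. (\<Sum>\<kappa><D. trial_row \<eta> \<kappa> * trial_phase s \<beta> \<kappa>) *
      cnj (\<Sum>\<kappa><D. trial_row \<eta> \<kappa> * trial_phase s \<beta> \<kappa>)) = of_real (m - weight d N \<beta>)"
    unfolding D_def m_def by (rule trial_fail_weight[OF s dN(1)])
  show ?success
  proof (induction n)
    case (Suc n)
    have app: "kernel_app (D ^ n * D) (\<lambda>i k. of_bool (k div D = c) * trial_row (4 * (i * N + r)) (k mod D))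
        (z (Suc n)) i = z n c * amp N \<beta> r i" if "c < D ^ n" "r < N" "i < d" for c r i
    proof -
      have "kernel_app (D ^ n * D) (\<lambda>i k. of_bool (k div D = c) * trial_row (4 * (i * N + r)) (k mod D))
          (z (Suc n)) i = (\<Sum>k<D ^ n * D. (of_bool (k div D = c) * z n (k div D)) *
            (trial_row (4 * (i * N + r)) (k mod D) * trial_phase s \<beta> (k mod D)))"
        unfolding kernel_app_def z_Suc by (rule sum.cong) simp_all
      also have "\<dots> = (\<Sum>a<D ^ n. \<Sum>\<kappa><D. (of_bool (a = c) * z n a) *
          (trial_row (4 * (i * N + r)) \<kappa> * trial_phase s \<beta> \<kappa>))"
        by (rule sum_div_mod)
      also have "\<dots> = (\<Sum>a<D ^ n. if a = c then z n c * amp N \<beta> r i else 0)"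
        unfolding sum_distrib_left[symmetric]
        using trial_row_amp[OF s that(3,2) dN(1)] by (intro sum.cong refl) (simp add: D_def)
      finally show ?thesis using that by simp
    qed
    have first: "kernel_out (D ^ n * D) [\<lambda>i k. of_bool (k div D = c) * trial_row (4 * (i * N + r)) (k mod D).
        c \<leftarrow> [0..<D ^ n], r \<leftarrow> [0..<N]] (z (Suc n)) i j =
        of_real (m ^ n * weight d N \<beta>) * \<rho> $$ (i, j)"
    proof -
      have "kernel_out (D ^ n * D) [\<lambda>i k. of_bool (k div D = c) * trial_row (4 * (i * N + r)) (k mod D).
          c \<leftarrow> [0..<D ^ n], r \<leftarrow> [0..<N]] (z (Suc n)) i j =
          (\<Sum>c<D ^ n. \<Sum>r<N. (z n c * amp N \<beta> r i) * cnj (z n c * amp N \<beta> r j))"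
        unfolding kernel_out_def sum_list_product sum_list_upt
        using app ij by (intro sum.cong refl) simp
      also have "\<dots> = (\<Sum>c<D ^ n. \<Sum>r<N. amp N \<beta> r i * cnj (amp N \<beta> r j))"
      proof (intro sum.cong refl)
        fix c r
        \<comment> \<open>The discarded digits contribute only a global phase.\<close>
        have "z n c * cnj (z n c) = 1" by (simp add: z_def cis_cnj cis_mult)
        then show "(z n c * amp N \<beta> r i) * cnj (z n c * amp N \<beta> r j) = amp N \<beta> r i * cnj (amp N \<beta> r j)"
          by (simp add: algebra_simps)
      qed
      also have "\<dots> = of_nat (D ^ n) * (of_real (weight d N \<beta>) * \<rho> $$ (i, j))"
        using enc ij by (simp add: encodes_def)
      finally show ?thesis by (simp add: m_def D_def mult.assoc)
    qed
    have tensor: "kernel_out (D ^ n * D) [\<lambda>i k. L i (k div D) * trial_row \<eta> (k mod D).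
        L \<leftarrow> decode_success d N n, \<eta> \<leftarrow> trial_fail d N] (z (Suc n)) i j =
        of_real (m ^ n - (m - weight d N \<beta>) ^ n) * \<rho> $$ (i, j) * of_real (m - weight d N \<beta>)"
      unfolding kernel_out_tensor[of "z (Suc n)", OF z_Suc] fail Suc.IH[folded D_def] ..
    have "kernel_out (D ^ Suc n) (decode_success d N (Suc n)) (z (Suc n)) i j =
        of_real (m ^ n * weight d N \<beta>) * \<rho> $$ (i, j) +
        of_real (m ^ n - (m - weight d N \<beta>) ^ n) * \<rho> $$ (i, j) * of_real (m - weight d N \<beta>)"
      unfolding first[symmetric] tensor[symmetric]
      by (simp add: kernel_out_def D_def mult.commute)
    also have "\<dots> = of_real (m ^ Suc n - (m - weight d N \<beta>) ^ Suc n) * \<rho> $$ (i, j)"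
      by (simp add: algebra_simps)
    finally show ?case by (simp add: D_def)
  qed (simp add: kernel_out_def)
  show ?failure
  proof (induction n)
    case 0
    then show ?case by (simp add: kernel_out_def kernel_app_def z_def)
  next
    case (Suc n)
    have "kernel_out (D ^ n * D) (decode_failure d N (Suc n)) (z (Suc n)) i j =
        kernel_out (D ^ n) (decode_failure d N n) (z n) i j * of_real (m - weight d N \<beta>)"
      unfolding decode_failure.simps D_def[symmetric] kernel_out_tensor[of "z (Suc n)", OF z_Suc] fail ..
    then show ?case using Suc.IH by (simp add: D_def mult.commute)
  qed
qed

section \<open>Kraus operators and queries\<close>

lemma sum_list_cong:
  "(\<And>x. x \<in> set xs \<Longrightarrow> f x = g x) \<Longrightarrow> (\<Sum>x\<leftarrow>xs. f x) = (\<Sum>x\<leftarrow>xs. g x)"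
  by (induction xs) simp_all

lemma sum_sum_list_swap:
  "(\<Sum>b\<in>S. \<Sum>x\<leftarrow>xs. g b x) = (\<Sum>x\<leftarrow>xs. \<Sum>b\<in>S. (g b x :: 'a::comm_monoid_add))"
  by (induction xs) (simp_all add: sum.distrib)

lemma sum_list_swap:
  "(\<Sum>x\<leftarrow>xs. \<Sum>y\<leftarrow>ys. g x y) = (\<Sum>y\<leftarrow>ys. \<Sum>x\<leftarrow>xs. (g x y :: 'a::comm_monoid_add))"
  by (induction xs) (simp_all add: sum_list_addf)

lemma mult_add_div: "(j::nat) < m \<Longrightarrow> (i * m + j) div m = i"
  by simp

lemma mat_adjoint_carrier: "A \<in> carrier_mat m n \<Longrightarrow> mat_adjoint A \<in> carrier_mat n m"
  by (auto simp: mat_adjoint_def mat_of_rows_def)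

lemma mat_adjoint_index:
  assumes "A \<in> carrier_mat m n" "i < n" "j < m"
  shows "mat_adjoint A $$ (i, j) = cnj (A $$ (j, i))"
  using assms by (auto simp: mat_adjoint_def mat_of_rows_def)

lemma mult_mat_index:
  assumes "A \<in> carrier_mat m n" "B \<in> carrier_mat n k" "i < m" "j < k"
  shows "(A * B) $$ (i, j) = (\<Sum>a<n. A $$ (i, a) * B $$ (a, j))"
  using assms by (simp add: scalar_prod_def atLeast0LessThan)

lemma sandwich_index:
  assumes A: "A \<in> carrier_mat m n" and \<sigma>: "\<sigma> \<in> carrier_mat n n" and ij: "i < m" "j < m"
  shows "(A * \<sigma> * mat_adjoint A) $$ (i, j) = (\<Sum>a<n. \<Sum>b<n. A $$ (i, a) * \<sigma> $$ (a, b) * cnj (A $$ (j, b)))"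
proof -
  have "(A * \<sigma> * mat_adjoint A) $$ (i, j) = (\<Sum>b<n. (A * \<sigma>) $$ (i, b) * mat_adjoint A $$ (b, j))"
    by (rule mult_mat_index[OF mult_carrier_mat[OF A \<sigma>] mat_adjoint_carrier[OF A] ij])
  also have "\<dots> = (\<Sum>b<n. (\<Sum>a<n. A $$ (i, a) * \<sigma> $$ (a, b)) * cnj (A $$ (j, b)))"
    using ij by (intro sum.cong refl) (simp add: mult_mat_index[OF A \<sigma>] mat_adjoint_index[OF A])
  also have "\<dots> = (\<Sum>a<n. \<Sum>b<n. A $$ (i, a) * \<sigma> $$ (a, b) * cnj (A $$ (j, b)))"
    unfolding sum_distrib_right by (rule sum.swap)
  finally show ?thesis .
qed

lemma kraus_apply_index:
  assumes "set Ks \<subseteq> carrier_mat m n" "\<sigma> \<in> carrier_mat n n" "i < m" "j < m"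
  shows "kraus_apply m Ks \<sigma> $$ (i, j) =
    (\<Sum>A\<leftarrow>Ks. \<Sum>a<n. \<Sum>b<n. A $$ (i, a) * \<sigma> $$ (a, b) * cnj (A $$ (j, b)))"
proof -
  have "(\<Sum>A\<leftarrow>Ks. (A * \<sigma> * mat_adjoint A) $$ (i, j)) =
      (\<Sum>A\<leftarrow>Ks. \<Sum>a<n. \<Sum>b<n. A $$ (i, a) * \<sigma> $$ (a, b) * cnj (A $$ (j, b)))"
    using assms by (intro sum_list_cong sandwich_index) auto
  then show ?thesis using assms(3,4) by (simp add: kraus_apply_def)
qed

lemma trace_preserving_iff:
  assumes "set Ks \<subseteq> carrier_mat m n"
  shows "trace_preserving n Ks \<longleftrightarrow>
    (\<forall>i<n. \<forall>j<n. (\<Sum>A\<leftarrow>Ks. \<Sum>k<m. cnj (A $$ (k, i)) * A $$ (k, j)) = of_bool (i = j))"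
proof -
  have eq: "(\<Sum>A\<leftarrow>Ks. (mat_adjoint A * A) $$ (i, j)) = (\<Sum>A\<leftarrow>Ks. \<Sum>k<m. cnj (A $$ (k, i)) * A $$ (k, j))"
    if ij: "i < n" "j < n" for i j
  proof (rule sum_list_cong)
    fix A assume "A \<in> set Ks"
    then have A: "A \<in> carrier_mat m n" using assms by blast
    have "(mat_adjoint A * A) $$ (i, j) = (\<Sum>k<m. mat_adjoint A $$ (i, k) * A $$ (k, j))"
      by (rule mult_mat_index[OF mat_adjoint_carrier[OF A] A ij])
    also have "\<dots> = (\<Sum>k<m. cnj (A $$ (k, i)) * A $$ (k, j))"
      using ij by (intro sum.cong refl) (simp add: mat_adjoint_index[OF A])
    finally show "(mat_adjoint A * A) $$ (i, j) = (\<Sum>k<m. cnj (A $$ (k, i)) * A $$ (k, j))" .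
  qed
  show ?thesis unfolding trace_preserving_def mat_eq_iff by (auto simp: eq)
qed

section \<open>Mixtures of vectors under Kraus maps\<close>

text \<open>States are kept as lists of unnormalized vectors, on which Kraus maps act one by one;
  equality of states is later reduced to equality of single vectors.\<close>

definition outer :: "nat \<Rightarrow> (nat \<Rightarrow> complex) list \<Rightarrow> complex mat" where
  "outer n vs = mat n n (\<lambda>(i, j). \<Sum>v\<leftarrow>vs. v i * cnj (v j))"

definition mat_app :: "nat \<Rightarrow> complex mat \<Rightarrow> (nat \<Rightarrow> complex) \<Rightarrow> nat \<Rightarrow> complex" where
  "mat_app n A v i = (\<Sum>k<n. A $$ (i, k) * v k)"

lemma outer_carrier [simp]: "outer n vs \<in> carrier_mat n n"
  by (simp add: outer_def)

lemma outer_index: "i < n \<Longrightarrow> j < n \<Longrightarrow> outer n vs $$ (i, j) = (\<Sum>v\<leftarrow>vs. v i * cnj (v j))"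
  by (simp add: outer_def)

lemma outer_cong:
  assumes "\<And>x i. x \<in> set xs \<Longrightarrow> i < n \<Longrightarrow> g x i = h x i"
  shows "outer n (map g xs) = outer n (map h xs)"
proof (rule eq_matI)
  fix i j assume "i < dim_row (outer n (map h xs))" "j < dim_col (outer n (map h xs))"
  then have ij: "i < n" "j < n" by (simp_all add: outer_def)
  have "(\<Sum>x\<leftarrow>xs. g x i * cnj (g x j)) = (\<Sum>x\<leftarrow>xs. h x i * cnj (h x j))"
    using assms ij by (intro sum_list_cong) simp
  then show "outer n (map g xs) $$ (i, j) = outer n (map h xs) $$ (i, j)"
    using ij by (simp add: outer_index comp_def)
qed (simp_all add: outer_def)

lemma kraus_apply_outer:
  assumes Ks: "set Ks \<subseteq> carrier_mat m n"
  shows "kraus_apply m Ks (outer n vs) = outer m [mat_app n A v. A \<leftarrow> Ks, v \<leftarrow> vs]"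
proof (rule eq_matI)
  fix i j
  assume "i < dim_row (outer m [mat_app n A v. A \<leftarrow> Ks, v \<leftarrow> vs])"
    "j < dim_col (outer m [mat_app n A v. A \<leftarrow> Ks, v \<leftarrow> vs])"
  then have ij: "i < m" "j < m" by (simp_all add: outer_def)
  have "(\<Sum>a<n. \<Sum>b<n. A $$ (i, a) * outer n vs $$ (a, b) * cnj (A $$ (j, b))) =
      (\<Sum>v\<leftarrow>vs. mat_app n A v i * cnj (mat_app n A v j))" for A
  proof (induction vs)
    case Nil
    then show ?case by (simp add: outer_index)
  next
    case (Cons v vs)
    have "(\<Sum>a<n. \<Sum>b<n. A $$ (i, a) * outer n (v # vs) $$ (a, b) * cnj (A $$ (j, b))) =
        (\<Sum>a<n. \<Sum>b<n. (A $$ (i, a) * v a) * cnj (A $$ (j, b) * v b) +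
          A $$ (i, a) * outer n vs $$ (a, b) * cnj (A $$ (j, b)))"
      by (intro sum.cong refl) (simp add: outer_index algebra_simps)
    also have "\<dots> = mat_app n A v i * cnj (mat_app n A v j) +
        (\<Sum>v\<leftarrow>vs. mat_app n A v i * cnj (mat_app n A v j))"
      by (simp only: sum.distrib Cons.IH mat_app_def sum_product cnj_sum)
    finally show ?case by simp
  qed
  then show "kraus_apply m Ks (outer n vs) $$ (i, j) =
      outer m [mat_app n A v. A \<leftarrow> Ks, v \<leftarrow> vs] $$ (i, j)"
    unfolding kraus_apply_index[OF Ks outer_carrier ij] outer_index[OF ij] sum_list_product by simp
qed (simp_all add: outer_def kraus_apply_def)

lemma kron_carrier:
  "A \<in> carrier_mat a b \<Longrightarrow> B \<in> carrier_mat c d \<Longrightarrow> kron A B \<in> carrier_mat (a * c) (b * d)"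
  by (simp add: kron_def)

lemma kron_index:
  assumes "A \<in> carrier_mat a b" "B \<in> carrier_mat c d" "i < a * c" "j < b * d"
  shows "kron A B $$ (i, j) = A $$ (i div c, j div d) * B $$ (i mod c, j mod d)"
  using assms by (simp add: kron_def)

lemma kron_one:
  assumes D: "D \<in> carrier_mat m n"
  shows "kron (1\<^sub>m 1) (kron D (1\<^sub>m 1)) = D"
proof (rule eq_matI)
  fix i j assume "i < dim_row D" "j < dim_col D"
  then show "kron (1\<^sub>m 1) (kron D (1\<^sub>m 1)) $$ (i, j) = D $$ (i, j)"
    using D by (simp add: kron_def)
qed (use D in \<open>simp_all add: kron_def\<close>)

lemma ptrace_one:
  assumes "A \<in> carrier_mat n n"
  shows "ptrace 1 n 1 A = A"
  by (rule eq_matI) (use assms in \<open>simp_all add: ptrace_def\<close>)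

section \<open>Query strings and the servers' views\<close>

lemma set_bits: "set (bits f) = {q. length q = f}"
  by (auto simp: bits_def set_n_lists)

lemma length_bits: "length (bits f) = 2 ^ f"
  by (simp add: bits_def length_n_lists numeral_2_eq_2)

lemma distinct_bits: "distinct (bits f)"
  by (simp add: bits_def distinct_n_lists)

lemma sum_bits: "(\<Sum>q\<leftarrow>bits f. g q) = (\<Sum>q | length q = f. g q)"
  by (simp add: sum_list_distinct_conv_sum_set distinct_bits set_bits)

lemma card_bits: "card {q :: bool list. length q = f} = 2 ^ f"
  by (metis distinct_bits distinct_card length_bits set_bits)

definition flip :: "nat \<Rightarrow> bool list \<Rightarrow> bool list" where
  "flip i q = q[i := \<not> q ! i]"

lemma length_flip [simp]: "length (flip i q) = length q"
  by (simp add: flip_def)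

lemma flip_flip [simp]: "flip i (flip i q) = q"
  by (cases "i < length q") (simp_all add: flip_def list_update_beyond)

definition one_round :: "nat \<Rightarrow> nat \<Rightarrow> pattern" where
  "one_round f e = \<lparr>rounds = 1, up1 = \<lambda>_. f, up2 = \<lambda>_. f, down1 = \<lambda>_. e, down2 = \<lambda>_. e\<rparr>"

lemma one_round_simps [simp]:
  "rounds (one_round f e) = 1" "up1 (one_round f e) t = f" "up2 (one_round f e) t = f"
  "down1 (one_round f e) t = e" "down2 (one_round f e) t = e"
  by (simp_all add: one_round_def)

lemma finite_bits [simp]: "finite {q :: bool list. length q = f}"
  by (metis List.finite_set set_bits)

lemma sum_list_zero_off:
  fixes g :: "bool list \<Rightarrow> complex"
  assumes "length p = f"
  shows "(\<Sum>q\<leftarrow>bits f. if q = p then g q else 0) = g p"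
  using assms by (simp add: sum_bits)

text \<open>Both servers see a uniformly random query; summing over the operations of the other server
  removes everything else.\<close>

locale query_round =
  fixes f e :: nat and s1 s2 :: server and u :: user and i0 :: nat and \<sigma> :: "complex mat"
  assumes s1: "server_strategy 1 (\<lambda>_. f) (\<lambda>_. e) s1"
    and s2: "server_strategy 1 (\<lambda>_. f) (\<lambda>_. e) s2"
    and \<sigma>: "\<sigma> \<in> carrier_mat (smem s1 0 * smem s2 0) (smem s1 0 * smem s2 0)"
    and umem: "umem u 0 = 1"
    and enc: "\<And>q1 q2. enc u 0 q1 q2 =
      (if q2 = flip i0 q1 then [mat 1 1 (\<lambda>_. of_real (1 / sqrt (2 ^ f)))] else [])"
begin

abbreviation "m1 \<equiv> smem s1 0"
abbreviation "m2 \<equiv> smem s2 0"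
abbreviation "r1 \<equiv> smem s1 1 * 2 ^ e"
abbreviation "r2 \<equiv> smem s2 1 * 2 ^ e"

lemma act_carrier:
  "length q = f \<Longrightarrow> set (act s1 0 q) \<subseteq> carrier_mat r1 m1"
  "length q = f \<Longrightarrow> set (act s2 0 q) \<subseteq> carrier_mat r2 m2"
  using s1 s2 by (simp_all add: server_strategy_def set_bits)

lemma act_complete:
  "length q = f \<Longrightarrow> x < m1 \<Longrightarrow> y < m1 \<Longrightarrow>
    (\<Sum>A\<leftarrow>act s1 0 q. \<Sum>k<r1. cnj (A $$ (k, x)) * A $$ (k, y)) = of_bool (x = y)"
  "length q = f \<Longrightarrow> x < m2 \<Longrightarrow> y < m2 \<Longrightarrow>
    (\<Sum>A\<leftarrow>act s2 0 q. \<Sum>k<r2. cnj (A $$ (k, x)) * A $$ (k, y)) = of_bool (x = y)"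
  using s1 s2 trace_preserving_iff[OF act_carrier(1)] trace_preserving_iff[OF act_carrier(2)]
  by (auto simp: server_strategy_def set_bits)

text \<open>Between the servers the user contributes only the scalar \<open>1 / sqrt (2 ^ f)\<close>
  for each allowed query pair; its square is the probability of that pair.\<close>

lemma joint_state_index:
  assumes i: "a < r1" "b < r2" "a' < r1" "b' < r2"
  shows "joint_state (one_round f e) s1 s2 u \<sigma> 1 $$ (a * r2 + b, a' * r2 + b') =
    (\<Sum>q1\<leftarrow>bits f. \<Sum>A\<leftarrow>act s1 0 q1. \<Sum>B\<leftarrow>act s2 0 (flip i0 q1).
       \<Sum>x<m1 * m2. \<Sum>y<m1 * m2. of_real (1 / 2 ^ f) * \<sigma> $$ (x, y) *
         (A $$ (a, x div m2) * cnj (A $$ (a', y div m2)) *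
          (B $$ (b, x mod m2) * cnj (B $$ (b', y mod m2)))))"
proof -
  define V where "V = mat 1 1 (\<lambda>_. complex_of_real (1 / sqrt (2 ^ f)))"
  have V: "V \<in> carrier_mat 1 1" by (simp add: V_def)
  have K: "kron A (kron V B) \<in> carrier_mat (r1 * r2) (m1 * m2)"
    if "A \<in> carrier_mat r1 m1" "B \<in> carrier_mat r2 m2" for A B
    using kron_carrier[OF that(1) kron_carrier[OF V that(2)]] by simp
  have ops: "set (round_ops (one_round f e) s1 s2 u 0) \<subseteq> carrier_mat (r1 * r2) (m1 * m2)"
  proof
    fix W assume "W \<in> set (round_ops (one_round f e) s1 s2 u 0)"
    then obtain q1 A B where q: "length q1 = f" "A \<in> set (act s1 0 q1)" "B \<in> set (act s2 0 (flip i0 q1))"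
      and W: "W = kron A (kron V B)"
      by (auto simp: round_ops_def set_bits enc V_def split: if_splits)
    show "W \<in> carrier_mat (r1 * r2) (m1 * m2)"
      unfolding W by (rule K) (use q act_carrier[of q1] act_carrier[of "flip i0 q1"] in auto)
  qed
  have dim: "smem s1 (Suc 0) * hold (one_round f e) u (Suc 0) * smem s2 (Suc 0) = r1 * r2"
    by (simp add: umem)
  define S where "S W = (\<Sum>x<m1 * m2. \<Sum>y<m1 * m2. W $$ (a * r2 + b, x) * \<sigma> $$ (x, y) *
      cnj (W $$ (a' * r2 + b', y)))" for W
  have lt: "a * r2 + b < r1 * r2" "a' * r2 + b' < r1 * r2" using i by (simp_all add: mult_add_less)
  have "joint_state (one_round f e) s1 s2 u \<sigma> 1 $$ (a * r2 + b, a' * r2 + b') =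
      (\<Sum>W\<leftarrow>round_ops (one_round f e) s1 s2 u 0. S W)"
    unfolding One_nat_def joint_state.simps dim S_def 
    by (rule kraus_apply_index[OF ops \<sigma> lt, unfolded One_nat_def])
  also have "\<dots> = (\<Sum>q1\<leftarrow>bits f. \<Sum>q2\<leftarrow>bits f. if q2 = flip i0 q1 then
      (\<Sum>A\<leftarrow>act s1 0 q1. \<Sum>B\<leftarrow>act s2 0 q2. S (kron A (kron V B))) else 0)"
    by (simp add: round_ops_def map_concat sum_list_concat comp_def enc V_def)
      (intro sum_list_cong, simp add: V_def)
  also have "\<dots> = (\<Sum>q1\<leftarrow>bits f. \<Sum>A\<leftarrow>act s1 0 q1. \<Sum>B\<leftarrow>act s2 0 (flip i0 q1). S (kron A (kron V B)))"
    by (rule sum_list_cong) (subst sum_list_zero_off, simp_all add: set_bits)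
  also have "\<dots> = (\<Sum>q1\<leftarrow>bits f. \<Sum>A\<leftarrow>act s1 0 q1. \<Sum>B\<leftarrow>act s2 0 (flip i0 q1).
       \<Sum>x<m1 * m2. \<Sum>y<m1 * m2. of_real (1 / 2 ^ f) * \<sigma> $$ (x, y) *
         (A $$ (a, x div m2) * cnj (A $$ (a', y div m2)) *
          (B $$ (b, x mod m2) * cnj (B $$ (b', y mod m2)))))"
  proof (intro sum_list_cong)
    fix q1 A B
    assume q: "q1 \<in> set (bits f)" "A \<in> set (act s1 0 q1)" "B \<in> set (act s2 0 (flip i0 q1))"
    then have A: "A \<in> carrier_mat r1 m1" and B: "B \<in> carrier_mat r2 m2"
      using act_carrier[of q1] act_carrier[of "flip i0 q1"] by (auto simp: set_bits)
    have VB: "kron V B \<in> carrier_mat r2 m2" using kron_carrier[OF V B] by simp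
    have idx: "kron A (kron V B) $$ (a * r2 + b, x) =
        A $$ (a, x div m2) * (of_real (1 / sqrt (2 ^ f)) * B $$ (b, x mod m2))"
      if "a < r1" "b < r2" "x < m1 * m2" for a b x
    proof -
      have m2: "0 < m2" using that by (cases "m2 = 0") auto
      have "kron A (kron V B) $$ (a * r2 + b, x) =
          A $$ ((a * r2 + b) div r2, x div m2) * kron V B $$ ((a * r2 + b) mod r2, x mod m2)"
        by (rule kron_index[OF A VB]) (use that in \<open>simp_all add: mult_add_less\<close>)
      also have "kron V B $$ ((a * r2 + b) mod r2, x mod m2) =
          V $$ (b div r2, x mod m2 div m2) * B $$ (b mod r2, x mod m2 mod m2)"
        using kron_index[OF V B, of b "x mod m2"] that m2 by simp
      finally show ?thesis using that m2 by (simp add: V_def mult_add_div[OF that(2), simplified])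
    qed
    have sq: "complex_of_real (1 / sqrt (2 ^ f)) * of_real (1 / sqrt (2 ^ f)) = of_real (1 / 2 ^ f)"
      by (simp flip: of_real_mult)
    show "S (kron A (kron V B)) = (\<Sum>x<m1 * m2. \<Sum>y<m1 * m2. of_real (1 / 2 ^ f) * \<sigma> $$ (x, y) *
         (A $$ (a, x div m2) * cnj (A $$ (a', y div m2)) *
          (B $$ (b, x mod m2) * cnj (B $$ (b', y mod m2)))))"
      unfolding S_def
      by (intro sum.cong refl)
        (simp only: idx[OF i(1,2)] idx[OF i(3,4)] lessThan_iff complex_cnj_mult
          complex_cnj_complex_of_real sq[symmetric] mult_ac)
  qed
  finally show ?thesis .
qed

text \<open>The factor \<open>of_bool\<close> is the partial trace of \<open>\<sigma>\<close> over
  the register of Server 2. As \<open>i0\<close> does not occur, this is one common state for all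
  labels.\<close>

definition reduced1 :: "complex mat" where
  "reduced1 = mat (smem s1 1) (smem s1 1) (\<lambda>(i, j).
     \<Sum>q\<leftarrow>bits f. \<Sum>A\<leftarrow>act s1 0 q. \<Sum>c<2 ^ e. \<Sum>x<m1 * m2. \<Sum>y<m1 * m2.
       of_real (1 / 2 ^ f) * \<sigma> $$ (x, y) *
       (A $$ (i * 2 ^ e + c, x div m2) * cnj (A $$ (j * 2 ^ e + c, y div m2)) *
        of_bool (x mod m2 = y mod m2)))"

definition reduced2 :: "complex mat" where
  "reduced2 = mat (smem s2 1) (smem s2 1) (\<lambda>(i, j).
     \<Sum>q\<leftarrow>bits f. \<Sum>B\<leftarrow>act s2 0 q. \<Sum>c<2 ^ e. \<Sum>x<m1 * m2. \<Sum>y<m1 * m2.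
       of_real (1 / 2 ^ f) * \<sigma> $$ (x, y) *
       (B $$ (c * smem s2 1 + i, x mod m2) * cnj (B $$ (c * smem s2 1 + j, y mod m2)) *
        of_bool (x div m2 = y div m2)))"

lemma act2_trace:
  assumes "length q = f" "x < m1 * m2" "y < m1 * m2"
  shows "(\<Sum>B\<leftarrow>act s2 0 q. \<Sum>b<r2. B $$ (b, x mod m2) * cnj (B $$ (b, y mod m2))) =
    of_bool (x mod m2 = y mod m2)"
proof -
  have m2: "0 < m2" using assms by (cases "m2 = 0") auto
  show ?thesis
    using act_complete(2)[OF assms(1), of "y mod m2" "x mod m2"] m2 
    by (simp add: mult.commute eq_commute[of "y mod m2"])
qed

lemma act1_trace:
  assumes "length q = f" "x < m1 * m2" "y < m1 * m2"
  shows "(\<Sum>A\<leftarrow>act s1 0 q. \<Sum>a<r1. A $$ (a, x div m2) * cnj (A $$ (a, y div m2))) =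
    of_bool (x div m2 = y div m2)"
  using act_complete(1)[OF assms(1), of "y div m2" "x div m2"] assms(2,3)
  by (simp add: mult.commute eq_commute[of "y div m2"] less_mult_imp_div_less)

text \<open>The position \<open>i0\<close> enters only through the query of Server 2, whose
  operation is trace preserving for every query, so summing over its output removes it.\<close>

lemma server1_state_eq: "server1_state (one_round f e) s1 s2 u \<sigma> = reduced1"
proof (rule eq_matI)
  let ?J = "joint_state (one_round f e) s1 s2 u \<sigma> 1"
  let ?s = "\<lambda>x y. of_real (1 / 2 ^ f) * \<sigma> $$ (x, y)"
  fix i j assume "i < dim_row reduced1" "j < dim_col reduced1"
  then have ij: "i < smem s1 1" "j < smem s1 1" by (simp_all add: reduced1_def)
  have "server1_state (one_round f e) s1 s2 u \<sigma> $$ (i, j) =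
      (\<Sum>l<2 ^ e * r2. ?J $$ (i * (2 ^ e * r2) + l, j * (2 ^ e * r2) + l))"
    using ij by (simp add: server1_state_def ptrace_def Let_def umem mult_ac)
  also have "\<dots> = (\<Sum>c<2 ^ e. \<Sum>b<r2. ?J $$ ((i * 2 ^ e + c) * r2 + b, (j * 2 ^ e + c) * r2 + b))"
    unfolding sum_mult_add[symmetric] by (simp only: distrib_right mult.assoc add.assoc)
  also have "\<dots> = (\<Sum>c<2 ^ e. \<Sum>b<r2. \<Sum>q\<leftarrow>bits f. \<Sum>A\<leftarrow>act s1 0 q. \<Sum>B\<leftarrow>act s2 0 (flip i0 q).
      \<Sum>x<m1 * m2. \<Sum>y<m1 * m2. ?s x y *
        (A $$ (i * 2 ^ e + c, x div m2) * cnj (A $$ (j * 2 ^ e + c, y div m2)) *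
         (B $$ (b, x mod m2) * cnj (B $$ (b, y mod m2)))))"
    using ij by (intro sum.cong refl joint_state_index) (simp_all add: mult_add_less)
  also have "\<dots> = (\<Sum>q\<leftarrow>bits f. \<Sum>A\<leftarrow>act s1 0 q. \<Sum>c<2 ^ e. \<Sum>B\<leftarrow>act s2 0 (flip i0 q). \<Sum>b<r2.
      \<Sum>x<m1 * m2. \<Sum>y<m1 * m2. ?s x y *
        (A $$ (i * 2 ^ e + c, x div m2) * cnj (A $$ (j * 2 ^ e + c, y div m2)) *
         (B $$ (b, x mod m2) * cnj (B $$ (b, y mod m2)))))"
    by (simp only: sum_sum_list_swap)
  also have "\<dots> = (\<Sum>q\<leftarrow>bits f. \<Sum>A\<leftarrow>act s1 0 q. \<Sum>c<2 ^ e. \<Sum>x<m1 * m2. \<Sum>y<m1 * m2. ?s x y *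
        (A $$ (i * 2 ^ e + c, x div m2) * cnj (A $$ (j * 2 ^ e + c, y div m2)) *
         of_bool (x mod m2 = y mod m2)))"
  proof (intro sum_list_cong sum.cong refl)
    fix q A c assume "q \<in> set (bits f)"
    then have q: "length (flip i0 q) = f" by (simp add: set_bits)
    let ?a = "\<lambda>x y. A $$ (i * 2 ^ e + c, x div m2) * cnj (A $$ (j * 2 ^ e + c, y div m2))"
    have "(\<Sum>B\<leftarrow>act s2 0 (flip i0 q). \<Sum>b<r2. \<Sum>x<m1 * m2. \<Sum>y<m1 * m2. ?s x y *
        (?a x y * (B $$ (b, x mod m2) * cnj (B $$ (b, y mod m2))))) =
        (\<Sum>B\<leftarrow>act s2 0 (flip i0 q). \<Sum>x<m1 * m2. \<Sum>y<m1 * m2. \<Sum>b<r2. ?s x y *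
        (?a x y * (B $$ (b, x mod m2) * cnj (B $$ (b, y mod m2)))))"
      by (intro sum_list_cong) (subst sum.swap, intro sum.cong refl sum.swap)
    also have "\<dots> = (\<Sum>x<m1 * m2. \<Sum>y<m1 * m2. ?s x y * (?a x y *
        (\<Sum>B\<leftarrow>act s2 0 (flip i0 q). \<Sum>b<r2. B $$ (b, x mod m2) * cnj (B $$ (b, y mod m2)))))"
      by (simp only: sum_sum_list_swap[symmetric] sum_distrib_left[symmetric] sum_list_const_mult)
    also have "\<dots> = (\<Sum>x<m1 * m2. \<Sum>y<m1 * m2. ?s x y * (?a x y * of_bool (x mod m2 = y mod m2)))"
      by (intro sum.cong refl) (simp only: act2_trace[OF q] lessThan_iff)
    finally show "(\<Sum>B\<leftarrow>act s2 0 (flip i0 q). \<Sum>b<r2. \<Sum>x<m1 * m2. \<Sum>y<m1 * m2. ?s x y *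
        (?a x y * (B $$ (b, x mod m2) * cnj (B $$ (b, y mod m2))))) =
        (\<Sum>x<m1 * m2. \<Sum>y<m1 * m2. ?s x y * (?a x y * of_bool (x mod m2 = y mod m2)))" .
  qed
  finally show "server1_state (one_round f e) s1 s2 u \<sigma> $$ (i, j) = reduced1 $$ (i, j)"
    using ij by (simp add: reduced1_def)
qed (simp_all add: server1_state_def ptrace_def reduced1_def Let_def)

lemma server2_state_eq: "server2_state (one_round f e) s1 s2 u \<sigma> = reduced2"
proof (rule eq_matI)
  let ?J = "joint_state (one_round f e) s1 s2 u \<sigma> 1"
  let ?n = "smem s2 1"
  let ?s = "\<lambda>x y. of_real (1 / 2 ^ f) * \<sigma> $$ (x, y)"
  fix i j assume "i < dim_row reduced2" "j < dim_col reduced2"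
  then have ij: "i < ?n" "j < ?n" by (simp_all add: reduced2_def)
  let ?b = "\<lambda>B c x y. B $$ (c * ?n + i, x mod m2) * cnj (B $$ (c * ?n + j, y mod m2))"
  have "server2_state (one_round f e) s1 s2 u \<sigma> $$ (i, j) =
      (\<Sum>k<r1 * 2 ^ e. ?J $$ (k * ?n + i, k * ?n + j))"
    using ij by (simp add: server2_state_def ptrace_def Let_def umem mult_ac)
  also have "\<dots> = (\<Sum>a<r1. \<Sum>c<2 ^ e. ?J $$ (a * r2 + (c * ?n + i), a * r2 + (c * ?n + j)))"
    by (rule trans[OF sum_mult_add[symmetric]], intro sum.cong refl)
      (simp only: distrib_right mult.assoc add.assoc mult.commute[of ?n "2 ^ e"])
  also have "\<dots> = (\<Sum>a<r1. \<Sum>c<2 ^ e. \<Sum>q\<leftarrow>bits f. \<Sum>A\<leftarrow>act s1 0 q. \<Sum>B\<leftarrow>act s2 0 (flip i0 q).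
      \<Sum>x<m1 * m2. \<Sum>y<m1 * m2. ?s x y *
        (A $$ (a, x div m2) * cnj (A $$ (a, y div m2)) * ?b B c x y))"
    using ij mult_add_less[of _ "2 ^ e" _ ?n]
    by (intro sum.cong refl joint_state_index) (simp_all add: mult.commute)
  also have "\<dots> = (\<Sum>q\<leftarrow>bits f. \<Sum>a<r1. \<Sum>A\<leftarrow>act s1 0 q. \<Sum>B\<leftarrow>act s2 0 (flip i0 q). \<Sum>c<2 ^ e.
      \<Sum>x<m1 * m2. \<Sum>y<m1 * m2. ?s x y *
        (A $$ (a, x div m2) * cnj (A $$ (a, y div m2)) * ?b B c x y))"
    by (simp only: sum_sum_list_swap)
  also have "\<dots> = (\<Sum>q\<leftarrow>bits f. \<Sum>B\<leftarrow>act s2 0 (flip i0 q). \<Sum>c<2 ^ e. \<Sum>x<m1 * m2. \<Sum>y<m1 * m2.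
      ?s x y * (?b B c x y * of_bool (x div m2 = y div m2)))"
  proof (rule sum_list_cong)
    fix q assume "q \<in> set (bits f)"
    then have q: "length q = f" by (simp add: set_bits)
    let ?a = "\<lambda>A a x y. A $$ (a, x div m2) * cnj (A $$ (a, y div m2))"
    let ?G = "\<lambda>B c. \<Sum>x<m1 * m2. \<Sum>y<m1 * m2. ?s x y * (?b B c x y * of_bool (x div m2 = y div m2))"
    have inner: "(\<Sum>a<r1. \<Sum>A\<leftarrow>act s1 0 q. \<Sum>x<m1 * m2. \<Sum>y<m1 * m2.
        ?s x y * (?a A a x y * ?b B c x y)) = ?G B c" for B :: "complex mat" and c
    proof -
      have "(\<Sum>a<r1. \<Sum>A\<leftarrow>act s1 0 q. \<Sum>x<m1 * m2. \<Sum>y<m1 * m2. ?s x y * (?a A a x y * ?b B c x y)) =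
          (\<Sum>A\<leftarrow>act s1 0 q. \<Sum>x<m1 * m2. \<Sum>y<m1 * m2. \<Sum>a<r1. ?s x y * ?b B c x y * ?a A a x y)"
        unfolding sum_sum_list_swap
        by (rule sum_list_cong, subst sum.swap, rule sum.cong[OF refl], subst sum.swap)
          (intro sum.cong refl, simp only: mult_ac)
      also have "\<dots> = (\<Sum>x<m1 * m2. \<Sum>y<m1 * m2. ?s x y * ?b B c x y *
          (\<Sum>A\<leftarrow>act s1 0 q. \<Sum>a<r1. ?a A a x y))"
        by (simp only: sum_sum_list_swap[symmetric] sum_distrib_left[symmetric] sum_list_const_mult)
      also have "\<dots> = ?G B c"
        by (intro sum.cong refl) (simp only: act1_trace[OF q] lessThan_iff mult.assoc)
      finally show ?thesis .
    qed
    have "(\<Sum>a<r1. \<Sum>A\<leftarrow>act s1 0 q. \<Sum>B\<leftarrow>act s2 0 (flip i0 q). \<Sum>c<2 ^ e. \<Sum>x<m1 * m2. \<Sum>y<m1 * m2.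
        ?s x y * (?a A a x y * ?b B c x y)) =
        (\<Sum>B\<leftarrow>act s2 0 (flip i0 q). \<Sum>c<2 ^ e. \<Sum>a<r1. \<Sum>A\<leftarrow>act s1 0 q. \<Sum>x<m1 * m2. \<Sum>y<m1 * m2.
        ?s x y * (?a A a x y * ?b B c x y))"
      (is "(\<Sum>a<r1. \<Sum>A\<leftarrow>_. \<Sum>B\<leftarrow>_. \<Sum>c<2 ^ e. ?H a A B c) = _")
    proof -
      have "(\<Sum>a<r1. \<Sum>A\<leftarrow>act s1 0 q. \<Sum>B\<leftarrow>act s2 0 (flip i0 q). \<Sum>c<2 ^ e. ?H a A B c) =
          (\<Sum>a<r1. \<Sum>B\<leftarrow>act s2 0 (flip i0 q). \<Sum>A\<leftarrow>act s1 0 q. \<Sum>c<2 ^ e. ?H a A B c)"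
        by (intro sum.cong refl sum_list_swap)
      also have "\<dots> = (\<Sum>B\<leftarrow>act s2 0 (flip i0 q). \<Sum>a<r1. \<Sum>c<2 ^ e. \<Sum>A\<leftarrow>act s1 0 q. ?H a A B c)"
        unfolding sum_sum_list_swap ..
      also have "\<dots> = (\<Sum>B\<leftarrow>act s2 0 (flip i0 q). \<Sum>c<2 ^ e. \<Sum>a<r1. \<Sum>A\<leftarrow>act s1 0 q. ?H a A B c)"
        by (intro sum_list_cong sum.swap)
      finally show ?thesis .
    qed
    then show "(\<Sum>a<r1. \<Sum>A\<leftarrow>act s1 0 q. \<Sum>B\<leftarrow>act s2 0 (flip i0 q). \<Sum>c<2 ^ e. \<Sum>x<m1 * m2. \<Sum>y<m1 * m2.
        ?s x y * (?a A a x y * ?b B c x y)) = (\<Sum>B\<leftarrow>act s2 0 (flip i0 q). \<Sum>c<2 ^ e. ?G B c)"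
      unfolding inner .
  qed
  \<comment> \<open>Flipping a fixed position permutes the query strings: the query of Server 2 is
    itself uniform, and \<open>i0\<close> disappears.\<close>
  also have "\<dots> = (\<Sum>q\<leftarrow>bits f. \<Sum>B\<leftarrow>act s2 0 q. \<Sum>c<2 ^ e. \<Sum>x<m1 * m2. \<Sum>y<m1 * m2.
      ?s x y * (?b B c x y * of_bool (x div m2 = y div m2)))"
    unfolding sum_bits
    by (rule sum.reindex_bij_witness[where i = "flip i0" and j = "flip i0"]) simp_all
  finally show "server2_state (one_round f e) s1 s2 u \<sigma> $$ (i, j) = reduced2 $$ (i, j)"
    using ij by (simp add: reduced2_def)
qed (simp_all add: server2_state_def ptrace_def reduced2_def Let_def)

end

section \<open>The protocol\<close>

definition basis_state :: "nat \<Rightarrow> nat \<Rightarrow> complex mat" where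
  "basis_state d a = mat d d (\<lambda>(i, j). of_bool (i = a \<and> j = a))"

lemma basis_state_index [simp]:
  "i < d \<Longrightarrow> j < d \<Longrightarrow> basis_state d a $$ (i, j) = of_bool (i = a \<and> j = a)"
  by (simp add: basis_state_def)

lemma dim_basis_state [simp]: "dim_row (basis_state d a) = d" "dim_col (basis_state d a) = d"
  by (simp_all add: basis_state_def)

lemma density_basis_state:
  assumes "a < d"
  shows "density d (basis_state d a)"
  unfolding density_def
proof (intro conjI ballI)
  show "basis_state d a \<in> carrier_mat d d" by (simp add: basis_state_def)
  have "mtrace (basis_state d a) = (\<Sum>i<d. if i = a then 1 else 0)"
    by (simp add: mtrace_def basis_state_def)
  then show "mtrace (basis_state d a) = 1" using assms by simp
  fix v :: "complex vec" assume v: "v \<in> carrier_vec d"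
  have "(basis_state d a *\<^sub>v v) \<bullet>c v = (\<Sum>i<d. (\<Sum>j<d. of_bool (i = a \<and> j = a) * v $ j) * cnj (v $ i))"
    using v by (simp add: basis_state_def scalar_prod_def atLeast0LessThan)
  also have "\<dots> = (\<Sum>i<d. if i = a then v $ a * cnj (v $ a) else 0)"
  proof (intro sum.cong refl)
    fix i
    have "(\<Sum>j<d. of_bool (i = a \<and> j = a) * v $ j) = (\<Sum>j<d. if j = a then of_bool (i = a) * v $ j else 0)"
      by (intro sum.cong refl) auto
    then show "(\<Sum>j<d. of_bool (i = a \<and> j = a) * v $ j) * cnj (v $ i) =
        (if i = a then v $ a * cnj (v $ a) else 0)"
      using assms by simp
  qed
  also have "\<dots> = of_real ((cmod (v $ a))\<^sup>2)"
    using assms by (simp add: complex_norm_square[symmetric])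
  finally have eq: "(basis_state d a *\<^sub>v v) \<bullet>c v = of_real ((cmod (v $ a))\<^sup>2)" .
  show "0 \<le> (basis_state d a *\<^sub>v v) \<bullet>c v" unfolding eq by (simp add: complex_le_real)
qed

lemma ebit_state_outer:
  "ebit_state e = outer (2 ^ e * 2 ^ e)
     [\<lambda>j. of_bool (j div 2 ^ e = j mod 2 ^ e) * of_real (1 / sqrt (2 ^ e))]"
proof -
  have "complex_of_real (1 / sqrt (2 ^ e)) * of_real (1 / sqrt (2 ^ e)) = of_real (1 / 2 ^ e)"
    by (simp flip: of_real_mult)
  then show ?thesis
    by (intro eq_matI) (auto simp: ebit_state_def outer_def Let_def)
qed

text \<open>\<open>N\<close> is the ensemble size and \<open>n\<close> the number of trials;
  \<open>dim\<close> makes an index of one half of the shared state exactly a string of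
  \<open>n\<close> trial digits.\<close>

locale phase_protocol =
  fixes d N n f e :: nat
  assumes d: "2 \<le> d" and N: "2 * d \<le> N" and n: "1 \<le> n" and dim: "2 ^ e = trial_dim N ^ n"
begin

abbreviation M :: nat where "M \<equiv> 2 ^ e"

text \<open>Query positions start at 0 and message labels at 1, hence \<open>Suc l\<close> here and
  \<open>K - 1\<close> in the user's flip.\<close>

definition message_phase :: "(nat \<Rightarrow> complex mat) \<Rightarrow> nat \<Rightarrow> nat \<Rightarrow> real" where
  "message_phase \<rho> l k = angle (trial_dim N) n (message_angles d N n (\<rho> (Suc l))) k"

definition query_phase :: "(nat \<Rightarrow> complex mat) \<Rightarrow> bool list \<Rightarrow> nat \<Rightarrow> real" where
  "query_phase \<rho> q k = (\<Sum>l<f. of_bool (q ! l) * message_phase \<rho> l k)"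

definition phase_diff :: "(nat \<Rightarrow> complex mat) \<Rightarrow> bool list \<Rightarrow> bool list \<Rightarrow> nat \<Rightarrow> real" where
  "phase_diff \<rho> q1 q2 k = (\<Sum>l<f. (of_bool (q1 ! l) - of_bool (q2 ! l)) * message_phase \<rho> l k)"

definition phase_mat :: "real \<Rightarrow> (nat \<Rightarrow> complex mat) \<Rightarrow> bool list \<Rightarrow> complex mat" where
  "phase_mat s \<rho> q = mat M M (\<lambda>(i, j). if i = j then cis (s * query_phase \<rho> q i) else 0)"

definition phase_server :: "real \<Rightarrow> (nat \<Rightarrow> complex mat) \<Rightarrow> server" where
  "phase_server s \<rho> = \<lparr>smem = \<lambda>t. if t = 0 then M else 1, act = \<lambda>t q. [phase_mat s \<rho> q]\<rparr>"

text \<open>Diagonal phases keep the shared state on pairs of equal indices, so decoding reads the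
  common index.\<close>

definition diag_kraus :: "(nat \<Rightarrow> nat \<Rightarrow> complex) \<Rightarrow> complex mat" where
  "diag_kraus L = mat d (M * M) (\<lambda>(i, j). if j div M = j mod M then L i (j mod M) else 0)"

text \<open>Unequal index pairs carry no amplitude when the servers are honest; these operators
  complete the measurement on them.\<close>

definition junk_kraus :: "nat \<Rightarrow> complex mat" where
  "junk_kraus c = mat d (M * M) (\<lambda>(i, j). of_bool (i = 0 \<and> j = c))"

definition junk_indices :: "nat list" where
  "junk_indices = filter (\<lambda>c. c div M \<noteq> c mod M) [0..<M * M]"

definition honest_user :: "nat \<Rightarrow> user" where
  "honest_user K = \<lparr>umem = \<lambda>_. 1,
     enc = \<lambda>t q1 q2. if q2 = flip (K - 1) q1 then [mat 1 1 (\<lambda>_. of_real (1 / sqrt (2 ^ f)))] else [],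
     outcomes = 2, aux = 1,
     dec = \<lambda>x. if x = 0 then map diag_kraus (decode_success d N n)
       else map diag_kraus (decode_failure d N n) @ map junk_kraus junk_indices\<rparr>"

definition the_protocol :: protocol where
  "the_protocol = \<lparr>pat = one_round f e, ebits = e, srv1 = phase_server 1, srv2 = phase_server (- 1),
     usr = honest_user\<rparr>"

lemma protocol_simps [simp]:
  "pat the_protocol = one_round f e" "ebits the_protocol = e"
  "srv1 the_protocol = phase_server 1" "srv2 the_protocol = phase_server (- 1)"
  "usr the_protocol = honest_user"
  "smem (phase_server s \<rho>) t = (if t = 0 then M else 1)"
  "act (phase_server s \<rho>) t q = [phase_mat s \<rho> q]"
  "umem (honest_user K) t = 1" "outcomes (honest_user K) = 2" "aux (honest_user K) = 1"
  by (simp_all add: the_protocol_def phase_server_def honest_user_def)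

lemma phase_mat_carrier [simp]: "phase_mat s \<rho> q \<in> carrier_mat M M"
  by (simp add: phase_mat_def)

lemma query_phase_diff: "query_phase \<rho> q1 k - query_phase \<rho> q2 k = phase_diff \<rho> q1 q2 k"
  by (simp add: query_phase_def phase_diff_def sum_subtractf left_diff_distrib)

lemma phase_server_strategy: "server_strategy 1 (\<lambda>_. f) (\<lambda>_. e) (phase_server s \<rho>)"
proof -
  have "(\<Sum>k<M. cnj (phase_mat s \<rho> q $$ (k, i)) * phase_mat s \<rho> q $$ (k, j)) = of_bool (i = j)"
    if "i < M" "j < M" for q i j
  proof -
    have "(\<Sum>k<M. cnj (phase_mat s \<rho> q $$ (k, i)) * phase_mat s \<rho> q $$ (k, j)) =
        (\<Sum>k<M. if k = i then of_bool (i = j) else 0)"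
      by (intro sum.cong refl) (use that in \<open>auto simp: phase_mat_def cis_cnj cis_mult\<close>)
    then show ?thesis using that by simp
  qed
  then have "trace_preserving M [phase_mat s \<rho> q]" for q
    by (subst trace_preserving_iff[where m = M]) simp_all
  then show ?thesis by (simp add: server_strategy_def)
qed

lemma honest_user_strategy: "user_strategy (one_round f e) d (honest_user K)"
proof -
  define V where "V = mat 1 1 (\<lambda>_. complex_of_real (1 / sqrt (2 ^ f)))"
  have enc: "enc (honest_user K) t q1 q2 = (if q2 = flip (K - 1) q1 then [V] else [])" for t q1 q2
    by (simp add: honest_user_def V_def)
  have VV: "cnj (V $$ (0, 0)) * V $$ (0, 0) = of_real (1 / 2 ^ f)"
    by (simp add: V_def flip: of_real_mult)
  let ?encs = "concat [enc (honest_user K) 0 q1 q2. q1 \<leftarrow> bits f, q2 \<leftarrow> bits f]"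
  have "set ?encs \<subseteq> carrier_mat 1 1" by (auto simp: enc V_def split: if_splits)
  moreover have "(\<Sum>A\<leftarrow>?encs. \<Sum>k<1. cnj (A $$ (k, 0)) * A $$ (k, 0)) = 1"
  proof -
    have "(\<Sum>A\<leftarrow>?encs. \<Sum>k<1. cnj (A $$ (k, 0)) * A $$ (k, 0)) =
        (\<Sum>q1\<leftarrow>bits f. \<Sum>q2\<leftarrow>bits f. if q2 = flip (K - 1) q1 then of_real (1 / 2 ^ f) else 0)"
      by (simp add: map_concat sum_list_concat comp_def enc)
        (intro sum_list_cong, use VV in simp)
    also have "\<dots> = (\<Sum>q1\<leftarrow>bits f. of_real (1 / 2 ^ f))"
      by (rule sum_list_cong) (subst sum_list_zero_off, simp_all add: set_bits)
    also have "\<dots> = 1" by (simp add: sum_bits card_bits)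
    finally show ?thesis .
  qed
  ultimately have enc_tp: "trace_preserving 1 ?encs"
    by (subst trace_preserving_iff[where m = 1]) simp_all
  let ?decs = "concat [dec (honest_user K) x. x \<leftarrow> [0..<2]]"
  have decs: "?decs = map diag_kraus (decode_success d N n @ decode_failure d N n) @
      map junk_kraus junk_indices"
    by (simp add: honest_user_def upt_rec numeral_2_eq_2)
  have "trace_preserving (M * M) ?decs"
  proof (subst trace_preserving_iff[where m = d], safe)
    show "A \<in> carrier_mat d (M * M)" if "A \<in> set ?decs" for A
      using that unfolding decs by (auto simp: diag_kraus_def junk_kraus_def)
    fix i j assume ij: "i < M * M" "j < M * M"
    let ?D = "\<lambda>i. i div M = i mod M"
    have "(\<Sum>A\<leftarrow>?decs. \<Sum>k<d. cnj (A $$ (k, i)) * A $$ (k, j)) =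
        (\<Sum>L\<leftarrow>decode_success d N n @ decode_failure d N n.
          \<Sum>k<d. cnj (diag_kraus L $$ (k, i)) * diag_kraus L $$ (k, j)) +
        (\<Sum>c\<leftarrow>junk_indices. \<Sum>k<d. cnj (junk_kraus c $$ (k, i)) * junk_kraus c $$ (k, j))"
      unfolding decs by (simp add: comp_def)
    also have "(\<Sum>L\<leftarrow>decode_success d N n @ decode_failure d N n.
          \<Sum>k<d. cnj (diag_kraus L $$ (k, i)) * diag_kraus L $$ (k, j)) =
        (\<Sum>L\<leftarrow>decode_success d N n @ decode_failure d N n.
          of_bool (?D i \<and> ?D j) * (\<Sum>k<d. cnj (L k (i mod M)) * L k (j mod M)))"
      unfolding sum_distrib_left
      by (intro sum_list_cong sum.cong refl) (use ij in \<open>auto simp: diag_kraus_def\<close>)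
    also have "\<dots> = of_bool (?D i \<and> ?D j) *
        kernel_gram d (decode_success d N n @ decode_failure d N n) (i mod M) (j mod M)"
      by (simp only: sum_list_const_mult kernel_gram_def)
    also have "\<dots> = of_bool (?D i \<and> ?D j) * of_bool (i mod M = j mod M)"
      by (subst decode_complete) (use d N in \<open>simp_all add: dim[symmetric]\<close>)
    also have "\<dots> = of_bool (i = j \<and> ?D i)"
    proof -
      have "i div M = j div M \<Longrightarrow> i mod M = j mod M \<Longrightarrow> i = j" by (metis div_mult_mod_eq)
      then show ?thesis by auto
    qed
    also have "(\<Sum>c\<leftarrow>junk_indices. \<Sum>k<d. cnj (junk_kraus c $$ (k, i)) * junk_kraus c $$ (k, j)) =
        (\<Sum>c\<leftarrow>junk_indices. of_bool (i = c \<and> j = c))"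
    proof (rule sum_list_cong)
      fix c
      have "(\<Sum>k<d. cnj (junk_kraus c $$ (k, i)) * junk_kraus c $$ (k, j)) =
          (\<Sum>k<d. if k = 0 then of_bool (i = c \<and> j = c) else 0)"
        by (intro sum.cong refl) (use ij in \<open>auto simp: junk_kraus_def\<close>)
      then show "(\<Sum>k<d. cnj (junk_kraus c $$ (k, i)) * junk_kraus c $$ (k, j)) =
          of_bool (i = c \<and> j = c)"
        using d by simp
    qed
    also have "\<dots> = (\<Sum>c\<in>{..<M * M}. if c = i then of_bool (i = j \<and> \<not> ?D i) else 0)"
    proof -
      have "(\<Sum>c\<leftarrow>junk_indices. of_bool (i = c \<and> j = c) :: complex) =
          (\<Sum>c\<in>set junk_indices. of_bool (i = c \<and> j = c))"
        by (rule sum_list_distinct_conv_sum_set) (simp add: junk_indices_def)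
      also have "\<dots> = (\<Sum>c\<in>{..<M * M}. if c = i then of_bool (i = j \<and> \<not> ?D i) else 0)"
        by (rule sum.mono_neutral_cong_left) (auto simp: junk_indices_def)
      finally show ?thesis .
    qed
    also have "\<dots> = of_bool (i = j \<and> \<not> ?D i)" using ij by simp
    finally show "(\<Sum>A\<leftarrow>?decs. \<Sum>k<d. cnj (A $$ (k, i)) * A $$ (k, j)) = of_bool (i = j)"
      by auto
  qed
  then show ?thesis
    using enc_tp unfolding user_strategy_def
    by (auto simp: enc V_def honest_user_def diag_kraus_def junk_kraus_def split: if_splits)
qed

text \<open>The index \<open>j\<close> stands for \<open>(k * umem u 0 + v) * M + l\<close>.
  Entanglement forces \<open>k = l\<close>, and the opposite signs of the servers leave the
  difference of the two query phases.\<close>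

definition received ::
  "user \<Rightarrow> (nat \<Rightarrow> complex mat) \<Rightarrow> bool list \<times> bool list \<times> complex mat \<Rightarrow> nat \<Rightarrow> complex" where
  "received u \<rho> = (\<lambda>(q1, q2, V) j.
     if j div M div umem u 0 = j mod M
     then of_real (1 / sqrt M) * V $$ (j div M mod umem u 0, 0) * cis (phase_diff \<rho> q1 q2 (j mod M))
     else 0)"

definition queries :: "user \<Rightarrow> (bool list \<times> bool list \<times> complex mat) list" where
  "queries u = [(q1, q2, V). q1 \<leftarrow> bits f, q2 \<leftarrow> bits f, V \<leftarrow> enc u 0 q1 q2]"

lemma joint_state_received:
  assumes u: "user_strategy (one_round f e) d u"
  shows "joint_state (one_round f e) (phase_server 1 \<rho>) (phase_server (- 1) \<rho>) u (ebit_state e) 1 =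
    outer (M * umem u 0 * M) (map (received u \<rho>) (queries u))"
proof -
  define um where "um = umem u 0"
  define \<phi> where "\<phi> = (\<lambda>j. of_bool (j div M = j mod M) * complex_of_real (1 / sqrt M))"
  define W where "W = (\<lambda>(q1, q2, V). kron (phase_mat 1 \<rho> q1) (kron V (phase_mat (- 1) \<rho> q2)))"
  have ops: "round_ops (one_round f e) (phase_server 1 \<rho>) (phase_server (- 1) \<rho>) u 0 = map W (queries u)"
    by (simp add: round_ops_def queries_def W_def map_concat comp_def)
  have V: "V \<in> carrier_mat um 1" if "(q1, q2, V) \<in> set (queries u)" for q1 q2 V
    using u that by (force simp: user_strategy_def queries_def um_def)
  have W: "W p \<in> carrier_mat (M * um * M) (M * M)" if p: "p \<in> set (queries u)" for p
  proof (cases p)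
    case (fields q1 q2 V)
    then show ?thesis
      using kron_carrier[OF phase_mat_carrier kron_carrier[OF V phase_mat_carrier]] p
      by (simp add: W_def mult.assoc)
  qed
  have "joint_state (one_round f e) (phase_server 1 \<rho>) (phase_server (- 1) \<rho>) u (ebit_state e) 1 =
      kraus_apply (M * um * M) (map W (queries u)) (outer (M * M) [\<phi>])"
    by (simp add: ops ebit_state_outer \<phi>_def um_def)
  also have "\<dots> = outer (M * um * M) (map (\<lambda>p. mat_app (M * M) (W p) \<phi>) (queries u))"
    by (subst kraus_apply_outer[where n = "M * M"]) (use W in \<open>auto simp: comp_def\<close>)
  also have "\<dots> = outer (M * um * M) (map (received u \<rho>) (queries u))"
  proof (rule outer_cong)
    fix p i assume p: "p \<in> set (queries u)" and i: "i < M * um * M"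
    obtain q1 q2 V where pq: "p = (q1, q2, V)" by (cases p)
    have um: "0 < um" using i by (cases "um = 0") auto
    have Vc: "V \<in> carrier_mat um 1" using V p pq by simp
    have VB: "kron V (phase_mat (- 1) \<rho> q2) \<in> carrier_mat (um * M) M"
      using kron_carrier[OF Vc phase_mat_carrier] by simp
    define k where "k = i div M div um"
    define v where "v = i div M mod um"
    define l where "l = i mod M"
    have idx: "i div (um * M) = k" "i mod (um * M) div M = v" "i mod (um * M) mod M = l"
      by (simp_all add: k_def v_def l_def div_mult2_eq mult.commute[of um M] mod_mult2_eq)
    have k: "k < M"
      using i by (simp add: k_def less_mult_imp_div_less)
    have l: "l < M" by (simp add: l_def)
    have entry: "W p $$ (i, j) = (phase_mat 1 \<rho> q1 $$ (k, j div M)) *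
        (V $$ (v, 0) * phase_mat (- 1) \<rho> q2 $$ (l, j mod M))" if j: "j < M * M" for j
    proof -
      have "W p $$ (i, j) = phase_mat 1 \<rho> q1 $$ (i div (um * M), j div M) *
          kron V (phase_mat (- 1) \<rho> q2) $$ (i mod (um * M), j mod M)"
        unfolding W_def pq prod.case
        by (rule kron_index[OF phase_mat_carrier VB]) (use i j in \<open>simp_all add: mult.assoc\<close>)
      also have "kron V (phase_mat (- 1) \<rho> q2) $$ (i mod (um * M), j mod M) =
          V $$ (i mod (um * M) div M, j mod M div M) *
          phase_mat (- 1) \<rho> q2 $$ (i mod (um * M) mod M, j mod M mod M)"
        by (rule kron_index[OF Vc phase_mat_carrier]) (use um in simp_all)
      finally show ?thesis unfolding idx by simp
    qed
    have "mat_app (M * M) (W p) \<phi> i = (\<Sum>j<M * M. phase_mat 1 \<rho> q1 $$ (k, j div M) *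
        (V $$ (v, 0) * phase_mat (- 1) \<rho> q2 $$ (l, j mod M)) *
        (of_bool (j div M = j mod M) * complex_of_real (1 / sqrt M)))"
      unfolding mat_app_def by (intro sum.cong refl) (simp add: entry \<phi>_def)
    also have "\<dots> = (\<Sum>a<M. \<Sum>b<M. phase_mat 1 \<rho> q1 $$ (k, a) *
        (V $$ (v, 0) * phase_mat (- 1) \<rho> q2 $$ (l, b)) *
        (of_bool (a = b) * complex_of_real (1 / sqrt M)))"
      by (rule sum_div_mod)
    also have "\<dots> = (\<Sum>a<M. \<Sum>b<M. if b = a then phase_mat 1 \<rho> q1 $$ (k, a) *
        (V $$ (v, 0) * phase_mat (- 1) \<rho> q2 $$ (l, a)) * complex_of_real (1 / sqrt M) else 0)"
      by (intro sum.cong refl) simp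
    also have "\<dots> = (\<Sum>a<M. if a = k then of_bool (k = l) * (cis (query_phase \<rho> q1 k) *
        (V $$ (v, 0) * cis (- query_phase \<rho> q2 k)) * complex_of_real (1 / sqrt M)) else 0)"
      by (intro sum.cong refl) (use k l in \<open>simp add: phase_mat_def\<close>)
    also have "\<dots> = of_bool (k = l) * (of_real (1 / sqrt M) * V $$ (v, 0) *
        (cis (query_phase \<rho> q1 k) * cis (- query_phase \<rho> q2 k)))"
      using k by simp
    also have "cis (query_phase \<rho> q1 k) * cis (- query_phase \<rho> q2 k) = cis (phase_diff \<rho> q1 q2 k)"
      unfolding cis_mult query_phase_diff[symmetric] by simp
    also have "of_bool (k = l) * (of_real (1 / sqrt M) * V $$ (v, 0) * cis (phase_diff \<rho> q1 q2 k)) =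
        received u \<rho> p i"
      unfolding received_def pq prod.case um_def[symmetric] k_def[symmetric] l_def[symmetric]
        v_def[symmetric] by simp
    finally show "mat_app (M * M) (W p) \<phi> i = received u \<rho> p i" .
  qed
  finally show ?thesis by (simp add: um_def)
qed

text \<open>The part due to the user's strategy, free of the messages, which enter
  \<open>final_vec\<close> through the phases only. The frequency argument relies on this
  separation.\<close>

definition final_coeff :: "user \<Rightarrow> complex mat \<Rightarrow> complex mat \<Rightarrow> nat \<Rightarrow> nat \<Rightarrow> complex" where
  "final_coeff u A V i k =
     (\<Sum>v<umem u 0. A $$ (i, (k * umem u 0 + v) * M + k) * V $$ (v, 0)) * of_real (1 / sqrt M)"

definition final_vec ::
  "user \<Rightarrow> (nat \<Rightarrow> complex mat) \<Rightarrow> complex mat \<times> bool list \<times> bool list \<times> complex mat \<Rightarrow> nat \<Rightarrow> complex"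
  where "final_vec u \<rho> = (\<lambda>(A, q1, q2, V) i. \<Sum>k<M. final_coeff u A V i k * cis (phase_diff \<rho> q1 q2 k))"

definition final_index ::
  "user \<Rightarrow> nat \<Rightarrow> (complex mat \<times> bool list \<times> bool list \<times> complex mat) list" where
  "final_index u x = [(A, p). A \<leftarrow> dec u x, p \<leftarrow> queries u]"

lemma final_state_outer:
  assumes u: "user_strategy (one_round f e) d u" and x: "x < outcomes u"
  shows "final_state d the_protocol \<rho> u x = outer (d * aux u) (map (final_vec u \<rho>) (final_index u x))"
proof -
  define um where "um = umem u 0"
  let ?J = "outer (M * um * M) (map (received u \<rho>) (queries u))"
  have decs: "set (dec u x) \<subseteq> carrier_mat (d * aux u) (M * um * M)"
    using u x by (simp add: user_strategy_def um_def)
  have "[kron (1\<^sub>m 1) (kron A (1\<^sub>m 1)). A \<leftarrow> dec u x] = dec u x"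
    using decs kron_one by (intro map_idI) blast
  then have "final_state d the_protocol \<rho> u x =
      ptrace 1 (d * aux u) 1 (kraus_apply (d * aux u) (dec u x) ?J)"
    using joint_state_received[OF u, of \<rho>]
    by (simp add: final_state_def user_state_def Let_def um_def)
  also have "\<dots> = kraus_apply (d * aux u) (dec u x) ?J"
    by (rule ptrace_one) (simp add: kraus_apply_def)
  also have "\<dots> = outer (d * aux u) [mat_app (M * um * M) A v. A \<leftarrow> dec u x, v \<leftarrow> map (received u \<rho>) (queries u)]"
    by (rule kraus_apply_outer[OF decs])
  also have "[mat_app (M * um * M) A v. A \<leftarrow> dec u x, v \<leftarrow> map (received u \<rho>) (queries u)] =
      map (\<lambda>(A, p). mat_app (M * um * M) A (received u \<rho> p)) (final_index u x)"
    by (simp add: final_index_def map_concat comp_def)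
  also have "outer (d * aux u) \<dots> = outer (d * aux u) (map (final_vec u \<rho>) (final_index u x))"
  proof (rule outer_cong)
    fix y :: "complex mat \<times> bool list \<times> bool list \<times> complex mat" and i
    obtain A q1 q2 V where y: "y = (A, q1, q2, V)" by (cases y)
    have "mat_app (M * um * M) A (received u \<rho> (q1, q2, V)) i =
        (\<Sum>k<M. \<Sum>v<um. \<Sum>l<M. A $$ (i, (k * um + v) * M + l) * received u \<rho> (q1, q2, V) ((k * um + v) * M + l))"
      unfolding mat_app_def
      using sum_mult_add[of "\<lambda>j. A $$ (i, j) * received u \<rho> (q1, q2, V) j" M "M * um"]
        sum_mult_add[of "\<lambda>p. \<Sum>l<M. A $$ (i, p * M + l) * received u \<rho> (q1, q2, V) (p * M + l)" um M]
      by simp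
    also have "\<dots> = (\<Sum>k<M. \<Sum>v<um. \<Sum>l<M. if l = k then A $$ (i, (k * um + v) * M + k) *
        (of_real (1 / sqrt M) * V $$ (v, 0) * cis (phase_diff \<rho> q1 q2 k)) else 0)"
      by (intro sum.cong refl) (auto simp: received_def um_def[symmetric])
    also have "\<dots> = (\<Sum>k<M. \<Sum>v<um. A $$ (i, (k * um + v) * M + k) *
        (of_real (1 / sqrt M) * V $$ (v, 0) * cis (phase_diff \<rho> q1 q2 k)))"
      by simp
    also have "\<dots> = final_vec u \<rho> y i"
      unfolding y final_vec_def prod.case final_coeff_def um_def sum_distrib_right
      by (intro sum.cong refl) (simp only: mult_ac)
    finally show "(\<lambda>(A, p). mat_app (M * um * M) A (received u \<rho> p)) y i = final_vec u \<rho> y i"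
      by (simp add: y)
  qed
  finally show ?thesis .
qed

section \<open>Secrecy and correctness\<close>

lemma phase_diff_cong:
  assumes "\<And>l. l < f \<Longrightarrow> l \<noteq> K - 1 \<Longrightarrow> q1 ! l = q2 ! l" and K: "1 \<le> K" "\<rho>' K = \<rho> K"
  shows "phase_diff \<rho>' q1 q2 k = phase_diff \<rho> q1 q2 k"
  unfolding phase_diff_def
proof (intro sum.cong refl)
  fix l assume "l \<in> {..<f}"
  then show "(of_bool (q1 ! l) - of_bool (q2 ! l)) * message_phase \<rho>' l k =
      (of_bool (q1 ! l) - of_bool (q2 ! l)) * message_phase \<rho> l k"
    using assms by (cases "l = K - 1") (simp_all add: message_phase_def)
qed

lemma dec_honest:
  "dec (honest_user K) 0 = map diag_kraus (decode_success d N n)"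
  "dec (honest_user K) (Suc 0) =
    map diag_kraus (decode_failure d N n) @ map junk_kraus junk_indices"
  by (simp_all add: honest_user_def)

text \<open>A zero diagonal entry of the output is a sum of squared moduli over the kept register
  and all vectors of the mixture, so each of them is zero.\<close>

lemma exact_output_vanishes:
  assumes u: "user_strategy (one_round f e) d u" and x: "x < outcomes u"
    and out: "outputs d the_protocol \<rho> u x (basis_state d a)"
    and i: "i < d" "i \<noteq> a" and l: "l < aux u" and y: "y \<in> set (final_index u x)"
  shows "final_vec u \<rho> y (i * aux u + l) = 0"
proof -
  let ?h = "\<lambda>y l. (cmod (final_vec u \<rho> y (i * aux u + l)))\<^sup>2"
  have "complex_of_real (\<Sum>l<aux u. \<Sum>y\<leftarrow>final_index u x. ?h y l) =
      (\<Sum>l<aux u. outer (d * aux u) (map (final_vec u \<rho>) (final_index u x)) $$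
        (i * aux u + l, i * aux u + l))"
  proof -
    have of_real_list: "complex_of_real (\<Sum>y\<leftarrow>ys. g y) = (\<Sum>y\<leftarrow>ys. of_real (g y))"
      for g :: "'z \<Rightarrow> real" and ys
      by (induction ys) simp_all
    show ?thesis
      unfolding of_real_sum of_real_list
      by (intro sum.cong refl)
        (use i in \<open>simp add: outer_index mult_add_less comp_def complex_norm_square[symmetric]\<close>)
  qed
  also have "\<dots> = output_state d the_protocol \<rho> u x $$ (i, i)"
    using i by (simp add: output_state_def ptrace_def final_state_outer[OF u x])
  also have "\<dots> = 0"
    using out i unfolding outputs_def by (simp add: basis_state_def)
  finally have "(\<Sum>l<aux u. \<Sum>y\<leftarrow>final_index u x. ?h y l) = 0" by (simp only: of_real_eq_0_iff)
  then have "(\<Sum>y\<leftarrow>final_index u x. ?h y l) = 0"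
    using l by (subst (asm) sum_nonneg_eq_0_iff) (auto intro!: sum_list_nonneg)
  then have "?h y l = 0"
    using y by (subst (asm) sum_list_nonneg_eq_0_iff) auto
  then show ?thesis by simp
qed

text \<open>If the queries differ at a second message, let that message run through the geometric family
  while the intended one is \<open>|0\<rangle>\<langle>0|\<close> or \<open>|1\<rangle>\<langle>1|\<close>. A row of the Kraus operator other than the
  one of the intended state kills infinitely many phase vectors, hence its coefficients sum to zero
  over every frequency class, and it kills the phase vector of every message tuple.\<close>

lemma two_messages_vanish:
  assumes u: "user_strategy (one_round f e) d u" and x: "x < outcomes u"
    and K: "K \<in> {1..f}"
    and out: "\<And>\<rho>. \<rho> \<in> messages d f \<Longrightarrow> outputs d the_protocol \<rho> u x (\<rho> K)"
    and y: "(A, q1, q2, V) \<in> set (final_index u x)"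
    and l: "l < f" "l \<noteq> K - 1" "q1 ! l \<noteq> q2 ! l" and i: "i < d * aux u"
  shows "final_vec u \<rho> (A, q1, q2, V) i = 0"
proof -
  define D where "D = trial_dim N"
  have aux: "0 < aux u" using i by (cases "aux u = 0") auto
  have ii: "i = i div aux u * aux u + i mod aux u" "i mod aux u < aux u" "i div aux u < d"
    using i aux by (simp_all add: less_mult_imp_div_less)
  \<comment> \<open>An intended state that does not meet the output row of \<open>i\<close>; |0> and
    |1> are both available since \<open>2 \<le> d\<close>.\<close>
  define a where "a = (if i div aux u = 0 then 1 else 0 :: nat)"
  have a: "i div aux u \<noteq> a" "a < d" using d by (auto simp: a_def)
  define \<rho>0 where "\<rho>0 = (\<lambda>_::nat. basis_state d 0)(K := basis_state d a)"
  define s where "s = (of_bool (q1 ! l) - of_bool (q2 ! l) :: real)"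
  have s: "s = 1 \<or> s = - 1" using l(3) by (auto simp: s_def)
  \<comment> \<open>The sign with which message \<open>l\<close> enters is absorbed into the integer
    frequency.\<close>
  define C where "C k = (if s = 1 then freq D n k else - freq D n k)" for k
  have C: "of_int (C k) = s * of_int (freq D n k)" for k using s by (auto simp: C_def)
  have C_eq: "C k = C k' \<Longrightarrow> message_phase \<rho> l' k = message_phase \<rho> l' k'" for k k' \<rho> l'
    unfolding message_phase_def D_def[symmetric]
    by (rule freq_determines_angle) (simp add: C_def split: if_splits)
  \<comment> \<open>The phase of all messages but \<open>l\<close>, frozen at
    \<open>\<rho>0\<close>; like every message phase it is constant on frequency classes.\<close>
  define c where
    "c k = cis (\<Sum>l'\<in>{..<f} - {l}. (of_bool (q1 ! l') - of_bool (q2 ! l')) * message_phase \<rho>0 l' k)" for k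
  obtain T where T: "infinite T" "T \<subseteq> {0<..<pi}"
    and fam: "\<And>\<tau>. \<tau> \<in> T \<Longrightarrow> \<exists>\<sigma>. density d \<sigma> \<and> message_angles d N n \<sigma> = geometric_angles n \<tau>"
    using infinitely_many_geometric_messages[OF d N n] by blast
  have "(\<Sum>k<M. final_coeff u A V i k * cis (phase_diff \<rho> q1 q2 k)) = 0"
  proof (rule class_function_sum_zero[OF T, where c = c and C = C])
    fix \<tau> assume "\<tau> \<in> T"
    then obtain \<sigma> where \<sigma>: "density d \<sigma>" "message_angles d N n \<sigma> = geometric_angles n \<tau>"
      using fam by blast
    define \<rho>1 where "\<rho>1 = \<rho>0(Suc l := \<sigma>)"
    have K1: "\<rho>1 K = basis_state d a" using l K by (auto simp: \<rho>1_def \<rho>0_def)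
    have "\<rho>1 \<in> messages d f"
      using \<sigma>(1) a d by (auto simp: messages_def \<rho>1_def \<rho>0_def density_basis_state)
    then have "final_vec u \<rho>1 (A, q1, q2, V) i = 0"
      using exact_output_vanishes[OF u x _ ii(3) a(1) ii(2) y, of \<rho>1] out[of \<rho>1] K1 ii(1) by simp
    moreover have "cis (phase_diff \<rho>1 q1 q2 k) = c k * cis (\<tau> * of_int (C k))" for k
    proof -
      have "phase_diff \<rho>1 q1 q2 k = s * message_phase \<rho>1 l k +
          (\<Sum>l'\<in>{..<f} - {l}. (of_bool (q1 ! l') - of_bool (q2 ! l')) * message_phase \<rho>1 l' k)"
        unfolding phase_diff_def s_def using l(1) by (subst sum.remove[of _ l]) auto
      also have "(\<Sum>l'\<in>{..<f} - {l}. (of_bool (q1 ! l') - of_bool (q2 ! l')) * message_phase \<rho>1 l' k) =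
          (\<Sum>l'\<in>{..<f} - {l}. (of_bool (q1 ! l') - of_bool (q2 ! l')) * message_phase \<rho>0 l' k)"
        by (intro sum.cong refl) (auto simp: message_phase_def \<rho>1_def)
      also have "message_phase \<rho>1 l k = \<tau> * of_int (freq D n k)"
        by (simp add: message_phase_def \<rho>1_def \<sigma>(2) angle_geometric D_def)
      finally show ?thesis by (simp add: c_def C cis_mult algebra_simps)
    qed
    ultimately show "(\<Sum>k<M. final_coeff u A V i k * c k * cis (\<tau> * of_int (C k))) = 0"
      by (simp add: final_vec_def mult.assoc)
  next
    show "c k \<noteq> 0" for k by (simp add: c_def)
    show "c k = c k'" if "C k = C k'" for k k' using C_eq[OF that] by (simp add: c_def)
    show "cis (phase_diff \<rho> q1 q2 k) = cis (phase_diff \<rho> q1 q2 k')" if "C k = C k'" for k k'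
      using C_eq[OF that] by (simp add: phase_diff_def)
  qed
  then show ?thesis by (simp add: final_vec_def)
qed

lemma protocol_user_secret: "user_secret f the_protocol"
  unfolding user_secret_def
proof (intro allI impI)
  fix s1 s2 :: server and \<sigma>
  assume s1: "server_strategy (rounds (pat the_protocol)) (up1 (pat the_protocol)) (down1 (pat the_protocol)) s1"
    and s2: "server_strategy (rounds (pat the_protocol)) (up2 (pat the_protocol)) (down2 (pat the_protocol)) s2"
    and \<sigma>: "density (smem s1 0 * smem s2 0) \<sigma>"
  have "query_round f e s1 s2 (honest_user K) (K - 1) \<sigma>" for K
  proof
    show "server_strategy 1 (\<lambda>_. f) (\<lambda>_. e) s1" using s1 by (simp add: one_round_def)
    show "server_strategy 1 (\<lambda>_. f) (\<lambda>_. e) s2" using s2 by (simp add: one_round_def)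
    show "\<sigma> \<in> carrier_mat (smem s1 0 * smem s2 0) (smem s1 0 * smem s2 0)"
      using \<sigma> by (simp add: density_def)
  qed (simp_all add: honest_user_def)
  note states = query_round.server1_state_eq[OF this] query_round.server2_state_eq[OF this]
  show "\<exists>\<tau>1 \<tau>2. \<forall>K\<in>{1..f}.
      server1_state (pat the_protocol) s1 s2 (usr the_protocol K) \<sigma> = \<tau>1 \<and>
      server2_state (pat the_protocol) s1 s2 (usr the_protocol K) \<sigma> = \<tau>2"
    unfolding protocol_simps states by blast
qed

lemma queries_honest:
  "queries (honest_user K) =
    map (\<lambda>q. (q, flip (K - 1) q, mat 1 1 (\<lambda>_. of_real (1 / sqrt (2 ^ f))))) (bits f)"
proof -
  let ?V = "mat 1 1 (\<lambda>_. complex_of_real (1 / sqrt (2 ^ f)))"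
  have one: "concat (map (\<lambda>q2. if q2 = p then [h q2] else []) qs) = (if p \<in> set qs then [h p] else [])"
    if "distinct qs" for h :: "bool list \<Rightarrow> 'z" and p qs
    using that by (induction qs) auto
  have "queries (honest_user K) = concat (map (\<lambda>q1. concat (map (\<lambda>q2.
      if q2 = flip (K - 1) q1 then [(q1, q2, ?V)] else []) (bits f))) (bits f))"
    unfolding queries_def honest_user_def user.simps by (simp add: if_distrib cong: if_cong)
  also have "\<dots> = concat (map (\<lambda>q1. [(q1, flip (K - 1) q1, ?V)]) (bits f))"
    unfolding one[OF distinct_bits] by (intro arg_cong[where f = concat] map_cong refl) (simp add: set_bits)
  finally show ?thesis by simp
qed

lemma flip_agree: "l \<noteq> j \<Longrightarrow> flip j q ! l = q ! l"
  by (simp add: flip_def)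

lemma flip_at: "j < length q \<Longrightarrow> flip j q ! j = (\<not> q ! j)"
  by (simp add: flip_def)

text \<open>Honest queries differ at \<open>K - 1\<close> only, so both outcomes, failure included,
  depend on \<open>\<rho> K\<close> alone. For an arbitrary user the vectors are treated one by one:
  the query pair agrees off \<open>K - 1\<close>, or the vector vanishes for both message
  tuples.\<close>

lemma protocol_server_secret: "server_secret d f the_protocol"
  unfolding server_secret_def protocol_simps
proof (intro ballI conjI allI impI)
  fix K x :: nat and \<rho> \<rho>' :: "nat \<Rightarrow> complex mat"
  assume K: "K \<in> {1..f}" and "x < 2" and eq: "\<rho>' K = \<rho> K"
  then have x: "x < outcomes (honest_user K)" by simp
  show "final_state d the_protocol \<rho>' (honest_user K) x = final_state d the_protocol \<rho> (honest_user K) x"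
    unfolding final_state_outer[OF honest_user_strategy x]
  proof (rule outer_cong)
    fix y i assume y: "y \<in> set (final_index (honest_user K) x)"
    obtain A q1 q2 V where yy: "y = (A, q1, q2, V)" by (cases y)
    have "q2 = flip (K - 1) q1" using y yy by (auto simp: final_index_def queries_honest)
    then have "phase_diff \<rho>' q1 q2 k = phase_diff \<rho> q1 q2 k" for k
      using K eq by (intro phase_diff_cong[where K = K]) (auto simp: flip_agree)
    then show "final_vec (honest_user K) \<rho>' y i = final_vec (honest_user K) \<rho> y i"
      by (simp add: final_vec_def yy)
  qed
next
  fix K :: nat and u x and \<rho> \<rho>' :: "nat \<Rightarrow> complex mat"
  assume K: "K \<in> {1..f}" and u: "user_strategy (one_round f e) d u" and x: "x < outcomes u"
    and out: "\<forall>\<rho>\<in>messages d f. outputs d the_protocol \<rho> u x (\<rho> K)" and eq: "\<rho>' K = \<rho> K"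
  show "final_state d the_protocol \<rho>' u x = final_state d the_protocol \<rho> u x"
    unfolding final_state_outer[OF u x]
  proof (rule outer_cong)
    fix y i assume y: "y \<in> set (final_index u x)" and i: "i < d * aux u"
    obtain A q1 q2 V where yy: "y = (A, q1, q2, V)" by (cases y)
    show "final_vec u \<rho>' y i = final_vec u \<rho> y i"
    proof (cases "\<exists>l<f. l \<noteq> K - 1 \<and> q1 ! l \<noteq> q2 ! l")
      case True
      then obtain l where l: "l < f" "l \<noteq> K - 1" "q1 ! l \<noteq> q2 ! l" by blast
      show ?thesis
        using two_messages_vanish[OF u x K _ y[unfolded yy] l i] out by (simp add: yy)
    next
      case False
      then have "phase_diff \<rho>' q1 q2 k = phase_diff \<rho> q1 q2 k" for k
        using K eq by (intro phase_diff_cong[where K = K]) auto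
      then show ?thesis by (simp add: final_vec_def yy)
    qed
  qed
qed

text \<open>The sign \<open>s\<close> tells which of the two servers saw the bit set.\<close>

lemma phase_diff_flip:
  assumes "length q = f" "K \<in> {1..f}"
  shows "\<exists>s. (s = 1 \<or> s = - 1) \<and> (\<forall>k. phase_diff \<rho> q (flip (K - 1) q) k = s * message_phase \<rho> (K - 1) k)"
proof -
  let ?s = "of_bool (q ! (K - 1)) - of_bool (\<not> q ! (K - 1)) :: real"
  have K: "K - 1 < f" using assms(2) by auto
  have "phase_diff \<rho> q (flip (K - 1) q) k = ?s * message_phase \<rho> (K - 1) k" for k
  proof -
    have at: "flip (K - 1) q ! (K - 1) = (\<not> q ! (K - 1))"
      using K assms(1) by (intro flip_at) simp
    have "(of_bool (q ! l) - of_bool (flip (K - 1) q ! l)) * message_phase \<rho> l k =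
        (if l = K - 1 then ?s * message_phase \<rho> (K - 1) k else 0)" for l
    proof (cases "l = K - 1")
      case True
      then show ?thesis by (simp only: at simp_thms if_True)
    next
      case False
      then show ?thesis by (simp add: flip_agree)
    qed
    then have "phase_diff \<rho> q (flip (K - 1) q) k =
        (\<Sum>l<f. if l = K - 1 then ?s * message_phase \<rho> (K - 1) k else 0)"
      unfolding phase_diff_def by simp
    then show ?thesis using K by simp
  qed
  moreover have "?s = 1 \<or> ?s = - 1" by (cases "q ! (K - 1)") simp_all
  ultimately show ?thesis by blast
qed

lemma final_vec_diag_kraus:
  assumes "i < d"
  shows "final_vec (honest_user K) \<rho> (diag_kraus L, q1, q2, mat 1 1 (\<lambda>_. of_real (1 / sqrt (2 ^ f)))) i =
    of_real (1 / sqrt (2 ^ f) * (1 / sqrt M)) * kernel_app M L (\<lambda>k. cis (phase_diff \<rho> q1 q2 k)) i"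
proof -
  have "final_coeff (honest_user K) (diag_kraus L) (mat 1 1 (\<lambda>_. of_real (1 / sqrt (2 ^ f)))) i k =
      of_real (1 / sqrt (2 ^ f) * (1 / sqrt M)) * L i k" if "k < M" for k
    using that assms mult_add_less[of k M k M] by (simp add: final_coeff_def diag_kraus_def)
  then show ?thesis
    unfolding final_vec_def prod.case kernel_app_def sum_distrib_left
    by (intro sum.cong refl) (simp only: lessThan_iff mult.assoc)
qed

lemma final_vec_junk_kraus:
  assumes "i < d" "c \<in> set junk_indices"
  shows "final_vec (honest_user K) \<rho> (junk_kraus c, q1, q2, V) i = 0"
proof -
  have "final_coeff (honest_user K) (junk_kraus c) V i k = 0" if "k < M" for k
    using that assms mult_add_less[of k M k M]
    by (auto simp: final_coeff_def junk_kraus_def junk_indices_def)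
  then show ?thesis by (simp add: final_vec_def)
qed

text \<open>Each of the \<open>2 ^ f\<close> queries yields the same value, by \<open>val\<close> at
  its sign, so averaging over them changes nothing; \<open>1 / M\<close> normalizes the shared
  state.\<close>

lemma honest_gram:
  assumes K: "K \<in> {1..f}" and ij: "i < d" "j < d"
    and val: "\<And>s. s = 1 \<or> s = - 1 \<Longrightarrow>
      kernel_out M Ls (\<lambda>k. cis (s * message_phase \<rho> (K - 1) k)) i j = v"
  shows "(\<Sum>y\<leftarrow>[(A, p). A \<leftarrow> map diag_kraus Ls, p \<leftarrow> queries (honest_user K)].
      final_vec (honest_user K) \<rho> y i * cnj (final_vec (honest_user K) \<rho> y j)) = of_real (1 / M) * v"
proof -
  define c where "c = 1 / sqrt (2 ^ f) * (1 / sqrt M)"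
  have c: "complex_of_real c * of_real c = of_real (1 / (2 ^ f * M))"
    by (simp add: c_def real_sqrt_mult[symmetric] flip: of_real_mult)
  have "(\<Sum>y\<leftarrow>[(A, p). A \<leftarrow> map diag_kraus Ls, p \<leftarrow> queries (honest_user K)].
      final_vec (honest_user K) \<rho> y i * cnj (final_vec (honest_user K) \<rho> y j)) =
      (\<Sum>L\<leftarrow>Ls. \<Sum>q\<leftarrow>bits f. of_real (1 / (2 ^ f * M)) *
        (kernel_app M L (\<lambda>k. cis (phase_diff \<rho> q (flip (K - 1) q) k)) i *
         cnj (kernel_app M L (\<lambda>k. cis (phase_diff \<rho> q (flip (K - 1) q) k)) j)))"
    unfolding sum_list_product queries_honest map_map comp_def final_vec_diag_kraus[OF ij(1)]
      final_vec_diag_kraus[OF ij(2)] c_def[symmetric] c[symmetric]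
    by (simp add: mult_ac)
  also have "\<dots> = (\<Sum>q\<leftarrow>bits f. of_real (1 / (2 ^ f * M)) *
      kernel_out M Ls (\<lambda>k. cis (phase_diff \<rho> q (flip (K - 1) q) k)) i j)"
    unfolding kernel_out_def sum_list_const_mult[symmetric] by (rule sum_list_swap)
  also have "\<dots> = (\<Sum>q\<leftarrow>bits f. of_real (1 / (2 ^ f * M)) * v)"
  proof (rule sum_list_cong)
    fix q assume "q \<in> set (bits f)"
    then obtain s :: real where "s = 1 \<or> s = - 1"
      "\<forall>k. phase_diff \<rho> q (flip (K - 1) q) k = s * message_phase \<rho> (K - 1) k"
      using phase_diff_flip[OF _ K, of q \<rho>] by (auto simp: set_bits)
    then show "of_real (1 / (2 ^ f * M)) * kernel_out M Ls (\<lambda>k. cis (phase_diff \<rho> q (flip (K - 1) q) k)) i j =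
        of_real (1 / (2 ^ f * M)) * v"
      using val[of s] by simp
  qed
  also have "\<dots> = of_real (1 / M) * v" by (simp add: sum_bits card_bits)
  finally show ?thesis .
qed

text \<open>The probability that a single trial fails.\<close>

definition fail_ratio :: "complex mat \<Rightarrow> real" where
  "fail_ratio \<rho> = 1 - weight d N (message_angles d N n \<rho>) / trial_dim N"

text \<open>The weight is at least \<open>N / 2\<close> out of \<open>4 * N * N\<close>, whence
  \<open>1 / (8 * N)\<close>; it is at most \<open>2 * d * N \<le> N * N\<close>, so failure keeps
  positive probability and the protocol is truly probabilistic.\<close>

lemma fail_ratio_bounds:
  assumes "density d \<rho>"
  shows "0 < fail_ratio \<rho>" "fail_ratio \<rho> \<le> 1 - 1 / (8 * N)"
proof -
  let ?w = "weight d N (message_angles d N n \<rho>)"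
  have N0: "0 < real N" using d N by simp
  have "?w \<le> 2 * real d * N" by (rule weight_le)
  also have "\<dots> \<le> real N * N" using N by (intro mult_right_mono) linarith+
  also have "\<dots> < real (trial_dim N)" using N0 by (simp add: trial_dim_def)
  finally show "0 < fail_ratio \<rho>" using N0 by (simp add: fail_ratio_def trial_dim_def)
  have "real N / 2 \<le> ?w"
    using message_angles_encodes[OF assms N, of n] N0 by (simp add: encodes_def)
  then have "real N / 2 / trial_dim N \<le> ?w / trial_dim N" by (rule divide_right_mono) simp
  then show "fail_ratio \<rho> \<le> 1 - 1 / (8 * N)" using N0 by (simp add: fail_ratio_def trial_dim_def)
qed

lemma honest_final_state:
  assumes K: "K \<in> {1..f}" and \<rho>: "\<rho> \<in> messages d f"
  shows "final_state d the_protocol \<rho> (honest_user K) 0 =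
      of_real (1 - fail_ratio (\<rho> K) ^ n) \<cdot>\<^sub>m \<rho> K"
    and "final_state d the_protocol \<rho> (honest_user K) 1 =
      of_real (fail_ratio (\<rho> K) ^ n) \<cdot>\<^sub>m basis_state d 0"
proof -
  let ?\<beta> = "message_angles d N n (\<rho> K)"
  let ?m = "real (trial_dim N)"
  let ?w = "weight d N ?\<beta>"
  have dens: "density d (\<rho> K)" using K \<rho> by (simp add: messages_def)
  have N0: "0 < N" using d N by simp
  have dN: "d \<le> N" "0 < d" using d N by auto
  have enc: "encodes d N (\<rho> K) ?\<beta>" by (rule message_angles_encodes[OF dens N N0])
  have phase: "message_phase \<rho> (K - 1) k = angle (trial_dim N) n ?\<beta> k" for k
    using K by (simp add: message_phase_def)
  have m: "0 < ?m" using N0 by (simp add: trial_dim_def)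
  have M: "(2::real) ^ e = ?m ^ n" using arg_cong[OF dim, of real] by simp
  have ratio: "(?m - ?w) ^ n / M = fail_ratio (\<rho> K) ^ n"
  proof -
    have "fail_ratio (\<rho> K) = (?m - ?w) / ?m" using m by (simp add: fail_ratio_def diff_divide_distrib)
    then show ?thesis by (simp add: M power_divide)
  qed
  have val0: "of_real (1 / M) * (complex_of_real (?m ^ n - (?m - ?w) ^ n) * \<rho> K $$ (i, j)) =
      of_real (1 - fail_ratio (\<rho> K) ^ n) * \<rho> K $$ (i, j)" for i j
  proof -
    have "1 / M * (?m ^ n - (?m - ?w) ^ n) = 1 - fail_ratio (\<rho> K) ^ n"
      using m unfolding ratio[symmetric] by (simp add: M diff_divide_distrib)
    then show ?thesis by (simp only: mult.assoc[symmetric] of_real_mult[symmetric])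
  qed
  have val1: "of_real (1 / M) * (complex_of_real ((?m - ?w) ^ n) * z) =
      of_real (fail_ratio (\<rho> K) ^ n) * z" for z
    unfolding ratio[symmetric] by simp
  have carrier: "\<rho> K \<in> carrier_mat d d" using dens by (simp add: density_def)
  show "final_state d the_protocol \<rho> (honest_user K) 0 =
      of_real (1 - fail_ratio (\<rho> K) ^ n) \<cdot>\<^sub>m \<rho> K"
  proof (rule eq_matI)
    fix i j
    assume "i < dim_row (of_real (1 - fail_ratio (\<rho> K) ^ n) \<cdot>\<^sub>m \<rho> K)"
      "j < dim_col (of_real (1 - fail_ratio (\<rho> K) ^ n) \<cdot>\<^sub>m \<rho> K)"
    then have ij: "i < d" "j < d" using carrier by auto
    have "final_state d the_protocol \<rho> (honest_user K) 0 $$ (i, j) =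
        (\<Sum>y\<leftarrow>[(A, p). A \<leftarrow> map diag_kraus (decode_success d N n), p \<leftarrow> queries (honest_user K)].
          final_vec (honest_user K) \<rho> y i * cnj (final_vec (honest_user K) \<rho> y j))"
      using ij by (simp add: final_state_outer[OF honest_user_strategy] outer_index final_index_def
          dec_honest comp_def)
    also have "\<dots> = of_real (1 / M) * (of_real (?m ^ n - (?m - ?w) ^ n) * \<rho> K $$ (i, j))"
      by (rule honest_gram[OF K ij]) (simp only: phase dim decode_out(1)[OF _ dN enc ij])
    finally show "final_state d the_protocol \<rho> (honest_user K) 0 $$ (i, j) =
        (of_real (1 - fail_ratio (\<rho> K) ^ n) \<cdot>\<^sub>m \<rho> K) $$ (i, j)"
      unfolding val0 using ij carrier by simp
  qed (use carrier in \<open>simp_all add: final_state_outer[OF honest_user_strategy] outer_def\<close>)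
  show "final_state d the_protocol \<rho> (honest_user K) 1 =
      of_real (fail_ratio (\<rho> K) ^ n) \<cdot>\<^sub>m basis_state d 0"
  proof (rule eq_matI)
    fix i j
    assume "i < dim_row (of_real (fail_ratio (\<rho> K) ^ n) \<cdot>\<^sub>m basis_state d 0)"
      "j < dim_col (of_real (fail_ratio (\<rho> K) ^ n) \<cdot>\<^sub>m basis_state d 0)"
    then have ij: "i < d" "j < d" by (auto simp: basis_state_def)
    have junk: "(\<Sum>y\<leftarrow>[(A, p). A \<leftarrow> map junk_kraus junk_indices, p \<leftarrow> queries (honest_user K)].
        final_vec (honest_user K) \<rho> y i * cnj (final_vec (honest_user K) \<rho> y j)) = 0"
      using final_vec_junk_kraus[OF ij(1)] by (intro sum_list_neutral) (auto)
    have "final_state d the_protocol \<rho> (honest_user K) 1 $$ (i, j) =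
        (\<Sum>y\<leftarrow>[(A, p). A \<leftarrow> map diag_kraus (decode_failure d N n), p \<leftarrow> queries (honest_user K)].
          final_vec (honest_user K) \<rho> y i * cnj (final_vec (honest_user K) \<rho> y j)) +
        (\<Sum>y\<leftarrow>[(A, p). A \<leftarrow> map junk_kraus junk_indices, p \<leftarrow> queries (honest_user K)].
          final_vec (honest_user K) \<rho> y i * cnj (final_vec (honest_user K) \<rho> y j))"
      using ij by (simp add: final_state_outer[OF honest_user_strategy] outer_index final_index_def
          dec_honest comp_def)
    also have "\<dots> = of_real (1 / M) * (of_real ((?m - ?w) ^ n) * of_bool (i = 0 \<and> j = 0))"
      unfolding junk add_0_right
      by (rule honest_gram[OF K ij]) (simp only: phase dim decode_out(2)[OF _ dN enc ij])
    finally show "final_state d the_protocol \<rho> (honest_user K) 1 $$ (i, j) =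
        (of_real (fail_ratio (\<rho> K) ^ n) \<cdot>\<^sub>m basis_state d 0) $$ (i, j)"
      unfolding val1 using ij by (simp add: basis_state_def)
  qed (simp_all add: final_state_outer[OF honest_user_strategy] outer_def basis_state_def)
qed

lemma honest_outcome:
  assumes fin: "final_state d the_protocol \<rho> (honest_user K) x = of_real p \<cdot>\<^sub>m \<omega>" and \<omega>: "density d \<omega>"
  shows "outcome_prob d the_protocol \<rho> (honest_user K) x = p"
    and "output_state d the_protocol \<rho> (honest_user K) x = of_real p \<cdot>\<^sub>m \<omega>"
proof -
  have c: "\<omega> \<in> carrier_mat d d" "mtrace \<omega> = 1" using \<omega> by (simp_all add: density_def)
  then have "mtrace (of_real p \<cdot>\<^sub>m \<omega>) = of_real p * mtrace \<omega>"
    by (simp add: mtrace_def flip: sum_distrib_left)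
  then show "outcome_prob d the_protocol \<rho> (honest_user K) x = p"
    using c by (simp add: outcome_prob_def fin)
  show "output_state d the_protocol \<rho> (honest_user K) x = of_real p \<cdot>\<^sub>m \<omega>"
    unfolding output_state_def fin protocol_simps by (rule ptrace_one) (use c in simp)
qed

lemma protocol_alpha_correct:
  assumes \<alpha>: "(1 - 1 / (8 * real N)) ^ n \<le> 1 - \<alpha>"
  shows "alpha_correct \<alpha> d f the_protocol"
  unfolding alpha_correct_def protocol_simps
proof (intro ballI)
  fix K \<rho> assume K: "K \<in> {1..f}" and \<rho>: "\<rho> \<in> messages d f"
  have dens: "density d (\<rho> K)" using K \<rho> by (simp add: messages_def)
  let ?X = "{x. x < 2 \<and> outputs d the_protocol \<rho> (honest_user K) x (\<rho> K)}"
  let ?p = "\<lambda>x. outcome_prob d the_protocol \<rho> (honest_user K) x"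
  note b = fail_ratio_bounds[OF dens]
  have d0: "density d (basis_state d 0)" using d by (intro density_basis_state) simp
  have p0: "?p 0 = 1 - fail_ratio (\<rho> K) ^ n"
    by (rule honest_outcome(1)[OF honest_final_state(1)[OF K \<rho>] dens])
  have p1: "?p 1 = fail_ratio (\<rho> K) ^ n"
    by (rule honest_outcome(1)[OF honest_final_state(2)[OF K \<rho>] d0])
  have "0 \<in> ?X"
    using honest_outcome(2)[OF honest_final_state(1)[OF K \<rho>] dens] p0 by (simp add: outputs_def)
  moreover have "0 \<le> ?p x" if "x \<in> ?X - {0}" for x
  proof -
    have "x = 1" using that by auto
    then show ?thesis using p1 b by simp
  qed
  ultimately have "?p 0 \<le> (\<Sum>x\<in>?X. ?p x)"
    by (intro member_le_sum) auto
  moreover have "fail_ratio (\<rho> K) ^ n \<le> (1 - 1 / (8 * real N)) ^ n"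
    using b by (intro power_mono) auto
  ultimately show "\<alpha> \<le> (\<Sum>x\<in>?X. ?p x)" using \<alpha> p0 by linarith
qed

text \<open>For the message |1><1| success outputs |1><1| and failure |0><0|, both with positive
  probability; the entry \<open>(1, 1)\<close> shows that no single state fits both.\<close>

lemma protocol_not_deterministic:
  assumes f: "1 \<le> f"
  shows "\<not> deterministic d f the_protocol"
proof
  assume det: "deterministic d f the_protocol"
  define \<rho> where "\<rho> = (\<lambda>_::nat. basis_state d 1)"
  have dens: "density d (basis_state d 1)" "density d (basis_state d 0)"
    using d by (auto intro!: density_basis_state)
  have K: "1 \<in> {1..f}" using f by simp
  have \<rho>: "\<rho> \<in> messages d f" using dens(1) by (simp add: messages_def \<rho>_def)
  obtain \<omega> where \<omega>: "\<And>x. x < 2 \<Longrightarrow> outputs d the_protocol \<rho> (honest_user 1) x \<omega>" "density d \<omega>"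
    using det K \<rho> unfolding deterministic_def protocol_simps by blast
  note b = fail_ratio_bounds[OF dens(1)]
  define r where "r = fail_ratio (basis_state d 1) ^ n"
  have r: "0 < r" "r < 1"
  proof -
    show "0 < r" using b(1) by (simp add: r_def)
    have "0 < 1 / (8 * real N)" using d N by simp
    then have "fail_ratio (basis_state d 1) < 1" using b(2) by linarith
    then show "r < 1" using b(1) n power_strict_mono[of "fail_ratio (basis_state d 1)" 1 n]
      by (simp add: r_def)
  qed
  have one: "1 < d" "\<omega> \<in> carrier_mat d d" using d \<omega>(2) by (simp_all add: density_def)
  have \<rho>1: "\<rho> 1 = basis_state d 1" by (simp add: \<rho>_def)
  note fin = honest_final_state[OF K \<rho>, unfolded \<rho>1 r_def[symmetric]]
  have "of_real (1 - r) \<cdot>\<^sub>m basis_state d 1 = of_real (1 - r) \<cdot>\<^sub>m \<omega>"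
    using \<omega>(1)[of 0] unfolding outputs_def honest_outcome[OF fin(1) dens(1)] by simp
  from arg_cong[OF this, of "\<lambda>A. A $$ (1, 1)"]
  have "of_real (1 - r) * \<omega> $$ (1, 1) = of_real (1 - r)" using one by simp
  then have "\<omega> $$ (1, 1) = 1" using r by (simp flip: of_real_diff)
  moreover have "of_real r \<cdot>\<^sub>m basis_state d 0 = of_real r \<cdot>\<^sub>m \<omega>"
    using \<omega>(1)[of 1] unfolding outputs_def honest_outcome[OF fin(2) dens(2)] by simp
  from arg_cong[OF this, of "\<lambda>A. A $$ (1, 1)"] have "\<omega> $$ (1, 1) = 0"
    using r one by simp
  ultimately show False by simp
qed

lemma protocol_valid: "tqot_protocol d f the_protocol"
  using phase_server_strategy honest_user_strategy
  by (simp add: tqot_protocol_def one_round_def)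

lemma protocol_complexity: "upload_bits the_protocol = 2 * f" "download_qubits the_protocol = 2 * e"
  by (simp_all add: upload_bits_def download_qubits_def)

end

section \<open>Choice of the parameters\<close>

lemma power_of_two_between:
  assumes "1 \<le> k"
  shows "\<exists>b. k \<le> 2 ^ b \<and> 2 ^ b \<le> 2 * (k::nat)"
  using assms
proof (induction k rule: dec_induct)
  case base
  show ?case by (rule exI[of _ 0]) simp
next
  case (step k)
  then obtain b where b: "k \<le> 2 ^ b" "2 ^ b \<le> 2 * k" by blast
  show ?case
  proof (cases "Suc k \<le> 2 ^ b")
    case True
    then show ?thesis using b by (intro exI[of _ b]) simp
  next
    case False
    then show ?thesis using b step by (intro exI[of _ "Suc b"]) simp
  qed
qed

text \<open>By \<open>1 - x \<le> exp (- x)\<close>, \<open>n\<close> failures in a row have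
  probability at most \<open>exp (- n / (8 * N))\<close>.\<close>

lemma trial_failure_le:
  fixes \<alpha> :: real
  assumes "\<alpha> < 1" "1 \<le> N" and n: "8 * real N * ln (1 / (1 - \<alpha>)) \<le> n"
  shows "(1 - 1 / (8 * real N)) ^ n \<le> 1 - \<alpha>"
proof -
  have "1 - 1 / (8 * real N) \<le> exp (- (1 / (8 * real N)))"
    using exp_ge_add_one_self[of "- (1 / (8 * real N))"] by simp
  moreover have "0 \<le> 1 - 1 / (8 * real N)" using assms(2) by simp
  ultimately have "(1 - 1 / (8 * real N)) ^ n \<le> exp (- (1 / (8 * real N))) ^ n"
    by (intro power_mono)
  also have "\<dots> = exp (- (n / (8 * real N)))"
    by (simp add: exp_of_nat_mult[symmetric])
  also have "\<dots> \<le> exp (- ln (1 / (1 - \<alpha>)))"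
    using n assms(2) by (simp add: field_simps)
  also have "\<dots> = 1 - \<alpha>" using assms(1) by (simp add: ln_div)
  finally show ?thesis .
qed

theorem theorem1:
  fixes \<alpha> :: real
  assumes "0 < \<alpha>" and "\<alpha> < 1"
  shows "\<exists>D E :: nat \<Rightarrow> real.
    D \<in> O(\<lambda>d. real d ^ 2) \<and> E \<in> O(\<lambda>d. real d ^ 2) \<and>
    (\<exists>d0 f0. \<forall>d\<ge>d0. \<forall>f\<ge>f0. \<exists>P.
       tqot_protocol d f P \<and> \<not> deterministic d f P \<and> alpha_correct \<alpha> d f P \<and>
       upload_bits P = 2 * f \<and> real (download_qubits P) \<le> D d \<and>
       user_secret f P \<and> server_secret d f P \<and>
       real (ebits P) \<le> E d)"
proof -
  define L where "L = ln (1 / (1 - \<alpha>))"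
  have L: "0 \<le> L" using assms by (simp add: L_def ln_ge_zero)
  \<comment> \<open>Relative to \<open>d\<close>, the factor 10 bounds the qubits per trial and
    \<open>32 * L + 2\<close> the number of trials.\<close>
  define c where "c = (32 * L + 2) * 10"
  have "\<exists>P. tqot_protocol d f P \<and> \<not> deterministic d f P \<and> alpha_correct \<alpha> d f P \<and>
       upload_bits P = 2 * f \<and> real (download_qubits P) \<le> 2 * c * real d ^ 2 \<and>
       user_secret f P \<and> server_secret d f P \<and> real (ebits P) \<le> c * real d ^ 2"
    if d: "2 \<le> d" and f: "1 \<le> f" for d f
  proof -
    obtain b where b: "2 * d \<le> 2 ^ b" "2 ^ b \<le> 2 * (2 * d)"
      using power_of_two_between[of "2 * d"] d by auto
    define N :: nat where "N = 2 ^ b"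
    \<comment> \<open>The number of trials required by \<open>trial_failure_le\<close>;
      \<open>Suc\<close> supplies \<open>1 \<le> n\<close>.\<close>
    define n where "n = Suc (nat \<lceil>8 * real N * L\<rceil>)"
    \<comment> \<open>A trial index has \<open>4 * N * N = 2 ^ (2 * b + 2)\<close> values and so
      occupies \<open>2 * b + 2\<close> qubits.\<close>
    define e where "e = (2 * b + 2) * n"
    have N_bounds: "2 * d \<le> N" "real N \<le> 4 * real d"
      using b(1) of_nat_mono[OF b(2), where 'a = real] by (simp_all add: N_def)
    have "0 \<le> 8 * real N * L" using L by simp
    then have n_bounds: "8 * real N * L \<le> n" "real n \<le> 8 * real N * L + 2"
      unfolding n_def by linarith+
    have dim: "2 ^ e = trial_dim N ^ n"
    proof -
      have "trial_dim N = 2 ^ (2 * b + 2)"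
        by (simp add: trial_dim_def N_def power_add mult_2)
      then show ?thesis by (simp only: e_def power_mult)
    qed
    interpret phase_protocol d N n f e
      by unfold_locales (use d N_bounds dim in \<open>simp_all add: n_def\<close>)
    have "(1 - 1 / (8 * real N)) ^ n \<le> 1 - \<alpha>"
      by (rule trial_failure_le) (use assms n_bounds(1) N_bounds d in \<open>simp_all add: L_def\<close>)
    then have correct: "alpha_correct \<alpha> d f the_protocol" by (rule protocol_alpha_correct)
    \<comment> \<open>The logarithm \<open>b\<close> of \<open>N\<close> is bounded crudely by
      \<open>N\<close> itself, which is enough for a quadratic total.\<close>
    have "real b \<le> 4 * real d"
      using N_bounds(2) less_exp[of b] unfolding N_def by linarith
    then have "real (2 * b + 2) \<le> 10 * real d" using d by simp
    moreover have "real n \<le> (32 * L + 2) * real d"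
    proof -
      have "8 * real N * L \<le> 8 * (4 * real d) * L" using N_bounds L by (intro mult_right_mono) auto
      then show ?thesis using n_bounds(2) d by (simp add: algebra_simps)
    qed
    ultimately have "real (2 * b + 2) * real n \<le> (10 * real d) * ((32 * L + 2) * real d)"
      by (intro mult_mono) auto
    then have e: "real e \<le> c * real d ^ 2"
      by (simp add: e_def c_def power2_eq_square algebra_simps)
    show ?thesis
      using protocol_valid protocol_not_deterministic[OF f] correct protocol_complexity
        protocol_user_secret protocol_server_secret e
      by (intro exI[of _ the_protocol]) simp
  qed
  then show ?thesis
    by (intro exI[of _ "\<lambda>d. 2 * c * real d ^ 2"] exI[of _ "\<lambda>d. c * real d ^ 2"] conjI
        exI[of _ 2] exI[of _ 1]) auto
qed

end
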